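(* Let $d\in\mathbb{N}$, $L=(L_1,\dots,L_d)\in\mathbb{N}^d$, $C_0=\{0,\dots,L_1-1\}\times\cdots\times\{0,\dots,L_d-1\}\subset\mathbb{Z}^d$, and $f:C_0\to(0,\infty)$, extended by zero to $\mathbb{Z}^d$. For $n\in\mathbb{Z}^d$ write $nL=(n_1L_1,\dots,n_dL_d)$. Let $(\omega_n)_{n\in\mathbb{Z}^d}$ be i.i.d. real random variables with distribution $\mu$ absolutely continuous with bounded, compactly supported density. On $\ell^2(\mathbb{Z}^d)$ define $$H^B_\omega=h_0+\sum_{n\in\mathbb{Z}^d}\omega_n f(\cdot-nL),$$ where $(h_0u)(n)=\sum_{m:|m-n|=1}u(m)$ is the discrete Laplacian and $f(\cdot-nL)$ acts as a multiplication operator. Suppose one of the following holds: (i) $d$ and $C_0$ are arbitrary and $f$ is injective, i.e. $f(j)\neq f(k)$ for all $j\neq k$ in $C_0$; or (ii) $d$ is arbitrary, $C_0=\{0,\dots,L_1-1\}\times\{0\}\times\cdots\times\{0\}$ (i.e. $L_2=\dots=L_d=1$) with $L_1\in\mathbb{N}$ arbitrary, and $f=\chi_{C_0}$; or (iii) $d=2$, $C_0=\{0,1\}\times\{0,1\}$ (i.e. $L=(2,2)$), and $f=\chi_{C_0}$. Then for almost every $\omega$, all eigenvalues of $H^B_\omega$ are simple.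
   Context: $\chi_{C_0}$ denotes the indicator function of $C_0$. "Almost every $\omega$" refers to the product measure $\bigotimes_n\mu$. *)

theory Defs
  imports "HOL-Probability.Probability"
begin

definition Zd :: "nat \<Rightarrow> (nat \<Rightarrow> int) set" where
  "Zd d = {x. \<forall>i\<ge>d. x i = 0}"

text \<open>The unit cell C_0 = {0..L_1-1} x ... x {0..L_d-1} (indices shifted to 0..d-1).\<close>
definition C0 :: "nat \<Rightarrow> (nat \<Rightarrow> nat) \<Rightarrow> (nat \<Rightarrow> int) set" where
  "C0 d L = {x. (\<forall>i<d. 0 \<le> x i \<and> x i < int (L i)) \<and> (\<forall>i\<ge>d. x i = 0)}"

definition shiftL :: "(nat \<Rightarrow> nat) \<Rightarrow> (nat \<Rightarrow> int) \<Rightarrow> (nat \<Rightarrow> int) \<Rightarrow> (nat \<Rightarrow> int)" where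
  "shiftL L n k = (\<lambda>i. n i - k i * int (L i))"

text \<open>Random potential V_omega(n) = sum_k omega_k f(n - kL); only finitely many
  (in fact exactly one) k contribute, since f vanishes outside C_0.\<close>
definition potential ::
  "nat \<Rightarrow> (nat \<Rightarrow> nat) \<Rightarrow> ((nat \<Rightarrow> int) \<Rightarrow> real) \<Rightarrow> ((nat \<Rightarrow> int) \<Rightarrow> real)
     \<Rightarrow> (nat \<Rightarrow> int) \<Rightarrow> real" where
  "potential d L f \<omega> n =
     (\<Sum>k\<in>{k\<in>Zd d. shiftL L n k \<in> C0 d L}. \<omega> k * f (shiftL L n k))"

definition nbrs :: "nat \<Rightarrow> (nat \<Rightarrow> int) \<Rightarrow> (nat \<Rightarrow> int) set" where
  "nbrs d n = {m\<in>Zd d. (\<Sum>i<d. \<bar>m i - n i\<bar>) = 1}"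

definition HB ::
  "nat \<Rightarrow> (nat \<Rightarrow> nat) \<Rightarrow> ((nat \<Rightarrow> int) \<Rightarrow> real) \<Rightarrow> ((nat \<Rightarrow> int) \<Rightarrow> real)
     \<Rightarrow> ((nat \<Rightarrow> int) \<Rightarrow> complex) \<Rightarrow> (nat \<Rightarrow> int) \<Rightarrow> complex" where
  "HB d L f \<omega> u n = (\<Sum>m\<in>nbrs d n. u m) + complex_of_real (potential d L f \<omega> n) * u n"

definition in_l2 :: "nat \<Rightarrow> ((nat \<Rightarrow> int) \<Rightarrow> complex) \<Rightarrow> bool" where
  "in_l2 d u \<longleftrightarrow> (\<lambda>n. (cmod (u n))\<^sup>2) summable_on Zd d"

definition is_eigenvector ::
  "nat \<Rightarrow> (nat \<Rightarrow> nat) \<Rightarrow> ((nat \<Rightarrow> int) \<Rightarrow> real) \<Rightarrow> ((nat \<Rightarrow> int) \<Rightarrow> real)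
     \<Rightarrow> real \<Rightarrow> ((nat \<Rightarrow> int) \<Rightarrow> complex) \<Rightarrow> bool" where
  "is_eigenvector d L f \<omega> E u \<longleftrightarrow>
     in_l2 d u \<and> (\<exists>n\<in>Zd d. u n \<noteq> 0) \<and>
     (\<forall>n\<in>Zd d. HB d L f \<omega> u n = complex_of_real E * u n)"

definition all_eigenvalues_simple ::
  "nat \<Rightarrow> (nat \<Rightarrow> nat) \<Rightarrow> ((nat \<Rightarrow> int) \<Rightarrow> real) \<Rightarrow> ((nat \<Rightarrow> int) \<Rightarrow> real) \<Rightarrow> bool" where
  "all_eigenvalues_simple d L f \<omega> \<longleftrightarrow>
     (\<forall>E u v. is_eigenvector d L f \<omega> E u \<and> is_eigenvector d L f \<omega> E v \<longrightarrow>
        (\<exists>c::complex. \<forall>n\<in>Zd d. v n = c * u n))"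

end

theory Submission
  imports Defs "HOL-Complex_Analysis.Complex_Analysis"
    "HOL-Computational_Algebra.Fundamental_Theorem_Algebra"
begin

text \<open>
  Fix a cell, let l be its coupling constant and write the operator as A + l P, where P is the
  finite-rank multiplication by f on the cell and A does not depend on l. Two eigenvectors with
  data (E, l) and (E', l') satisfy (E - E') <v, u> = (l - l') <v, P u>, so on countably many pieces
  l is a Lipschitz function of E, and Lebesgue-null sets of energies only arise from null sets of
  couplings. If E is degenerate, some eigenvector u at E is orthogonal on the cell to a prescribed
  e. Either u vanishes on the cell, and then E is one of the countably many eigenvalues of A; or the
  restriction of u annihilates, as z tends to E, all Krylov vectors of e under the cell block of the
  resolvent of the dissipative operator A - i P. These are bounded holomorphic functions of z, so by
  Jensen's inequality this happens only for a null set of E, unless the Krylov vectors fail to span at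
  some z with large imaginary part, that is, unless there A + c P has a complex-energy eigenvector
  orthogonal to e on the cell. At large imaginary energy such a mode is governed by the cell alone in
  cases (i) and (ii). In case (iii) the square has a two-fold eigenvalue 0, which is split at third
  order in the inverse energy by the couplings of the four adjacent cells, provided that the sums of
  the opposite ones differ. Finally, for fixed cell the exceptional set is a countable union of
  projections of compact sets, hence measurable, and Fubini's theorem applies.
\<close>

section \<open>The Hilbert space of square-summable functions\<close>

text \<open>Testing the eigenvalue equation of A + l P against the resolvent of A - i P makes the
  weighted restriction of the eigenvector to the cell an approximate left eigenvector of the cell
  block, with eigenvalue -1 / (l + i) and an error that vanishes as z tends to E. Orthogonality to e
  thus passes from each Krylov vector to the next and l drops out: one null set of energies serves
  all couplings, as the Lipschitz transfer requires. The coupling -i is used because dissipation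
  alone bounds the cell block up to the real axis, whatever the spectrum of A. Spanning is tested at
  one point only, which the Cayley parameter moves to the centre of the disc; far up the imaginary
  axis hopping merely perturbs the isolated cell. There e must be cyclic: the constant for injective
  f, an end point of a segment, a corner of the square. If the surroundings share the reflection
  that fixes the corner, antisymmetric modes vanish there; hence the condition on neighbouring
  couplings in that case alone.\<close>

typedef 'a ell2 = "{u :: 'a \<Rightarrow> complex. (\<lambda>i. (cmod (u i))\<^sup>2) summable_on UNIV}"
  morphisms coord ell2_of
  by (rule exI[of _ "\<lambda>_. 0"]) simp

lemma coord_ell2_of:
  "(\<lambda>i. (cmod (u i))\<^sup>2) summable_on UNIV \<Longrightarrow> coord (ell2_of u) = u"
  by (simp add: ell2_of_inverse)

lemma coord_square_summable: "(\<lambda>i. (cmod (coord u i))\<^sup>2) summable_on UNIV"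
  using coord by auto

lemma ell2_eqI: "(\<And>i. coord u i = coord v i) \<Longrightarrow> u = v"
  by (metis coord_inject ext)

lemma square_summable_bounded:
  assumes "\<And>i. cmod (u i) \<le> K * cmod (v i)" "(\<lambda>i. (cmod (v i))\<^sup>2) summable_on UNIV"
  shows "(\<lambda>i. (cmod (u i))\<^sup>2) summable_on UNIV"
proof (rule summable_on_comparison_test)
  show "(\<lambda>i. K\<^sup>2 * (cmod (v i))\<^sup>2) summable_on UNIV"
    using assms(2) by (rule summable_on_cmult_right)
  show "(cmod (u i))\<^sup>2 \<le> K\<^sup>2 * (cmod (v i))\<^sup>2" for i
    using power_mono[OF assms(1)[of i], of 2] by (simp add: power_mult_distrib)
qed auto

lemma square_summable_add:
  assumes "(\<lambda>i. (cmod (u i))\<^sup>2) summable_on UNIV" "(\<lambda>i. (cmod (v i))\<^sup>2) summable_on UNIV"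
  shows "(\<lambda>i. (cmod (u i + v i))\<^sup>2) summable_on UNIV"
proof (rule summable_on_comparison_test)
  show "(\<lambda>i. 2 * (cmod (u i))\<^sup>2 + 2 * (cmod (v i))\<^sup>2) summable_on UNIV"
    by (intro summable_on_add summable_on_cmult_right assms)
  show "(cmod (u i + v i))\<^sup>2 \<le> 2 * (cmod (u i))\<^sup>2 + 2 * (cmod (v i))\<^sup>2" for i
  proof -
    have "(cmod (u i + v i))\<^sup>2 \<le> (cmod (u i) + cmod (v i))\<^sup>2"
      by (intro power_mono norm_triangle_ineq) auto
    then show ?thesis
      using sum_squares_bound[of "cmod (u i)" "cmod (v i)"] by (simp add: power2_sum)
  qed
qed auto

lemma abs_summable_cnj_mult:
  assumes "(\<lambda>i. (cmod (u i))\<^sup>2) summable_on UNIV" "(\<lambda>i. (cmod (v i))\<^sup>2) summable_on UNIV"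
  shows "(\<lambda>i. norm (cnj (u i) * v i)) summable_on UNIV"
proof (rule summable_on_comparison_test)
  show "(\<lambda>i. (cmod (u i))\<^sup>2 + (cmod (v i))\<^sup>2) summable_on UNIV"
    by (intro summable_on_add assms)
  show "norm (cnj (u i) * v i) \<le> (cmod (u i))\<^sup>2 + (cmod (v i))\<^sup>2" for i
  proof -
    have "0 \<le> cmod (u i) * cmod (v i)" by simp
    then show ?thesis
      using sum_squares_bound[of "cmod (u i)" "cmod (v i)"]
      unfolding norm_mult complex_mod_cnj by linarith
  qed
qed auto

instantiation ell2 :: (type) real_vector
begin

definition "0 = ell2_of (\<lambda>_. 0)"
definition "u + v = ell2_of (\<lambda>i. coord u i + coord v i)"
definition "- u = ell2_of (\<lambda>i. - coord u i)"
definition "u - v = u + - (v :: 'a ell2)"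
definition "scaleR r u = ell2_of (\<lambda>i. complex_of_real r * coord u i)"

lemma coord_zero [simp]: "coord 0 i = 0"
  by (simp add: zero_ell2_def coord_ell2_of)

lemma coord_add [simp]: "coord (u + v) i = coord u i + coord v i"
  by (simp add: plus_ell2_def coord_ell2_of square_summable_add coord_square_summable)

lemma coord_uminus [simp]: "coord (- u) i = - coord u i"
  by (simp add: uminus_ell2_def coord_ell2_of coord_square_summable)

lemma coord_diff [simp]: "coord (u - v) i = coord u i - coord v i"
  by (simp add: minus_ell2_def)

lemma coord_scaleR [simp]: "coord (scaleR r u) i = complex_of_real r * coord u i"
  unfolding scaleR_ell2_def
  by (subst coord_ell2_of, rule square_summable_bounded[where v = "coord u" and K = "\<bar>r\<bar>"])
    (auto simp: norm_mult coord_square_summable)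

instance
  by standard (auto intro!: ell2_eqI simp: algebra_simps)

end

definition cinner :: "'a ell2 \<Rightarrow> 'a ell2 \<Rightarrow> complex" where
  "cinner u v = (\<Sum>\<^sub>\<infinity>i. cnj (coord u i) * coord v i)"

lemma cinner_summable: "(\<lambda>i. cnj (coord u i) * coord v i) summable_on UNIV"
  by (rule Infinite_Sum.abs_summable_summable)
    (rule abs_summable_cnj_mult[OF coord_square_summable coord_square_summable])

lemma cinner_commute: "cinner v u = cnj (cinner u v)"
  unfolding cinner_def by (subst infsum_cnj[symmetric]) (simp add: mult.commute)

lemma cinner_add_left: "cinner (u + v) w = cinner u w + cinner v w"
  unfolding cinner_def
  by (simp add: distrib_right infsum_add cinner_summable)

lemma cinner_scaleR_left: "cinner (scaleR r u) w = complex_of_real r * cinner u w"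
  unfolding cinner_def
  by (simp add: mult.assoc infsum_cmult_right' )

lemma cinner_self: "cinner u u = complex_of_real (\<Sum>\<^sub>\<infinity>i. (cmod (coord u i))\<^sup>2)"
proof -
  have "cnj (coord u i) * coord u i = complex_of_real ((cmod (coord u i))\<^sup>2)" for i
    by (simp only: complex_norm_square mult.commute)
  then show ?thesis
    unfolding cinner_def
    by (simp del: of_real_power)
      (rule infsumI, rule has_sum_bounded_linear[OF bounded_linear_of_real],
       simp add: coord_square_summable)
qed

instantiation ell2 :: (type) real_inner
begin

definition "inner u v = Re (cinner u v)"
definition "norm u = sqrt (inner u (u :: 'a ell2))"
definition "sgn u = inverse (norm u) *\<^sub>R (u :: 'a ell2)"
definition "dist u v = norm (u - v :: 'a ell2)"
definition "uniformity = (INF e\<in>{0<..}. principal {(x, y). dist x (y :: 'a ell2) < e})"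
definition "open (U :: 'a ell2 set) \<longleftrightarrow> (\<forall>x\<in>U. \<forall>\<^sub>F (x', y) in uniformity. x' = x \<longrightarrow> y \<in> U)"

instance
proof
  fix u v w :: "'a ell2" and r :: real
  show "inner u v = inner v u"
    unfolding inner_ell2_def by (subst cinner_commute) simp
  show "inner (u + v) w = inner u w + inner v w"
    by (simp add: inner_ell2_def cinner_add_left)
  show "inner (scaleR r u) v = r * inner u v"
    by (simp add: inner_ell2_def cinner_scaleR_left)
  show "0 \<le> inner u u"
    by (simp add: inner_ell2_def cinner_self infsum_nonneg)
  show "inner u u = 0 \<longleftrightarrow> u = 0"
  proof
    assume "inner u u = 0"
    then have "(\<Sum>\<^sub>\<infinity>i. (cmod (coord u i))\<^sup>2) = 0"
      by (simp add: inner_ell2_def cinner_self)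
    then have "(cmod (coord u i))\<^sup>2 = 0" for i
      using nonneg_infsum_le_0D[of "\<lambda>i. (cmod (coord u i))\<^sup>2" UNIV i]
      by (simp add: coord_square_summable)
    then show "u = 0" by (auto intro: ell2_eqI)
  qed (simp add: inner_ell2_def cinner_self)
qed (fact norm_ell2_def sgn_ell2_def dist_ell2_def uniformity_ell2_def open_ell2_def)+

end

lemma norm_ell2_square: "(norm u)\<^sup>2 = (\<Sum>\<^sub>\<infinity>i. (cmod (coord u i))\<^sup>2)"
  by (simp add: power2_norm_eq_inner inner_ell2_def cinner_self)

lemma sum_coord_le_norm:
  assumes "finite F"
  shows "(\<Sum>i\<in>F. (cmod (coord u i))\<^sup>2) \<le> (norm u)\<^sup>2"
  unfolding norm_ell2_square
  by (rule finite_sum_le_infsum) (auto simp: assms coord_square_summable)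

lemma coord_le_norm: "cmod (coord u i) \<le> norm u"
proof -
  have "(cmod (coord u i))\<^sup>2 \<le> (norm u)\<^sup>2"
    using sum_coord_le_norm[of "{i}" u] by simp
  then show ?thesis by (rule power2_le_imp_le) simp
qed

lemma bounded_linear_coord: "bounded_linear (\<lambda>u. coord u i)"
  by (rule bounded_linear_intro[of _ 1]) (auto simp: coord_le_norm scaleR_conv_of_real)

lemma square_summable_bound:
  assumes "\<And>F. finite F \<Longrightarrow> (\<Sum>i\<in>F. (cmod (u i))\<^sup>2) \<le> B"
  shows "(\<lambda>i. (cmod (u i))\<^sup>2) summable_on UNIV" "(\<Sum>\<^sub>\<infinity>i. (cmod (u i))\<^sup>2) \<le> B"
proof -
  show "(\<lambda>i. (cmod (u i))\<^sup>2) summable_on UNIV"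
    by (rule nonneg_bdd_above_summable_on) (use assms in \<open>auto intro!: bdd_aboveI[of _ B]\<close>)
  then show "(\<Sum>\<^sub>\<infinity>i. (cmod (u i))\<^sup>2) \<le> B"
    by (rule infsum_le_finite_sums) (use assms in auto)
qed

text \<open>The coordinatewise limit is the candidate. Cauchy bounds are stated for sums over finite
  sets, which survive coordinatewise limits; the supremum over finite sets then restores the
  norm.\<close>

instance ell2 :: (type) banach
proof
  fix X :: "nat \<Rightarrow> 'a ell2"
  assume X: "Cauchy X"
  have "Cauchy (\<lambda>n. coord (X n) i)" for i
    by (rule bounded_linear.Cauchy[OF bounded_linear_coord X])
  then have "\<exists>x. (\<lambda>n. coord (X n) i) \<longlonglongrightarrow> x" for i
    by (simp add: Cauchy_convergent convergent_def[symmetric])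
  then obtain x where x: "\<And>i. (\<lambda>n. coord (X n) i) \<longlonglongrightarrow> x i" by metis
  have tail: "\<exists>N. \<forall>n\<ge>N. \<forall>F. finite F \<longrightarrow> (\<Sum>i\<in>F. (cmod (coord (X n) i - x i))\<^sup>2) \<le> e\<^sup>2" if "e > 0" for e
  proof -
    obtain N where N: "\<And>m n. m \<ge> N \<Longrightarrow> n \<ge> N \<Longrightarrow> norm (X n - X m) < e"
      using X \<open>e > 0\<close> unfolding Cauchy_iff by metis
    have "(\<Sum>i\<in>F. (cmod (coord (X n) i - x i))\<^sup>2) \<le> e\<^sup>2" if "n \<ge> N" "finite F" for n F
    proof (rule LIMSEQ_le_const2)
      show "(\<lambda>m. \<Sum>i\<in>F. (cmod (coord (X n) i - coord (X m) i))\<^sup>2)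
          \<longlonglongrightarrow> (\<Sum>i\<in>F. (cmod (coord (X n) i - x i))\<^sup>2)"
        by (intro tendsto_intros x)
      show "\<exists>M. \<forall>m\<ge>M. (\<Sum>i\<in>F. (cmod (coord (X n) i - coord (X m) i))\<^sup>2) \<le> e\<^sup>2"
      proof (intro exI allI impI)
        fix m assume "m \<ge> N"
        have "(\<Sum>i\<in>F. (cmod (coord (X n) i - coord (X m) i))\<^sup>2) \<le> (norm (X n - X m))\<^sup>2"
          using sum_coord_le_norm[OF \<open>finite F\<close>, of "X n - X m"] by simp
        also have "\<dots> \<le> e\<^sup>2"
          using N[OF \<open>m \<ge> N\<close> \<open>n \<ge> N\<close>] by (intro power_mono) auto
        finally show "(\<Sum>i\<in>F. (cmod (coord (X n) i - coord (X m) i))\<^sup>2) \<le> e\<^sup>2" .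
      qed
    qed
    then show ?thesis by blast
  qed
  obtain N where N: "\<And>F. finite F \<Longrightarrow> (\<Sum>i\<in>F. (cmod (coord (X N) i - x i))\<^sup>2) \<le> 1"
    using tail[of 1] by auto
  have "(\<lambda>i. (cmod (- (coord (X N) i - x i)))\<^sup>2) summable_on UNIV"
    using square_summable_bound(1)[OF N] by (simp add: norm_minus_commute)
  from square_summable_add[OF coord_square_summable[of "X N"] this]
  have sx: "(\<lambda>i. (cmod (x i))\<^sup>2) summable_on UNIV" by simp
  have "X \<longlonglongrightarrow> ell2_of x"
  proof (rule LIMSEQ_I)
    fix e :: real assume "e > 0"
    then obtain N where
      N: "\<And>n F. n \<ge> N \<Longrightarrow> finite F \<Longrightarrow> (\<Sum>i\<in>F. (cmod (coord (X n) i - x i))\<^sup>2) \<le> (e/2)\<^sup>2"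
      using tail[of "e/2"] by auto
    have "norm (X n - ell2_of x) < e" if "n \<ge> N" for n
    proof -
      have "(norm (X n - ell2_of x))\<^sup>2 \<le> (e/2)\<^sup>2"
        unfolding norm_ell2_square
        using square_summable_bound(2)[OF N[OF that]] by (simp add: coord_ell2_of sx)
      then have "norm (X n - ell2_of x) \<le> e/2"
        by (rule power2_le_imp_le) (use \<open>e > 0\<close> in simp)
      then show ?thesis using \<open>e > 0\<close> by simp
    qed
    then show "\<exists>no. \<forall>n\<ge>no. norm (X n - ell2_of x) < e" by blast
  qed
  then show "convergent X" by (auto simp: convergent_def)
qed

lemma coord_sum: "coord (\<Sum>x\<in>X. g x) i = (\<Sum>x\<in>X. coord (g x) i)"
  by (induction X rule: infinite_finite_induct) auto

definition scaleC :: "complex \<Rightarrow> 'a ell2 \<Rightarrow> 'a ell2" (infixr \<open>*\<^sub>C\<close> 75) where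
  "c *\<^sub>C u = ell2_of (\<lambda>i. c * coord u i)"

lemma coord_scaleC [simp]: "coord (c *\<^sub>C u) i = c * coord u i"
  unfolding scaleC_def
  by (subst coord_ell2_of, rule square_summable_bounded[where v = "coord u" and K = "cmod c"])
    (auto simp: norm_mult coord_square_summable)

lemma scaleC_add_right: "c *\<^sub>C (u + v) = c *\<^sub>C u + c *\<^sub>C v"
  by (rule ell2_eqI) (simp add: algebra_simps)

lemma scaleC_diff_right: "c *\<^sub>C (u - v) = c *\<^sub>C u - c *\<^sub>C v"
  by (rule ell2_eqI) (simp add: algebra_simps)

lemma scaleC_scaleC [simp]: "a *\<^sub>C b *\<^sub>C u = (a * b) *\<^sub>C u"
  by (rule ell2_eqI) (simp add: algebra_simps)

lemma scaleC_one [simp]: "1 *\<^sub>C u = u"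
  by (rule ell2_eqI) simp

lemma scaleC_zero [simp]: "0 *\<^sub>C u = 0" "c *\<^sub>C 0 = 0"
  by (rule ell2_eqI, simp)+

lemma scaleC_of_real: "of_real r *\<^sub>C u = r *\<^sub>R u"
  by (rule ell2_eqI) simp

lemma cinner_add_right: "cinner w (u + v) = cinner w u + cinner w v"
  by (metis cinner_add_left cinner_commute complex_cnj_add)

lemma cinner_scaleC_left: "cinner (c *\<^sub>C u) v = cnj c * cinner u v"
  unfolding cinner_def by (simp add: mult.assoc infsum_cmult_right')

lemma cinner_scaleC_right: "cinner u (c *\<^sub>C v) = c * cinner u v"
  by (metis cinner_commute cinner_scaleC_left complex_cnj_cnj complex_cnj_mult)

lemma cinner_diff_left: "cinner (u - v) w = cinner u w - cinner v w"
  using cinner_add_left[of "u - v" v w] by simp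

lemma cinner_diff_right: "cinner w (u - v) = cinner w u - cinner w v"
  using cinner_add_right[of w "u - v" v] by simp

lemma cinner_self_norm: "cinner u u = complex_of_real ((norm u)\<^sup>2)"
  by (simp add: norm_ell2_square cinner_self)

lemma norm_scaleC: "norm (c *\<^sub>C u) = cmod c * norm u"
proof -
  have "complex_of_real ((norm (c *\<^sub>C u))\<^sup>2) = complex_of_real ((cmod c * norm u)\<^sup>2)"
    unfolding cinner_self_norm[symmetric] cinner_scaleC_left cinner_scaleC_right
    by (simp add: cinner_self_norm power_mult_distrib mult.commute[of _ c] complex_norm_square[symmetric] del: of_real_power)
  then have "(norm (c *\<^sub>C u))\<^sup>2 = (cmod c * norm u)\<^sup>2"
    using of_real_eq_iff by blast
  then show ?thesis by simp
qed

text \<open>Rotating \<open>v\<close> by the phase of \<open>cinner u v\<close> makes the inner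
  product real without changing its modulus, so the real Cauchy-Schwarz inequality applies.\<close>

lemma norm_cinner_le: "cmod (cinner u v) \<le> norm u * norm v"
proof -
  define c where "c = cnj (sgn (cinner u v))"
  have c: "cmod c \<le> 1" by (simp add: c_def norm_sgn)
  have "complex_of_real (cmod (cinner u v)) = c * cinner u v"
    by (auto simp: c_def sgn_div_norm complex_norm_square[symmetric] power2_eq_square
        scaleR_conv_of_real field_simps)
  then have "cmod (cinner u v) = Re (cinner u (c *\<^sub>C v))"
    by (metis Re_complex_of_real cinner_scaleC_right)
  also have "\<dots> \<le> norm u * norm (c *\<^sub>C v)"
    using norm_cauchy_schwarz[of u "c *\<^sub>C v"] by (simp add: inner_ell2_def)
  also have "\<dots> \<le> norm u * norm v"
    using c by (intro mult_left_mono) (auto simp: norm_scaleC mult_left_le_one_le)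
  finally show ?thesis .
qed

definition delta :: "'a \<Rightarrow> 'a ell2" where
  "delta y = ell2_of (\<lambda>i. if i = y then 1 else 0)"

lemma coord_delta: "coord (delta y) i = (if i = y then 1 else 0)"
  unfolding delta_def
proof (subst coord_ell2_of)
  have "(\<lambda>i. (cmod (if i = y then 1 else 0))\<^sup>2) summable_on {y}" by simp
  then show "(\<lambda>i. (cmod (if i = y then 1 else 0))\<^sup>2) summable_on UNIV"
    by (rule summable_on_cong_neutral[THEN iffD1, rotated -1]) auto
qed simp

lemma cinner_finite_support:
  assumes "finite S" "\<And>i. i \<notin> S \<Longrightarrow> coord v i = 0"
  shows "cinner u v = (\<Sum>i\<in>S. cnj (coord u i) * coord v i)"
proof -
  have "cinner u v = (\<Sum>\<^sub>\<infinity>i\<in>S. cnj (coord u i) * coord v i)"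
    unfolding cinner_def by (rule infsum_cong_neutral) (use assms in auto)
  then show ?thesis using assms by simp
qed

lemma cinner_delta: "cinner u (delta y) = cnj (coord u y)"
  by (subst cinner_finite_support[of "{y}"]) (auto simp: coord_delta)

section \<open>Resolvents of finite-rank dissipative perturbations\<close>

lemma bounded_linear_scaleC: "bounded_linear (\<lambda>u. c *\<^sub>C u)"
  by (rule bounded_linear_intro[of _ "cmod c"])
    (auto simp: scaleC_add_right norm_scaleC mult.commute simp flip: scaleC_of_real)

definition mult_op :: "('a \<Rightarrow> real) \<Rightarrow> 'a ell2 \<Rightarrow> 'a ell2" where
  "mult_op g u = ell2_of (\<lambda>i. complex_of_real (g i) * coord u i)"

lemma coord_mult_op:
  assumes "\<And>i. \<bar>g i\<bar> \<le> K"
  shows "coord (mult_op g u) i = complex_of_real (g i) * coord u i"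
  unfolding mult_op_def
  by (subst coord_ell2_of, rule square_summable_bounded[where v = "coord u" and K = K])
    (auto simp: norm_mult coord_square_summable intro: mult_right_mono assms)

lemma norm_le_coordwise:
  assumes "\<And>i. cmod (coord u i) \<le> K * cmod (coord v i)" "0 \<le> K"
  shows "norm u \<le> K * norm v"
proof -
  have "(norm u)\<^sup>2 \<le> (\<Sum>\<^sub>\<infinity>i. K\<^sup>2 * (cmod (coord v i))\<^sup>2)"
    unfolding norm_ell2_square
  proof (rule infsum_mono)
    show "(cmod (coord u i))\<^sup>2 \<le> K\<^sup>2 * (cmod (coord v i))\<^sup>2" for i
      using power_mono[OF assms(1)[of i], of 2] by (simp add: power_mult_distrib)
  qed (auto intro: coord_square_summable summable_on_cmult_right)
  also have "\<dots> = (K * norm v)\<^sup>2"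
    by (simp add: infsum_cmult_right' norm_ell2_square power_mult_distrib)
  finally show ?thesis
    by (rule power2_le_imp_le) (simp add: assms)
qed

lemma bounded_linear_mult_op:
  assumes "\<And>i. \<bar>g i\<bar> \<le> K"
  shows "bounded_linear (mult_op g)"
proof (rule bounded_linear_intro[of _ K])
  have "0 \<le> K" using assms order_trans abs_ge_zero by blast
  then show "norm (mult_op g u) \<le> norm u * K" for u
    using norm_le_coordwise[of "mult_op g u" K u]
    by (simp add: coord_mult_op[OF assms] norm_mult mult_right_mono assms mult.commute)
qed (auto intro!: ell2_eqI simp: coord_mult_op[OF assms] algebra_simps)

lemma mult_op_scaleC:
  assumes "\<And>i. \<bar>g i\<bar> \<le> K"
  shows "mult_op g (c *\<^sub>C u) = c *\<^sub>C mult_op g u"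
  by (rule ell2_eqI) (simp add: coord_mult_op[OF assms])

lemma cinner_mult_op:
  assumes "\<And>i. \<bar>g i\<bar> \<le> K"
  shows "cinner (mult_op g u) v = cinner u (mult_op g v)"
  unfolding cinner_def by (simp add: coord_mult_op[OF assms] algebra_simps)

text \<open>The equation is the fixed point problem u = (T u - v) / (i s), a contraction with factor
  M / s. Only resolvent points far from the spectrum are constructed this way; the rest of the upper
  half-plane is reached by a power series.\<close>

lemma shift_solvable:
  fixes T :: "'a ell2 \<Rightarrow> 'a ell2"
  assumes T: "bounded_linear T" and M: "\<And>u. norm (T u) \<le> M * norm u" "0 \<le> M" "M < s"
  shows "\<exists>u. T u - (\<i> * s) *\<^sub>C u = v"
proof -
  have s: "s > 0" using M by simp
  let ?F = "\<lambda>u. (1 / (\<i> * s)) *\<^sub>C (T u - v)"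
  have "\<exists>!u. ?F u = u"
  proof (rule banach_fix_type[of "M / s"])
    show "\<forall>x y. dist (?F x) (?F y) \<le> M / s * dist x y"
    proof (intro allI)
      fix x y
      have "?F x - ?F y = (1 / (\<i> * s)) *\<^sub>C T (x - y)"
        by (simp add: scaleC_diff_right linear_diff[OF bounded_linear.linear[OF T]])
      then have "dist (?F x) (?F y) = norm (T (x - y)) / s"
        using s by (simp add: dist_norm norm_scaleC norm_divide norm_mult)
      also have "\<dots> \<le> M * norm (x - y) / s"
        using s M by (intro divide_right_mono) auto
      finally show "dist (?F x) (?F y) \<le> M / s * dist x y"
        by (simp add: dist_norm)
    qed
  qed (use M s in auto)
  then obtain u where "?F u = u" by blast
  then have "(\<i> * s) *\<^sub>C ?F u = (\<i> * s) *\<^sub>C u" by simp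
  then have "T u - v = (\<i> * s) *\<^sub>C u" using s by simp
  then show ?thesis by (intro exI[of _ u]) (simp add: algebra_simps)
qed

definition cnj_ell2 :: "'a ell2 \<Rightarrow> 'a ell2" where
  "cnj_ell2 u = ell2_of (\<lambda>i. cnj (coord u i))"

lemma coord_cnj_ell2 [simp]: "coord (cnj_ell2 u) i = cnj (coord u i)"
  by (simp add: cnj_ell2_def coord_ell2_of coord_square_summable)

text \<open>Linearity in \<open>bounded_linear\<close> is over the reals, so commutation with
  complex scalars is stated separately. \<open>A_real\<close> says that A has real matrix entries,
  which makes the kernel of the resolvent symmetric; strict positivity of \<open>f\<close> on
  \<open>S\<close> lets the dissipative term control every coordinate in the cell.\<close>

locale cell_perturbation =
  fixes A :: "'a ell2 \<Rightarrow> 'a ell2" and S :: "'a set" and f :: "'a \<Rightarrow> real"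
  assumes A_bounded: "bounded_linear A"
    and A_scaleC: "A (c *\<^sub>C u) = c *\<^sub>C A u"
    and A_sym: "cinner (A u) v = cinner u (A v)"
    and A_real: "A (cnj_ell2 u) = cnj_ell2 (A u)"
    and finite_S: "finite S"
    and f_pos: "x \<in> S \<Longrightarrow> 0 < f x"
    and f_zero: "x \<notin> S \<Longrightarrow> f x = 0"
begin

lemma f_bounded: "\<bar>f x\<bar> \<le> (\<Sum>y\<in>S. f y)"
proof (cases "x \<in> S")
  case True
  then have "f x \<le> (\<Sum>y\<in>S. f y)"
    by (intro member_le_sum[OF _ _ finite_S]) (auto intro: less_imp_le[OF f_pos])
  then show ?thesis using f_pos[OF True] by simp
qed (auto simp: f_zero intro!: sum_nonneg less_imp_le[OF f_pos])

abbreviation P :: "'a ell2 \<Rightarrow> 'a ell2" where "P \<equiv> mult_op f"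

lemma coord_P: "coord (P u) x = f x * coord u x"
  by (rule coord_mult_op[OF f_bounded])

lemma cinner_P: "cinner u (P v) = (\<Sum>x\<in>S. f x * cnj (coord u x) * coord v x)"
  by (subst cinner_finite_support[OF finite_S]) (auto simp: coord_P f_zero algebra_simps)

lemma P_sym: "cinner (P u) v = cinner u (P v)"
  by (rule cinner_mult_op[OF f_bounded])

lemma P_scaleC: "P (c *\<^sub>C u) = c *\<^sub>C P u"
  by (rule mult_op_scaleC[OF f_bounded])

lemma P_quadratic: "cinner u (P u) = complex_of_real (\<Sum>x\<in>S. f x * (cmod (coord u x))\<^sup>2)"
  unfolding cinner_P
  by (simp add: complex_norm_square mult.assoc mult.commute[of "cnj _"] del: of_real_power)

lemma cinner_A_self: "Im (cinner u (A u)) = 0"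
proof -
  have "cinner u (A u) = cnj (cinner u (A u))"
    using A_sym[of u u] cinner_commute[of "A u" u] by simp
  then show ?thesis by (metis Im_complex_of_real Reals_cases Reals_cnj_iff)
qed

definition T :: "'a ell2 \<Rightarrow> 'a ell2" where "T u = A u - \<i> *\<^sub>C P u"

lemma T_bounded: "bounded_linear T"
  unfolding T_def
  by (intro bounded_linear_sub A_bounded
      bounded_linear_compose[OF bounded_linear_scaleC bounded_linear_mult_op[OF f_bounded]])

lemma T_scaleC: "T (c *\<^sub>C u) = c *\<^sub>C T u"
  by (simp add: T_def A_scaleC P_scaleC scaleC_diff_right mult.commute)

lemma Im_cinner_T: "Im (cinner u (T u)) = - (\<Sum>x\<in>S. f x * (cmod (coord u x))\<^sup>2)"
  by (simp add: T_def cinner_diff_right cinner_scaleC_right cinner_A_self P_quadratic)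

lemma P_form_nonneg: "0 \<le> (\<Sum>x\<in>S. f x * (cmod (coord u x))\<^sup>2)"
  using f_pos by (intro sum_nonneg mult_nonneg_nonneg) (auto intro: less_imp_le)

text \<open>The cross term in both squared norms is s Im <u, T u>, which is nonpositive. This is
  what makes the Cayley transform a contraction.\<close>

lemma dissipative:
  fixes s :: real
  assumes s: "0 \<le> s"
  shows "norm (T u + (\<i> * s) *\<^sub>C u) \<le> norm (T u - (\<i> * s) *\<^sub>C u)"
proof -
  have "inner (T u) ((\<i> * s) *\<^sub>C u) = s * Im (cinner u (T u))"
    unfolding inner_ell2_def
    by (subst cinner_commute) (simp add: cinner_scaleC_left)
  then have "inner (T u) ((\<i> * s) *\<^sub>C u) \<le> 0"
    using s P_form_nonneg[of u] by (simp add: Im_cinner_T)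
  then have "(norm (T u + (\<i> * s) *\<^sub>C u))\<^sup>2 \<le> (norm (T u - (\<i> * s) *\<^sub>C u))\<^sup>2"
    by (simp add: power2_norm_eq_inner inner_add_left inner_add_right inner_diff_left
        inner_diff_right inner_commute)
  then show ?thesis by (rule power2_le_imp_le) simp
qed

text \<open>Imaginary part of the equation paired with \<open>r\<close>. For Im z > 0 both terms on
  the left are nonnegative, so the single coordinate at \<open>y\<close> controls dissipation and
  norm at once.\<close>

lemma resolvent_energy:
  assumes "T r - z *\<^sub>C r = delta y"
  shows "(\<Sum>x\<in>S. f x * (cmod (coord r x))\<^sup>2) + Im z * (norm r)\<^sup>2 = Im (coord r y)"
proof -
  have "cinner r (T r) - z * cinner r r = cnj (coord r y)"
    unfolding cinner_delta[symmetric] assms[symmetric]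
    by (simp add: cinner_diff_right cinner_scaleC_right)
  from arg_cong[OF this, of Im] show ?thesis
    by (simp add: Im_cinner_T cinner_self_norm)
qed

text \<open>The energy identity bounds f y |r y|^2 by |r y|, which gives a bound free of z. Its
  second term gives norm r = O((Im z)^(-1/2)), better than the general (Im z)^(-1);
  \<open>radial_null\<close> depends on this gain.\<close>

lemma resolvent_bound:
  assumes "T r - z *\<^sub>C r = delta y" "0 < Im z" "y \<in> S"
  shows "cmod (coord r y) \<le> 1 / f y" "(norm r)\<^sup>2 \<le> 1 / (f y * Im z)"
proof -
  let ?c = "cmod (coord r y)"
  have "f y * ?c\<^sup>2 \<le> (\<Sum>x\<in>S. f x * (cmod (coord r x))\<^sup>2)"
    by (rule member_le_sum[OF \<open>y \<in> S\<close> _ finite_S, of "\<lambda>x. f x * (cmod (coord r x))\<^sup>2"])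
      (auto intro: mult_nonneg_nonneg less_imp_le[OF f_pos])
  moreover have "Im (coord r y) \<le> ?c"
    using abs_Im_le_cmod[of "coord r y"] by simp
  moreover have "0 \<le> Im z * (norm r)\<^sup>2" using assms by simp
  ultimately have *: "f y * ?c\<^sup>2 \<le> ?c" "Im z * (norm r)\<^sup>2 \<le> ?c"
    using resolvent_energy[OF assms(1)] P_form_nonneg[of r] by linarith+
  show c: "?c \<le> 1 / f y"
  proof (cases "?c = 0")
    case False
    then have "f y * ?c \<le> 1"
      using *(1) by (simp add: power2_eq_square mult.assoc[symmetric])
    then show ?thesis using f_pos[OF \<open>y \<in> S\<close>] by (simp add: field_simps)
  qed (use f_pos[OF \<open>y \<in> S\<close>] in simp)
  then have "Im z * (norm r)\<^sup>2 \<le> 1 / f y" using *(2) by linarith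
  then have "(norm r)\<^sup>2 \<le> (1 / f y) / Im z"
    by (subst pos_le_divide_eq) (simp_all add: mult.commute assms(2))
  then show "(norm r)\<^sup>2 \<le> 1 / (f y * Im z)" by simp
qed

lemma resolvent_unique:
  assumes "T u = z *\<^sub>C u" "0 < Im z"
  shows "u = 0"
proof -
  have "cinner u (T u) = z * cinner u u"
    by (simp add: assms cinner_scaleC_right)
  from arg_cong[OF this, of Im] have "Im z * (norm u)\<^sup>2 \<le> 0"
    using P_form_nonneg[of u] by (simp add: Im_cinner_T cinner_self_norm)
  then show ?thesis using assms(2) by (simp add: mult_le_0_iff)
qed

section \<open>The Cayley transform and the resolvent on the upper half-plane\<close>

definition is_bound :: "real \<Rightarrow> bool" where
  "is_bound M \<longleftrightarrow> 0 \<le> M \<and> (\<forall>u. norm (T u) \<le> M * norm u)"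

lemma ex_bound: "\<exists>M. is_bound M"
  using bounded_linear.nonneg_bounded[OF T_bounded] by (auto simp: is_bound_def mult.commute)

definition J :: "real \<Rightarrow> 'a ell2 \<Rightarrow> 'a ell2" where
  "J s v = (SOME u. T u - (\<i> * s) *\<^sub>C u = v)"

text \<open>This is (T + i s)(T - i s)^(-1), since T - i s maps \<open>J s v\<close> to v.\<close>

definition cayley :: "real \<Rightarrow> 'a ell2 \<Rightarrow> 'a ell2" where
  "cayley s v = v + (2 * \<i> * s) *\<^sub>C J s v"

context
  fixes s M
  assumes M: "is_bound M" and s: "M < s"
begin

lemma s_pos: "0 < s"
  using M s by (auto simp: is_bound_def)

lemma T_J: "T (J s v) = v + (\<i> * s) *\<^sub>C J s v"
proof -
  have "\<exists>u. T u - (\<i> * s) *\<^sub>C u = v"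
    using M s by (intro shift_solvable[OF T_bounded]) (auto simp: is_bound_def)
  then have "T (J s v) - (\<i> * s) *\<^sub>C J s v = v"
    unfolding J_def by (rule someI_ex)
  then show ?thesis by (simp add: algebra_simps)
qed

lemma norm_J_le: "norm (J s v) \<le> norm v / (s - M)"
proof -
  have "norm ((\<i> * s) *\<^sub>C J s v) = norm (T (J s v) - v)" by (simp add: T_J)
  also have "\<dots> \<le> norm (T (J s v)) + norm v" by (rule norm_triangle_ineq4)
  also have "norm (T (J s v)) \<le> M * norm (J s v)" using M by (simp add: is_bound_def)
  finally have "s * norm (J s v) \<le> M * norm (J s v) + norm v"
    using s_pos by (simp add: norm_scaleC norm_mult)
  then show ?thesis using s by (simp add: field_simps)
qed

lemma norm_cayley_le: "norm (cayley s v) \<le> norm v"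
proof -
  have "cayley s v = T (J s v) + (\<i> * s) *\<^sub>C J s v"
    by (intro ell2_eqI) (simp add: cayley_def T_J algebra_simps)
  moreover have "v = T (J s v) - (\<i> * s) *\<^sub>C J s v" by (simp add: T_J)
  ultimately show ?thesis using dissipative[of s "J s v"] s_pos by (metis less_imp_le)
qed

lemma norm_cayley_power_le: "norm ((cayley s ^^ n) v) \<le> norm v"
  by (induction n) (auto intro: order_trans[OF norm_cayley_le])

end

text \<open>The Taylor series of the resolvent in the parameter q with z = i s (1 + q) / (1 - q), which maps the
  unit disc onto the upper half-plane; it converges there because the Cayley transform of a
  dissipative operator is a contraction.\<close>

definition G :: "real \<Rightarrow> 'a \<Rightarrow> complex \<Rightarrow> 'a ell2" where
  "G s y q = (\<Sum>n. q ^ n *\<^sub>C J s ((cayley s ^^ n) (delta y)))"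

definition R :: "real \<Rightarrow> 'a \<Rightarrow> complex \<Rightarrow> 'a ell2" where
  "R s y q = (1 - q) *\<^sub>C G s y q"

lemma summable_ell2_power:
  assumes "cmod q < 1" "\<And>n. norm (v n) \<le> K"
  shows "summable (\<lambda>n. q ^ n *\<^sub>C (v n :: 'b ell2))"
proof (rule summable_comparison_test')
  show "summable (\<lambda>n. K * cmod q ^ n)"
    using assms by (intro summable_mult summable_geometric) auto
  show "norm (q ^ n *\<^sub>C v n) \<le> K * cmod q ^ n" for n
    using mult_right_mono[OF assms(2)[of n], of "cmod q ^ n"]
    by (simp add: norm_scaleC norm_power mult.commute)
qed

lemma norm_J_cayley_le:
  assumes "is_bound M" "M < s"
  shows "norm (J s ((cayley s ^^ n) v)) \<le> norm v / (s - M)"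
  using norm_J_le[OF assms, of "(cayley s ^^ n) v"]
    divide_right_mono[OF norm_cayley_power_le[OF assms, of n v], of "s - M"] assms(2) by linarith

text \<open>With C = \<open>cayley s\<close>, the identity (1 - q)(T - z) = (1 - q C)(T - i s) gives
  the inverse as (1 - q)(T - i s)^(-1)(1 - q C)^(-1); hence the prefactor in \<open>R\<close> and
  the geometric series in \<open>G\<close>.\<close>

lemma R_eq:
  assumes M: "is_bound M" "M < s" and q: "cmod q < 1"
  shows "T (R s y q) - (\<i> * s * (1 + q) / (1 - q)) *\<^sub>C R s y q = delta y"
proof -
  let ?c = "\<lambda>n. (cayley s ^^ n) (delta y)"
  let ?G = "G s y q"
  \<comment> \<open>Here K = (1 - q C)^(-1) \<open>delta y\<close>; shifting the summation index
    expresses the relation K = \<open>delta y\<close> + q C K.\<close>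
  define K where "K = (\<Sum>n. q ^ n *\<^sub>C ?c n)"
  have sJ: "summable (\<lambda>n. q ^ n *\<^sub>C J s (?c n))"
    by (rule summable_ell2_power[OF q norm_J_cayley_le[OF M]])
  have sC: "summable (\<lambda>n. q ^ n *\<^sub>C ?c n)"
    by (rule summable_ell2_power[OF q norm_cayley_power_le[OF M]])
  have sC': "summable (\<lambda>n. q ^ n *\<^sub>C ?c (Suc n))"
    by (rule summable_ell2_power[OF q norm_cayley_power_le[OF M]])
  have "T ?G = (\<Sum>n. T (q ^ n *\<^sub>C J s (?c n)))"
    unfolding G_def by (rule bounded_linear.suminf[OF T_bounded sJ])
  also have "\<dots> = (\<Sum>n. q ^ n *\<^sub>C ?c n + (\<i> * s) *\<^sub>C q ^ n *\<^sub>C J s (?c n))"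
    by (simp add: T_scaleC T_J[OF M] scaleC_add_right mult.commute)
  also have "\<dots> = K + (\<i> * s) *\<^sub>C ?G"
    unfolding K_def G_def bounded_linear.suminf[OF bounded_linear_scaleC sJ]
    by (intro suminf_add[symmetric] sC bounded_linear.summable[OF bounded_linear_scaleC sJ])
  finally have TG: "T ?G = K + (\<i> * s) *\<^sub>C ?G" .
  have "(\<Sum>n. q ^ n *\<^sub>C ?c (Suc n)) = (\<Sum>n. q ^ n *\<^sub>C ?c n + (2 * \<i> * s) *\<^sub>C q ^ n *\<^sub>C J s (?c n))"
    by (simp add: cayley_def scaleC_add_right mult.commute)
  also have "\<dots> = K + (2 * \<i> * s) *\<^sub>C ?G"
    unfolding K_def G_def bounded_linear.suminf[OF bounded_linear_scaleC sJ]
    by (intro suminf_add[symmetric] sC bounded_linear.summable[OF bounded_linear_scaleC sJ])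
  finally have sh: "(\<Sum>n. q ^ n *\<^sub>C ?c (Suc n)) = K + (2 * \<i> * s) *\<^sub>C ?G" .
  have "K = delta y + (\<Sum>n. q ^ Suc n *\<^sub>C ?c (Suc n))"
    unfolding K_def using suminf_split_head[OF sC] by (simp add: algebra_simps)
  also have "(\<Sum>n. q ^ Suc n *\<^sub>C ?c (Suc n)) = q *\<^sub>C (\<Sum>n. q ^ n *\<^sub>C ?c (Suc n))"
    unfolding bounded_linear.suminf[OF bounded_linear_scaleC sC'] by simp
  finally have K: "K = delta y + q *\<^sub>C (K + (2 * \<i> * s) *\<^sub>C ?G)" unfolding sh .
  have q1: "1 - q \<noteq> 0" using q by auto
  show ?thesis
  proof (rule ell2_eqI)
    fix i
    have 1: "coord K i = coord (delta y) i + q * (coord K i + 2 * \<i> * s * coord ?G i)"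
      by (subst K) simp
    have "coord (T (R s y q)) i = (1 - q) * (coord K i + \<i> * s * coord ?G i)"
      by (simp add: R_def T_scaleC TG)
    also have "\<dots> = coord (delta y) i + \<i> * s * (1 + q) * coord ?G i"
      using 1 by (simp add: algebra_simps)
    finally show "coord (T (R s y q) - (\<i> * s * (1 + q) / (1 - q)) *\<^sub>C R s y q) i = coord (delta y) i"
      using q1 by (simp add: R_def)
  qed
qed

lemma R_holomorphic:
  assumes M: "is_bound M" "M < s"
  shows "(\<lambda>q. coord (R s y q) x) holomorphic_on ball 0 1"
proof -
  let ?J = "\<lambda>n. J s ((cayley s ^^ n) (delta y))"
  have "(\<lambda>n. coord (?J n) x * (q - 0) ^ n) sums coord (G s y q) x" if "q \<in> ball 0 1" for q
  proof -
    have "cmod q < 1" using that by simp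
    from summable_ell2_power[OF this norm_J_cayley_le[OF M]]
    have "summable (\<lambda>n. q ^ n *\<^sub>C ?J n)" .
    from bounded_linear.sums[OF bounded_linear_coord summable_sums[OF this], of x]
    show ?thesis by (simp add: G_def mult.commute)
  qed
  then have "(\<lambda>q. coord (G s y q) x) holomorphic_on ball 0 1"
    by (rule power_series_holomorphic)
  then show ?thesis
    by (simp add: R_def) (intro holomorphic_intros)
qed

end

section \<open>Boundary uniqueness for bounded holomorphic functions\<close>

inductive trig :: "(real \<Rightarrow> real) \<Rightarrow> bool" where
  trig_monom: "trig (\<lambda>t. Re (c * cis (of_int k * t)))"
| trig_add: "trig h1 \<Longrightarrow> trig h2 \<Longrightarrow> trig (\<lambda>t. h1 t + h2 t)"

lemma trig_mult_monom:
  "trig h \<Longrightarrow> trig (\<lambda>t. Re (c * cis (of_int k * t)) * h t)"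
proof (induction rule: trig.induct)
  case (trig_monom d l)
  have "Re (c * cis (of_int k * t)) * Re (d * cis (of_int l * t)) =
      Re (c * d / 2 * cis (of_int (k + l) * t)) + Re (c * cnj d / 2 * cis (of_int (k - l) * t))" for t
  proof -
    have product: "Re a * Re b = Re (a * b / 2) + Re (a * cnj b / 2)" for a b
      by (simp add: field_simps)
    have "c * cis (of_int k * t) * (d * cis (of_int l * t)) = c * d * cis (of_int (k + l) * t)"
      by (simp add: distrib_right flip: cis_mult)
    moreover have "c * cis (of_int k * t) * cnj (d * cis (of_int l * t))
        = c * cnj d * cis (of_int (k - l) * t)"
      by (simp add: left_diff_distrib cis_cnj flip: cis_divide) (simp add: cis_inverse divide_inverse)
    ultimately show ?thesis
      unfolding product by (simp only: times_divide_eq_left)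
  qed
  then show ?case by (simp only:) (intro trig.intros)
next
  case (trig_add h1 h2)
  then show ?case using trig.trig_add by (simp only: distrib_left)
qed

lemma trig_mult: "trig h1 \<Longrightarrow> trig h2 \<Longrightarrow> trig (\<lambda>t. h1 t * h2 t)"
proof (induction rule: trig.induct)
  case (trig_monom c k)
  then show ?case by (rule trig_mult_monom)
next
  case (trig_add h1 h2)
  then show ?case using trig.trig_add by (simp only: distrib_right)
qed

text \<open>On the circle a real linear form is a combination of cos and sin, that is a monomial of
  frequency 1, and products of monomials split into sum and difference frequencies.\<close>

lemma trig_polynomial:
  fixes g :: "complex \<Rightarrow> real"
  assumes "real_polynomial_function g"
  shows "trig (\<lambda>t. g (cis t))"
  using assms
proof (induction rule: real_polynomial_function.induct)
  case (linear g)
  have "g (cis t) = Re (Complex (g 1) (- g \<i>) * cis (of_int 1 * t))" for t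
  proof -
    have "cis t = cos t *\<^sub>R 1 + sin t *\<^sub>R \<i>" by (simp add: complex_eq_iff)
    then have "g (cis t) = cos t * g 1 + sin t * g \<i>"
      by (simp add: linear_add[OF bounded_linear.linear[OF linear]]
          linear_scale[OF bounded_linear.linear[OF linear]] del: scaleR_conv_of_real)
    then show ?thesis by (simp add: mult.commute)
  qed
  then show ?case by (simp only:) (rule trig.intros)
next
  case (const c)
  show ?case using trig.trig_monom[of "complex_of_real c" 0] by simp
qed (auto intro: trig.intros trig_mult)

lemma has_integral_monom:
  assumes "k \<noteq> 0"
  shows "((\<lambda>t. Re (c * cis (of_int k * t))) has_integral 0) {0..2*pi}"
proof -
  let ?F = "\<lambda>t. Re (c / (\<i> * of_int k) * cis (of_int k * t))"
  have "((\<lambda>t. Re (c * cis (of_int k * t))) has_integral (?F (2*pi) - ?F 0)) {0..2*pi}"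
  proof (rule fundamental_theorem_of_calculus)
    fix t
    have "((\<lambda>z. c / (\<i> * of_int k) * exp (\<i> * of_int k * z)) has_field_derivative
        c * exp (\<i> * of_int k * of_real t)) (at (of_real t))"
      using assms by (auto intro!: derivative_eq_intros)
    then have "((\<lambda>t. c / (\<i> * of_int k) * exp (\<i> * of_int k * of_real t)) has_vector_derivative
        c * exp (\<i> * of_int k * of_real t)) (at t within {0..2*pi})"
      by (rule has_vector_derivative_real_field)
    then have "((\<lambda>t. c / (\<i> * of_int k) * cis (of_int k * t)) has_vector_derivative
        c * cis (of_int k * t)) (at t within {0..2*pi})"
      by (simp add: cis_conv_exp mult.assoc)
    then show "(?F has_vector_derivative Re (c * cis (of_int k * t))) (at t within {0..2*pi})"
      by (rule bounded_linear.has_vector_derivative[OF bounded_linear_Re])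
  qed simp
  moreover have "cis (of_int k * (2 * pi)) = 1"
    by (metis cis_multiple_2pi Ints_of_int mult.commute mult.left_commute)
  ultimately show ?thesis by simp
qed

text \<open>A frequency k > 0 extends by \<open>c * z ^ nat k\<close>; for k < 0, conjugating inside
  Re turns the monomial into one of positive frequency. Only frequency 0 contributes to the
  integral, which is therefore 2 pi times the value at the centre.\<close>

lemma trig_harmonic_extension:
  "trig h \<Longrightarrow> \<exists>F. F holomorphic_on UNIV \<and> (\<forall>t. Re (F (cis t)) = h t) \<and>
     (h has_integral (2 * pi * Re (F 0))) {0..2*pi}"
proof (induction rule: trig.induct)
  case (trig_monom c k)
  consider "k = 0" | "k > 0" | "k < 0" by linarith
  then show ?case
  proof cases
    case 1
    show ?thesis
      using 1 has_integral_const_real[of "Re c" 0 "2*pi"] by (intro exI[of _ "\<lambda>_. c"]) simp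
  next
    case 2
    have "cis (of_int k * t) = cis t ^ nat k" for t
      using 2 by (simp add: Complex.DeMoivre)
    then show ?thesis
      using 2 has_integral_monom[of k c]
      by (intro exI[of _ "\<lambda>z. c * z ^ nat k"]) (auto intro!: holomorphic_intros simp: power_0_left)
  next
    case 3
    have "cnj (cis (of_int k * t)) = cis t ^ nat (- k)" for t
      using 3 by (simp add: Complex.DeMoivre cis_cnj)
    then have "Re (cnj c * cis t ^ nat (- k)) = Re (c * cis (of_int k * t))" for t
      by (metis complex_cnj_mult cnj.sel(1))
    then show ?thesis
      using 3 has_integral_monom[of k c]
      by (intro exI[of _ "\<lambda>z. cnj c * z ^ nat (- k)"]) (auto intro!: holomorphic_intros simp: power_0_left)
  qed
next
  case (trig_add h1 h2)
  then obtain F1 F2 where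
    "F1 holomorphic_on UNIV" "\<forall>t. Re (F1 (cis t)) = h1 t"
    "(h1 has_integral (2 * pi * Re (F1 0))) {0..2*pi}"
    "F2 holomorphic_on UNIV" "\<forall>t. Re (F2 (cis t)) = h2 t"
    "(h2 has_integral (2 * pi * Re (F2 0))) {0..2*pi}"
    by blast
  then show ?case
    using has_integral_add[of h1 _ "{0..2*pi}" h2]
    by (intro exI[of _ "\<lambda>z. F1 z + F2 z"]) (auto intro!: holomorphic_intros simp: distrib_left)
qed

text \<open>Approximating h uniformly by the real part of an entire function F reduces the inequality to the
  maximum principle for g exp (- F), so zeros of g need no separate treatment.\<close>

lemma Jensen_inequality_circle:
  fixes g :: "complex \<Rightarrow> complex" and h :: "complex \<Rightarrow> real"
  assumes g: "g holomorphic_on ball 0 1" "continuous_on (cball 0 1) g" "g 0 \<noteq> 0"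
    and h: "continuous_on (sphere 0 1) h"
    and le: "\<And>z. cmod z = 1 \<Longrightarrow> cmod (g z) \<le> exp (h z)"
  shows "2 * pi * ln (cmod (g 0)) \<le> integral {0..2*pi} (\<lambda>t. h (cis t))"
proof -
  have hint: "(\<lambda>t. h (cis t)) integrable_on {0..2*pi}"
    by (intro integrable_continuous_real continuous_on_compose2[OF h] continuous_intros) auto
  have "ln (cmod (g 0)) \<le> integral {0..2*pi} (\<lambda>t. h (cis t)) / (2 * pi) + e" if "e > 0" for e
  proof -
    obtain p where p: "real_polynomial_function p" "\<And>z. z \<in> sphere 0 1 \<Longrightarrow> \<bar>h z - p z\<bar> < e / 2"
      using Stone_Weierstrass_real_polynomial_function[OF _ h, of "e / 2"] \<open>e > 0\<close> by auto
    obtain F where F: "F holomorphic_on UNIV" "\<And>t. Re (F (cis t)) = p (cis t)"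
      "((\<lambda>t. p (cis t)) has_integral (2 * pi * Re (F 0))) {0..2*pi}"
      using trig_harmonic_extension[OF trig_polynomial[OF p(1)]] by blast
    let ?g = "\<lambda>z. g z * exp (- F z)"
    have "cmod (?g 0) \<le> exp (e / 2)"
    proof (rule maximum_modulus_frontier[of ?g "cball 0 1" _ 0])
      show "?g holomorphic_on interior (cball 0 1)"
        using g(1) by (auto intro!: holomorphic_intros holomorphic_on_subset[OF F(1)])
      show "continuous_on (closure (cball 0 1)) ?g"
        using g(2) holomorphic_on_imp_continuous_on[OF F(1)]
        by (auto intro!: continuous_intros elim: continuous_on_subset)
      fix z :: complex assume "z \<in> frontier (cball 0 1)"
      then have z: "cmod z = 1" by simp
      then have t: "z = cis (Arg z)"
        by (metis cis_Arg div_by_1 norm_eq_zero of_real_1 sgn_eq zero_neq_one)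
      have "cmod (?g z) = cmod (g z) * exp (- p z)"
        by (subst t, subst (3) t) (simp add: norm_mult F(2))
      also have "\<dots> \<le> exp (h z) * exp (- p z)"
        by (intro mult_right_mono le z) auto
      also have "\<dots> = exp (h z - p z)" by (simp add: exp_add[symmetric])
      also have "\<bar>h z - p z\<bar> < e / 2" using p(2)[of z] z by simp
      then have "exp (h z - p z) \<le> exp (e / 2)" unfolding exp_le_cancel_iff by linarith
      finally show "cmod (?g z) \<le> exp (e / 2)" .
    qed auto
    then have "cmod (g 0) \<le> exp (e / 2 + Re (F 0))"
      unfolding exp_add by (simp add: norm_mult norm_divide exp_minus field_simps)
    then have 1: "ln (cmod (g 0)) \<le> e / 2 + Re (F 0)"
      using g(3) by (subst exp_le_cancel_iff[symmetric]) simp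
    have p_le: "p (cis t) \<le> h (cis t) + e / 2" for t
      using p(2)[of "cis t"] unfolding abs_less_iff by simp
    have "2 * pi * Re (F 0) \<le> integral {0..2*pi} (\<lambda>t. h (cis t) + e / 2)"
      using integral_unique[OF F(3)] has_integral_integrable[OF F(3)] p(2)
      by (subst integral_unique[OF F(3), symmetric], intro integral_le)
        (auto intro!: integrable_add hint simp: p_le)
    also have "\<dots> = integral {0..2*pi} (\<lambda>t. h (cis t)) + 2 * pi * (e / 2)"
      by (subst integral_add[OF hint]) auto
    finally have "Re (F 0) \<le> integral {0..2*pi} (\<lambda>t. h (cis t)) / (2 * pi) + e / 2"
      by (simp add: field_simps)
    with 1 show ?thesis by simp
  qed
  then have "ln (cmod (g 0)) \<le> integral {0..2*pi} (\<lambda>t. h (cis t)) / (2 * pi)"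
    by (rule field_le_epsilon)
  then show ?thesis by (simp add: field_simps)
qed

text \<open>Jensen's inequality on the circles of radius \<open>r n\<close> bounds the integrals of
  ln max(|g| / K, \<eta>) from below by a constant independent of n and \<eta>. On the bad set N the
  integrand tends to ln \<eta>, so dominated convergence gives const \<le> |N| ln \<eta> for every
  \<eta> in (0, 1), which forces |N| = 0.\<close>

lemma radial_limit_uniqueness:
  fixes g :: "complex \<Rightarrow> complex" and r :: "nat \<Rightarrow> real"
  assumes g: "g holomorphic_on ball 0 1" "g 0 \<noteq> 0"
    and K: "\<And>z. z \<in> ball 0 1 \<Longrightarrow> cmod (g z) \<le> K"
    and r: "\<And>n. 0 < r n" "\<And>n. r n < 1"
  shows "negligible {t\<in>{0..2*pi}. (\<lambda>n. g (r n * cis t)) \<longlonglongrightarrow> 0}" (is "negligible ?N")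
proof -
  have "K > 0" using K[of 0] g(2) by (simp add: order_less_le_trans[of 0 "cmod (g 0)"])
  define X where "X n t = g (r n * cis t) / K" for n and t :: real
  have in_ball: "complex_of_real (r n) * z \<in> ball 0 1" if "cmod z \<le> 1" for n z
  proof -
    have "r n * cmod z \<le> r n * 1" using that r(1)[of n] by (intro mult_left_mono) auto
    then show ?thesis using r[of n] by (simp add: norm_mult less_imp_le order_le_less_trans[of "r n * cmod z" "r n"])
  qed
  have X_cont: "continuous_on UNIV (X n)" for n
    unfolding X_def using in_ball
    by (intro continuous_intros continuous_on_compose2[OF holomorphic_on_imp_continuous_on[OF g(1)]])
      (use \<open>K > 0\<close> in auto)
  have X_meas [measurable]: "X n \<in> borel_measurable borel" for n
    using X_cont by (rule borel_measurable_continuous_onI)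
  have X_le: "cmod (X n t) \<le> 1" for n t
    using K[OF in_ball[of "cis t" n]] \<open>K > 0\<close> by (simp add: X_def norm_divide)
  \<comment> \<open>Thresholds 1 / Suc k express convergence by countably many conditions, which
    makes the set Borel.\<close>
  have N_eq: "?N = {t. t \<in> {0..2*pi} \<and> (\<forall>k. \<exists>m. \<forall>n. m \<le> n \<longrightarrow> cmod (X n t) < 1 / real (Suc k))}"
  proof -
    have "(\<lambda>n. g (r n * cis t)) \<longlonglongrightarrow> 0 \<longleftrightarrow> (\<lambda>n. X n t) \<longlonglongrightarrow> 0" for t
      unfolding X_def divide_inverse
      using \<open>K > 0\<close> tendsto_mult_right_iff[of "inverse (complex_of_real K)" _ 0] by simp
    moreover have "(\<lambda>n. X n t) \<longlonglongrightarrow> 0 \<longleftrightarrow>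
        (\<forall>k. \<exists>m. \<forall>n. m \<le> n \<longrightarrow> cmod (X n t) < 1 / real (Suc k))" for t
    proof
      assume "(\<lambda>n. X n t) \<longlonglongrightarrow> 0"
      then show "\<forall>k. \<exists>m. \<forall>n. m \<le> n \<longrightarrow> cmod (X n t) < 1 / real (Suc k)"
        unfolding lim_sequentially dist_norm diff_0_right by (auto simp del: of_nat_Suc)
    next
      assume *: "\<forall>k. \<exists>m. \<forall>n. m \<le> n \<longrightarrow> cmod (X n t) < 1 / real (Suc k)"
      show "(\<lambda>n. X n t) \<longlonglongrightarrow> 0"
      proof (rule LIMSEQ_I)
        fix e :: real assume "e > 0"
        then obtain k where k: "1 / real (Suc k) < e" by (rule nat_approx_posE)
        from * obtain m where "\<And>n. m \<le> n \<Longrightarrow> cmod (X n t) < 1 / real (Suc k)" by blast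
        with k show "\<exists>m. \<forall>n\<ge>m. norm (X n t - 0) < e"
          by (intro exI[of _ m]) (auto intro: less_trans simp del: of_nat_Suc)
      qed
    qed
    ultimately show ?thesis by simp
  qed
  have N_meas [measurable]: "?N \<in> sets borel"
    unfolding N_eq by measurable
  have N_fin: "emeasure lborel ?N < \<infinity>"
    by (rule le_less_trans[OF emeasure_mono[of ?N "{0..2*pi}"]]) auto
  have bound: "2 * pi * ln (cmod (g 0) / K) \<le> measure lborel ?N * ln \<eta>" if \<eta>: "0 < \<eta>" "\<eta> < 1" for \<eta>
  proof -
    \<comment> \<open>Cutting off at \<open>\<eta>\<close> keeps the logarithm continuous across
      zeros of g and bounded below; dividing by K keeps it nonpositive.\<close>
    define Y where "Y n t = ln (max (cmod (X n t)) \<eta>)" for n t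
    have Y_meas [measurable]: "Y n \<in> borel_measurable borel" for n
      unfolding Y_def by measurable
    have Y_bounds: "Y n t \<le> 0" "ln \<eta> \<le> Y n t" for n t
      using X_le[of n t] \<eta> by (auto simp: Y_def)
    have Y_abs: "\<bar>Y n t\<bar> \<le> \<bar>ln \<eta>\<bar>" for n t
      using Y_bounds[of n t] by linarith
    have const_integrable: "integrable lborel (\<lambda>t. indicator B t * \<bar>ln \<eta>\<bar> :: real)"
      if "B \<in> sets borel" "emeasure lborel B < \<infinity>" for B
      using that by (intro integrable_mult_left) auto
    have Y_integrable: "integrable lborel (\<lambda>t. indicator B t * Y n t)"
      if [measurable]: "B \<in> sets borel" and "emeasure lborel B < \<infinity>" for B n
    proof (rule Bochner_Integration.integrable_bound)
      show "integrable lborel (\<lambda>t. indicator B t * \<bar>ln \<eta>\<bar> :: real)"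
        using that by (rule const_integrable)
      show "AE t in lborel. norm (indicator B t * Y n t) \<le> norm (indicator B t * \<bar>ln \<eta>\<bar> :: real)"
        by (rule AE_I2) (simp add: indicator_def Y_abs)
    qed measurable
    have Jn: "2 * pi * ln (cmod (g 0) / K) \<le> (\<integral>t. indicator ?N t * Y n t \<partial>lborel)" for n
    proof -
      let ?G = "\<lambda>z::complex. g (r n * z) / K" and ?h = "\<lambda>z::complex. ln (max (cmod (g (r n * z) / K)) \<eta>)"
      have G_cont: "continuous_on (cball 0 1) ?G"
        using in_ball \<open>K > 0\<close>
        by (intro continuous_intros continuous_on_compose2[OF holomorphic_on_imp_continuous_on[OF g(1)]])
          auto
      have "2 * pi * ln (cmod (?G 0)) \<le> integral {0..2*pi} (\<lambda>t. ?h (cis t))"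
      proof (rule Jensen_inequality_circle)
        have "(g \<circ> (\<lambda>z. r n * z)) holomorphic_on ball 0 1"
          by (rule holomorphic_on_compose_gen[OF _ g(1)])
            (use in_ball[of _ n] in \<open>auto intro!: holomorphic_intros\<close>)
        then show "?G holomorphic_on ball 0 1"
          unfolding o_def by (intro holomorphic_intros) (use \<open>K > 0\<close> in auto)
        show "continuous_on (sphere 0 1) ?h"
          using \<eta> by (intro continuous_intros continuous_on_subset[OF G_cont]) auto
        show "cmod (?G z) \<le> exp (?h z)" for z
          using \<eta> by (simp add: less_max_iff_disj)
      qed (use G_cont g(2) \<open>K > 0\<close> in auto)
      also have "integral {0..2*pi} (\<lambda>t. ?h (cis t)) = integral {0..2*pi} (Y n)"
        by (simp add: Y_def[abs_def] X_def)
      also have "\<dots> = (\<integral>t. indicator {0..2*pi} t * Y n t \<partial>lborel)"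
      proof (subst set_borel_integral_eq_integral(2)[symmetric])
        have "continuous_on {0..2*pi} (Y n)"
          unfolding Y_def using \<eta>
          by (intro continuous_intros continuous_on_subset[OF X_cont]) auto
        then show "set_integrable lborel {0..2*pi} (Y n)"
          by (rule borel_integrable_atLeastAtMost')
      qed (simp add: set_lebesgue_integral_def)
      \<comment> \<open>Since \<open>Y n\<close> is nonpositive, shrinking the domain of integration
        increases the integral.\<close>
      also have "\<dots> \<le> (\<integral>t. indicator ?N t * Y n t \<partial>lborel)"
      proof (rule integral_mono)
        show "integrable lborel (\<lambda>t. indicator {0..2*pi} t * Y n t)"
          by (rule Y_integrable) simp_all
        show "integrable lborel (\<lambda>t. indicator ?N t * Y n t)"
          by (rule Y_integrable[OF N_meas N_fin])
        show "indicator {0..2*pi} t * Y n t \<le> indicator ?N t * Y n t" for t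
          using Y_bounds[of n t] by (auto simp: indicator_def)
      qed
      finally show ?thesis by (simp add: norm_divide \<open>K > 0\<close> abs_of_pos)
    qed
    have "(\<lambda>n. \<integral>t. indicator ?N t * Y n t \<partial>lborel) \<longlonglongrightarrow> (\<integral>t. indicator ?N t * ln \<eta> \<partial>lborel)"
    proof (rule integral_dominated_convergence)
      show "integrable lborel (\<lambda>t. indicator ?N t * \<bar>ln \<eta>\<bar> :: real)"
        by (rule const_integrable[OF N_meas N_fin])
      show "AE t in lborel. (\<lambda>n. indicator ?N t * Y n t) \<longlonglongrightarrow> indicator ?N t * ln \<eta>"
      proof (rule AE_I2)
        fix t
        show "(\<lambda>n. indicator ?N t * Y n t) \<longlonglongrightarrow> indicator ?N t * ln \<eta>"
        proof (cases "t \<in> ?N")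
          case True
          then have "(\<lambda>n. X n t) \<longlonglongrightarrow> 0"
            unfolding X_def by (intro tendsto_divide_zero) auto
          then have "(\<lambda>n. ln (max (cmod (X n t)) \<eta>)) \<longlonglongrightarrow> ln (max (cmod (0 :: complex)) \<eta>)"
            using \<eta> by (intro tendsto_intros) auto
          then show ?thesis using True \<eta> by (simp add: Y_def)
        qed simp
      qed
      show "AE t in lborel. norm (indicator ?N t * Y n t) \<le> indicator ?N t * \<bar>ln \<eta>\<bar>" for n
        by (rule AE_I2) (simp add: indicator_def Y_abs)
    qed (use N_meas in measurable)
    then have "2 * pi * ln (cmod (g 0) / K) \<le> (\<integral>t. indicator ?N t * ln \<eta> \<partial>lborel)"
      by (rule LIMSEQ_le_const) (use Jn in auto)
    then show ?thesis by simp
  qed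
  have "measure lborel ?N = 0"
  proof (rule ccontr)
    assume "measure lborel ?N \<noteq> 0"
    then have m: "measure lborel ?N > 0" by (simp add: zero_less_measure_iff)
    \<comment> \<open>The value \<open>exp (- \<bar>c\<bar> - 1)\<close> of \<open>\<eta>\<close>
      has logarithm below c, against the bound just proved.\<close>
    define c where "c = 2 * pi * ln (cmod (g 0) / K) / measure lborel ?N"
    have "c \<le> ln (exp (- \<bar>c\<bar> - 1))"
      using bound[of "exp (- \<bar>c\<bar> - 1)"] m by (simp add: c_def field_simps)
    then show False by simp
  qed
  then have "?N \<in> null_sets lborel"
    using N_meas N_fin by (simp add: null_sets_def emeasure_eq_ennreal_measure)
  then show ?thesis
    by (simp add: negligible_iff_null_sets null_sets_completionI)
qed

text \<open>Gaussian elimination of one coordinate reduces the vector-valued statement to the scalar one.\<close>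

lemma vector_radial_uniqueness:
  fixes v :: "nat \<Rightarrow> 'a \<Rightarrow> complex \<Rightarrow> complex" and r :: "nat \<Rightarrow> real"
  assumes "finite S"
    and "\<And>j x. x \<in> S \<Longrightarrow> v j x holomorphic_on ball 0 1"
    and "\<And>j x. x \<in> S \<Longrightarrow> \<exists>K. \<forall>z\<in>ball 0 1. cmod (v j x z) \<le> K"
    and "\<And>q. (\<And>j. (\<Sum>x\<in>S. q x * v j x 0) = 0) \<Longrightarrow> \<forall>x\<in>S. q x = 0"
    and r: "\<And>n. 0 < r n" "\<And>n. r n < 1"
  shows "negligible {t\<in>{0..2*pi}. \<exists>q. (\<exists>x\<in>S. q x \<noteq> 0) \<and>
    (\<forall>j. (\<lambda>n. \<Sum>x\<in>S. q x * v j x (r n * cis t)) \<longlonglongrightarrow> 0)}"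
  using assms(1-4)
proof (induction S arbitrary: v rule: finite_induct)
  case empty
  then show ?case by simp
next
  case (insert a S)
  have "\<exists>i. v i a 0 \<noteq> 0"
  proof (rule ccontr)
    assume *: "\<nexists>i. v i a 0 \<noteq> 0"
    then have "(\<Sum>x\<in>insert a S. (if x = a then 1 else 0) * v j x 0) = 0" for j
      using insert.hyps by (auto intro!: sum.neutral)
    from insert.prems(3)[OF this] show False by simp
  qed
  then obtain i where i: "v i a 0 \<noteq> 0" by blast
  \<comment> \<open>Cross-multiplied elimination with pivot row i: coordinate a cancels without
    division, so the new entries stay bounded and holomorphic.\<close>
  define v' where "v' j x z = v i a z * v j x z - v j a z * v i x z" for j x z
  let ?bad = "\<lambda>S v. {t\<in>{0..2*pi}. \<exists>q. (\<exists>x\<in>S. q x \<noteq> 0) \<and>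
    (\<forall>j. (\<lambda>n. \<Sum>x\<in>S. q x * v j x (r n * cis t)) \<longlonglongrightarrow> (0::complex))}"
  have in_ball: "complex_of_real (r n) * cis t \<in> ball 0 1" for n t
    using r[of n] by (simp add: norm_mult)
  have sum_v': "(\<Sum>x\<in>S. q x * v' j x z) =
      v i a z * (\<Sum>x\<in>insert a S. q x * v j x z) - v j a z * (\<Sum>x\<in>insert a S. q x * v i x z)" for q j z
    using insert.hyps
    by (simp add: v'_def sum_distrib_left sum_subtractf algebra_simps)
  have "negligible (?bad S v')"
  proof (rule insert.IH)
    fix j x assume x: "x \<in> S"
    show "v' j x holomorphic_on ball 0 1"
      unfolding v'_def using insert.prems(1) x by (intro holomorphic_intros) auto
    obtain K1 K2 K3 K4 where K: "\<forall>z\<in>ball 0 1. cmod (v i a z) \<le> K1"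
      "\<forall>z\<in>ball 0 1. cmod (v j x z) \<le> K2" "\<forall>z\<in>ball 0 1. cmod (v j a z) \<le> K3"
      "\<forall>z\<in>ball 0 1. cmod (v i x z) \<le> K4"
      using insert.prems(2) x by (metis insertCI)
    have "cmod (v' j x z) \<le> K1 * K2 + K3 * K4" if z: "z \<in> ball 0 1" for z
    proof -
      have "cmod (v' j x z) \<le> cmod (v i a z * v j x z) + cmod (v j a z * v i x z)"
        unfolding v'_def by (rule norm_triangle_ineq4)
      also have "\<dots> \<le> K1 * K2 + K3 * K4"
        unfolding norm_mult using K z by (intro add_mono mult_mono) (auto intro: order_trans[OF norm_ge_zero])
      finally show ?thesis .
    qed
    then show "\<exists>K. \<forall>z\<in>ball 0 1. cmod (v' j x z) \<le> K" by blast
  next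
    fix q assume q: "\<And>j. (\<Sum>x\<in>S. q x * v' j x 0) = 0"
    \<comment> \<open>The value at a is chosen such that the pivot row annihilates \<open>q'\<close>
      at 0; the minors then force the other rows to do the same.\<close>
    define q' where "q' = q(a := - (\<Sum>x\<in>S. q x * v i x 0) / v i a 0)"
    have q'_S: "(\<Sum>x\<in>S. q' x * g x) = (\<Sum>x\<in>S. q x * g x)" for g :: "'a \<Rightarrow> complex"
      using insert.hyps by (intro sum.cong) (auto simp: q'_def)
    have 0: "(\<Sum>x\<in>insert a S. q' x * v i x 0) = 0"
      using insert.hyps i by (simp add: q'_S) (simp add: q'_def)
    have "(\<Sum>x\<in>insert a S. q' x * v j x 0) = 0" for j
    proof -
      have "v i a 0 * (\<Sum>x\<in>insert a S. q' x * v j x 0) = (\<Sum>x\<in>S. q' x * v' j x 0)"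
        unfolding sum_v' 0 by simp
      then show ?thesis using q[of j] i by (simp add: q'_S)
    qed
    from insert.prems(3)[OF this] show "\<forall>x\<in>S. q x = 0"
      using insert.hyps(2) by (metis fun_upd_other insertCI q'_def)
  qed
  moreover have "negligible {t\<in>{0..2*pi}. (\<lambda>n. v i a (r n * cis t)) \<longlonglongrightarrow> 0}"
  proof -
    obtain K where "\<forall>z\<in>ball 0 1. cmod (v i a z) \<le> K" using insert.prems(2) by blast
    then show ?thesis
      using insert.prems(1) i r by (intro radial_limit_uniqueness[of _ K]) auto
  qed
  ultimately have neg: "negligible (?bad S v' \<union> {t\<in>{0..2*pi}. (\<lambda>n. v i a (r n * cis t)) \<longlonglongrightarrow> 0})"
    by (rule negligible_Un)
  show ?case
  proof (rule negligible_subset[OF neg], rule subsetI)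
    fix t assume "t \<in> ?bad (insert a S) v"
    then obtain q where t: "t \<in> {0..2*pi}" and q: "\<exists>x\<in>insert a S. q x \<noteq> 0"
      and lim: "\<And>j. (\<lambda>n. \<Sum>x\<in>insert a S. q x * v j x (r n * cis t)) \<longlonglongrightarrow> 0" by blast
    show "t \<in> ?bad S v' \<union> {t\<in>{0..2*pi}. (\<lambda>n. v i a (r n * cis t)) \<longlonglongrightarrow> 0}"
    proof (cases "\<exists>x\<in>S. q x \<noteq> 0")
      case True
      have null: "(\<lambda>n. v k a (r n * cis t) * g n) \<longlonglongrightarrow> 0" if "g \<longlonglongrightarrow> 0" for k g
      proof -
        obtain K where "\<forall>z\<in>ball 0 1. cmod (v k a z) \<le> K" using insert.prems(2) by blast
        then show ?thesis using in_ball that by (intro lim_null_mult_left_bounded[of _ K]) auto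
      qed
      have "(\<lambda>n. \<Sum>x\<in>S. q x * v' j x (r n * cis t)) \<longlonglongrightarrow> 0" for j
        unfolding sum_v' using tendsto_diff[OF null[OF lim[of j], of i] null[OF lim[of i], of j]] by simp
      then show ?thesis using True t by blast
    next
      \<comment> \<open>Here q is supported at a alone, so the pivot entry itself tends to 0 along
        the radius: the scalar exceptional set.\<close>
      case False
      then have qa: "q a \<noteq> 0" using q by auto
      have "(\<Sum>x\<in>insert a S. q x * v i x z) = q a * v i a z" for z
        using False insert.hyps by simp
      then have "(\<lambda>n. q a * v i a (r n * cis t)) \<longlonglongrightarrow> q a * 0"
        using lim[of i] by simp
      then have "(\<lambda>n. v i a (r n * cis t)) \<longlonglongrightarrow> 0"
        using qa by (subst (asm) tendsto_mult_left_iff) auto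
      then show ?thesis using t by blast
    qed
  qed
qed

section \<open>Eigenvectors in invariant subspaces of a finite matrix\<close>

lemma ex_linear_dependence:
  fixes v :: "'i \<Rightarrow> 'a \<Rightarrow> complex"
  assumes "finite S" "finite I" "card S < card I"
  shows "\<exists>c. (\<exists>i\<in>I. c i \<noteq> 0) \<and> (\<forall>x\<in>S. (\<Sum>i\<in>I. c i * v i x) = 0)"
  using assms
proof (induction S arbitrary: I v rule: finite_induct)
  case empty
  then have "I \<noteq> {}" by auto
  then show ?case by (intro exI[of _ "\<lambda>_. 1"]) auto
next
  case (insert a S)
  show ?case
  proof (cases "\<forall>i\<in>I. v i a = 0")
    case True
    obtain c where "\<exists>i\<in>I. c i \<noteq> 0" "\<forall>x\<in>S. (\<Sum>i\<in>I. c i * v i x) = 0"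
      using insert.IH[of I v] insert.prems insert.hyps by auto
    with True show ?thesis by (intro exI[of _ c]) auto
  next
    case False
    then obtain k where k: "k \<in> I" "v k a \<noteq> 0" by blast
    define w where "w i x = v i x - v i a / v k a * v k x" for i x
    have "card S < card (I - {k})" using insert.prems insert.hyps k by simp
    then obtain c where c: "\<exists>i\<in>I - {k}. c i \<noteq> 0"
      "\<forall>x\<in>S. (\<Sum>i\<in>I - {k}. c i * w i x) = 0"
      using insert.IH[of "I - {k}" w] insert.prems by auto
    define c' where "c' = c(k := - (\<Sum>i\<in>I - {k}. c i * v i a) / v k a)"
    have c': "(\<Sum>i\<in>I. c' i * v i x) = (\<Sum>i\<in>I - {k}. c i * w i x)" for x
    proof -
      have "(\<Sum>i\<in>I. c' i * v i x) = c' k * v k x + (\<Sum>i\<in>I - {k}. c' i * v i x)"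
        using insert.prems(1) k(1) by (rule sum.remove)
      also have "(\<Sum>i\<in>I - {k}. c' i * v i x) = (\<Sum>i\<in>I - {k}. c i * v i x)"
        by (intro sum.cong) (auto simp: c'_def)
      also have "c' k * v k x + \<dots> = (\<Sum>i\<in>I - {k}. c i * w i x)"
        by (simp add: c'_def w_def right_diff_distrib sum_subtractf sum_divide_distrib sum_distrib_right mult.assoc)
      finally show ?thesis .
    qed
    have "w i a = 0" for i using k by (simp add: w_def)
    then show ?thesis using c c' by (intro exI[of _ c']) (auto simp: c'_def)
  qed
qed

text \<open>The linear functional on polynomials that sends x^i to \<open>a i\<close>. With
  \<open>a i\<close> the value at y of the i-th iterate of a linear map on q, it is the value at y
  of p(map) q.\<close>

definition lin_eval :: "(nat \<Rightarrow> complex) \<Rightarrow> complex poly \<Rightarrow> complex" where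
  "lin_eval a p = (\<Sum>i\<le>degree p. coeff p i * a i)"

lemma lin_eval_bound: "degree p \<le> n \<Longrightarrow> lin_eval a p = (\<Sum>i\<le>n. coeff p i * a i)"
  unfolding lin_eval_def by (rule sum.mono_neutral_left) (auto simp: coeff_eq_0)

lemma lin_eval_linear_factor:
  "lin_eval a ([:- k, 1:] * p) = lin_eval (\<lambda>i. a (Suc i) - k * a i) p"
proof -
  have "degree ([:- k, 1:] * p) \<le> Suc (degree p)"
    using degree_mult_le[of "[:- k, 1:]" p] by simp
  then have "lin_eval a ([:- k, 1:] * p) = (\<Sum>i\<le>Suc (degree p). coeff ([:- k, 1:] * p) i * a i)"
    by (rule lin_eval_bound)
  also have "[:- k, 1:] * p = pCons 0 p + smult (- k) p" by simp
  also have "(\<Sum>i\<le>Suc (degree p). coeff (pCons 0 p + smult (- k) p) i * a i) =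
      (\<Sum>i\<le>Suc (degree p). coeff (pCons 0 p) i * a i) - k * (\<Sum>i\<le>Suc (degree p). coeff p i * a i)"
    by (simp only: coeff_add coeff_smult sum_distrib_left distrib_right sum.distrib)
      (simp add: sum_negf mult.assoc)
  also have "(\<Sum>i\<le>Suc (degree p). coeff (pCons 0 p) i * a i) = lin_eval (\<lambda>i. a (Suc i)) p"
    by (simp add: sum.atMost_Suc_shift lin_eval_def del: sum.atMost_Suc)
  also have "(\<Sum>i\<le>Suc (degree p). coeff p i * a i) = lin_eval a p"
    by (simp add: lin_eval_bound[of p "Suc (degree p)"])
  finally show ?thesis
    by (simp add: lin_eval_def sum_distrib_left sum_subtractf algebra_simps)
qed

text \<open>Some nonzero polynomial in the matrix annihilates q, as card S + 1 iterates are
  dependent. Its linear factors are split off one at a time: either the factor kills the current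
  vector on S, which is then an eigenvector, or the image is a nonzero vector of X annihilated by a
  polynomial of smaller degree. Vectors are compared on S only, although X consists of functions on
  the whole type.\<close>

lemma ex_eigenvector_invariant:
  fixes b :: "'a \<Rightarrow> 'a \<Rightarrow> complex"
  assumes "finite S"
    and X_act: "\<And>q. q \<in> X \<Longrightarrow> (\<lambda>y. \<Sum>x\<in>S. q x * b x y) \<in> X"
    and X_comb: "\<And>q q' c. q \<in> X \<Longrightarrow> q' \<in> X \<Longrightarrow> (\<lambda>y. q y - c * q' y) \<in> X"
    and "q \<in> X" "\<exists>x\<in>S. q x \<noteq> 0"
  shows "\<exists>q\<in>X. \<exists>k. (\<exists>x\<in>S. q x \<noteq> 0) \<and> (\<forall>y\<in>S. (\<Sum>x\<in>S. q x * b x y) = k * q y)"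
proof -
  define act where "act q = (\<lambda>y. \<Sum>x\<in>S. q x * b x y)" for q :: "'a \<Rightarrow> complex"
  have act_diff: "(act ^^ i) (\<lambda>y. q y - c * q' y) = (\<lambda>y. (act ^^ i) q y - c * (act ^^ i) q' y)"
    for i c q q'
    by (induction i) (auto simp: act_def sum_subtractf sum_distrib_left algebra_simps)
  have main: "\<exists>q\<in>X. \<exists>k. (\<exists>x\<in>S. q x \<noteq> 0) \<and> (\<forall>y\<in>S. act q y = k * q y)"
    if "p \<noteq> 0" "q \<in> X" "\<exists>x\<in>S. q x \<noteq> 0" "\<forall>y\<in>S. lin_eval (\<lambda>i. (act ^^ i) q y) p = 0" for p q
    using that
  proof (induction "degree p" arbitrary: p q)
    case 0
    then obtain c where "p = [:c:]" "c \<noteq> 0" by (metis degree_eq_zeroE pCons_0_0)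
    with 0 show ?case by (auto simp: lin_eval_def)
  next
    case (Suc n)
    then have "\<not> constant (poly p)" by (simp add: constant_degree)
    then obtain k where "poly p k = 0" using fundamental_theorem_of_algebra by blast
    then obtain p' where p': "p = [:- k, 1:] * p'" by (metis dvd_def poly_eq_0_iff_dvd)
    have "p' \<noteq> 0" using Suc.prems(1) p' by auto
    then have "degree p = Suc (degree p')"
      unfolding p' by (subst degree_mult_eq) auto
    then have deg: "n = degree p'" using Suc.hyps(2) by simp
    define q' where "q' = (\<lambda>y. act q y - k * q y)"
    show ?case
    proof (cases "\<exists>x\<in>S. q' x \<noteq> 0")
      case True
      have "q' \<in> X" unfolding q'_def act_def
        using Suc.prems(2) by (intro X_comb X_act)
      moreover have "(act ^^ i) q' y = (act ^^ Suc i) q y - k * (act ^^ i) q y" for i y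
        unfolding q'_def act_diff by (simp add: funpow_swap1)
      then have "\<forall>y\<in>S. lin_eval (\<lambda>i. (act ^^ i) q' y) p' = 0"
        using Suc.prems(4) unfolding p' lin_eval_linear_factor by simp
      ultimately show ?thesis using Suc.hyps(1)[OF deg \<open>p' \<noteq> 0\<close> _ True] by blast
    next
      case False
      then show ?thesis using Suc.prems(2,3) by (auto simp: q'_def)
    qed
  qed
  obtain c where c: "\<exists>i\<in>{..card S}. c i \<noteq> 0"
    "\<forall>y\<in>S. (\<Sum>i\<in>{..card S}. c i * (act ^^ i) q y) = 0"
    using ex_linear_dependence[OF \<open>finite S\<close>, of "{..card S}" "\<lambda>i. (act ^^ i) q"] by auto
  define p where "p = (\<Sum>i\<le>card S. monom (c i) i)"
  have coeff_p: "coeff p i = (if i \<le> card S then c i else 0)" for i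
    by (simp add: p_def coeff_sum)
  have "degree p \<le> card S" by (rule degree_le) (simp add: coeff_p)
  then have "\<forall>y\<in>S. lin_eval (\<lambda>i. (act ^^ i) q y) p = 0"
    using c(2) by (simp add: lin_eval_bound coeff_p)
  moreover have "p \<noteq> 0" using c(1) coeff_p by (metis atMost_iff coeff_0)
  ultimately show ?thesis using main[of p q] assms(4,5) by (auto simp: act_def)
qed

section \<open>Energies of orthogonal eigenvectors\<close>

lemma Im_cayley_param:
  fixes s :: real
  assumes "q \<noteq> 1"
  shows "Im (\<i> * s * (1 + q) / (1 - q)) = s * (1 - (cmod q)\<^sup>2) / (cmod (1 - q))\<^sup>2"
proof -
  have "\<i> * s * (1 + q) / (1 - q) = \<i> * s * (1 + q) * cnj (1 - q) / complex_of_real ((cmod (1 - q))\<^sup>2)"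
    by (rule complex_div_cnj)
  moreover have "Im (\<i> * s * (1 + q) * cnj (1 - q)) = s * (1 - (cmod q)\<^sup>2)"
    by (simp add: cmod_power2) (simp add: algebra_simps power2_eq_square)
  ultimately show ?thesis by (simp only: Im_divide_of_real)
qed

lemma cayley_param_diff:
  fixes c a b :: complex
  assumes "a \<noteq> 1" "b \<noteq> 1"
  shows "c * (1 + a) / (1 - a) - c * (1 + b) / (1 - b) = 2 * c * (a - b) / ((1 - a) * (1 - b))"
proof -
  have "c * (1 + a) / (1 - a) - c * (1 + b) / (1 - b)
      = (c * (1 + a) * (1 - b) - c * (1 + b) * (1 - a)) / ((1 - a) * (1 - b))"
    using assms by (intro diff_frac_eq) auto
  also have "c * (1 + a) * (1 - b) - c * (1 + b) * (1 - a) = 2 * c * (a - b)"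
    by (simp add: algebra_simps)
  finally show ?thesis .
qed

context cell_perturbation
begin

lemma resolvent_offdiagonal_bound:
  assumes "T r - z *\<^sub>C r = delta y" "0 < Im z" "y \<in> S" "x \<in> S"
  shows "(cmod (coord r x))\<^sup>2 \<le> 1 / (f x * f y)"
proof -
  have "f x * (cmod (coord r x))\<^sup>2 \<le> (\<Sum>x\<in>S. f x * (cmod (coord r x))\<^sup>2)"
    by (rule member_le_sum[OF \<open>x \<in> S\<close> _ finite_S, of "\<lambda>x. f x * (cmod (coord r x))\<^sup>2"])
      (auto intro: mult_nonneg_nonneg less_imp_le[OF f_pos])
  also have "\<dots> \<le> \<dots> + Im z * (norm r)\<^sup>2" using assms(2) by simp
  also have "\<dots> \<le> cmod (coord r y)"
    unfolding resolvent_energy[OF assms(1)] using abs_Im_le_cmod[of "coord r y"] by simp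
  also have "\<dots> \<le> 1 / f y" by (rule resolvent_bound(1)[OF assms(1-3)])
  finally have "(cmod (coord r x))\<^sup>2 \<le> (1 / f y) / f x"
    using f_pos[OF \<open>x \<in> S\<close>] by (subst pos_le_divide_eq) (simp_all add: mult.commute)
  then show ?thesis by (simp add: mult.commute)
qed

text \<open>T is complex symmetric: as A and P are real, conjugation carries T to its adjoint A + i
  P.\<close>

lemma T_adjoint_cnj: "cinner (cnj_ell2 u) (T v) = cinner (cnj_ell2 (T u)) v"
proof -
  have "cnj_ell2 (T u) = A (cnj_ell2 u) + \<i> *\<^sub>C P (cnj_ell2 u)"
    by (rule ell2_eqI) (simp add: T_def A_real coord_P)
  then show ?thesis
    by (simp add: T_def cinner_add_left cinner_diff_right cinner_scaleC_left cinner_scaleC_right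
        A_sym P_sym)
qed

text \<open>Symmetry of T under the bilinear pairing passes to its inverse. It lets left
  eigenvectors of the cell block be read as combinations of resolvent columns.\<close>

lemma resolvent_symmetric:
  assumes "T r - z *\<^sub>C r = delta y" "T r' - z *\<^sub>C r' = delta x"
  shows "coord r x = coord r' y"
proof -
  have "cnj_ell2 (z *\<^sub>C r') = cnj z *\<^sub>C cnj_ell2 r'" by (rule ell2_eqI) simp
  then have *: "cinner (cnj_ell2 r') (T r - z *\<^sub>C r) = cinner (cnj_ell2 (T r') - cnj_ell2 (z *\<^sub>C r')) r"
    by (simp add: cinner_diff_right cinner_diff_left T_adjoint_cnj cinner_scaleC_right cinner_scaleC_left)
  have "cnj_ell2 (T r') - cnj_ell2 (z *\<^sub>C r') = cnj_ell2 (T r' - z *\<^sub>C r')"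
    by (rule ell2_eqI) simp
  also have "\<dots> = delta x"
    unfolding assms(2) by (rule ell2_eqI) (simp add: coord_delta)
  finally have "cnj_ell2 (T r') - cnj_ell2 (z *\<^sub>C r') = delta x" .
  with * show ?thesis
    by (simp add: assms(1) cinner_delta cinner_commute[of "delta x" r])
qed

abbreviation eigen :: "real \<Rightarrow> real \<Rightarrow> 'a ell2 \<Rightarrow> bool" where
  "eigen l E u \<equiv> A u + of_real l *\<^sub>C P u = of_real E *\<^sub>C u"

text \<open>Pairing w with the equation for r moves A onto w, where it acts as E - l P. Besides the
  term in E - z, only the values of w and r in the cell remain.\<close>

lemma eigen_relation:
  assumes "eigen l E w"
    and "T r - z *\<^sub>C r = delta y"
  shows "cnj (coord w y) = (E - z) * cinner w r
    - (l + \<i>) * (\<Sum>x\<in>S. f x * cnj (coord w x) * coord r x)"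
proof -
  have Aw: "A w = of_real E *\<^sub>C w - of_real l *\<^sub>C P w"
    using assms(1) by (simp add: eq_diff_eq)
  have "cnj (coord w y) = cinner w (T r - z *\<^sub>C r)"
    by (simp add: assms(2) cinner_delta)
  also have "\<dots> = cinner (A w) r - \<i> * cinner w (P r) - z * cinner w r"
    by (simp add: T_def cinner_diff_right cinner_scaleC_right A_sym)
  also have "\<dots> = (E - z) * cinner w r - (l + \<i>) * cinner w (P r)"
    by (simp add: Aw cinner_diff_left cinner_scaleC_left P_sym algebra_simps)
  finally show ?thesis by (simp add: cinner_P)
qed

section \<open>Krylov vectors of the cell block and their annihilators\<close>

primrec krylov :: "real \<Rightarrow> ('a \<Rightarrow> real) \<Rightarrow> nat \<Rightarrow> 'a \<Rightarrow> complex \<Rightarrow> complex" where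
  "krylov s e 0 x q = complex_of_real (e x)"
| "krylov s e (Suc j) x q = (\<Sum>y\<in>S. coord (R s y q) x * f y * krylov s e j y q)"

context
  fixes s M
  assumes M: "is_bound M" "M < s"
begin

lemma Im_param_pos: "cmod q < 1 \<Longrightarrow> 0 < Im (\<i> * s * (1 + q) / (1 - q))"
  using s_pos[OF M]
  by (subst Im_cayley_param) (auto intro!: divide_pos_pos mult_pos_pos simp: power_less_one_iff abs_square_less_1)

lemma krylov_holomorphic: "krylov s e j x holomorphic_on ball 0 1"
proof (induction j arbitrary: x)
  case 0
  show ?case by (simp add: holomorphic_on_def field_differentiable_const)
next
  case (Suc j)
  have "(\<lambda>q. \<Sum>y\<in>S. coord (R s y q) x * f y * krylov s e j y q) holomorphic_on ball 0 1"
    by (intro holomorphic_intros R_holomorphic[OF M] Suc)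
  then show ?case by (simp add: fun_eq_iff cong: holomorphic_cong)
qed

lemma krylov_bounded: "x \<in> S \<Longrightarrow> \<exists>K. \<forall>q\<in>ball 0 1. cmod (krylov s e j x q) \<le> K"
proof (induction j arbitrary: x)
  case 0
  show ?case by auto
next
  case (Suc j)
  obtain K where K: "\<And>y q. y \<in> S \<Longrightarrow> q \<in> ball 0 1 \<Longrightarrow> cmod (krylov s e j y q) \<le> K y"
    using Suc.IH by metis
  have "cmod (krylov s e (Suc j) x q) \<le> (\<Sum>y\<in>S. sqrt (1 / (f x * f y)) * f y * K y)"
    if q: "q \<in> ball 0 1" for q
    unfolding krylov.simps
  proof (rule sum_norm_le)
    fix y assume y: "y \<in> S"
    have q': "cmod q < 1" using q by simp
    have "cmod (coord (R s y q) x) \<le> sqrt (1 / (f x * f y))"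
      using resolvent_offdiagonal_bound[OF R_eq[OF M q'] Im_param_pos[OF q'] y \<open>x \<in> S\<close>]
      by (rule real_le_rsqrt)
    then show "cmod (coord (R s y q) x * f y * krylov s e j y q) \<le> sqrt (1 / (f x * f y)) * f y * K y"
      unfolding norm_mult using K[OF y q] f_pos[OF y] f_pos[OF \<open>x \<in> S\<close>]
      by (intro mult_mono) auto
  qed
  then show ?case by blast
qed

text \<open>Along a radius E - z has size O(1 - r), whereas the resolvent column has norm O((Im
  z)^(-1/2)) = O((1 - r)^(-1/2)); the product is O(sqrt (1 - r)).\<close>

lemma radial_null:
  fixes r :: "nat \<Rightarrow> real" and E t :: real
  assumes t: "cis t \<noteq> 1" "complex_of_real E * (1 - cis t) = \<i> * s * (1 + cis t)"
    and r: "\<And>n. 0 < r n" "\<And>n. r n < 1" "r \<longlonglongrightarrow> 1" and y: "y \<in> S"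
  shows "(\<lambda>n. (E - \<i> * s * (1 + r n * cis t) / (1 - r n * cis t)) * cinner w (R s y (r n * cis t)))
    \<longlonglongrightarrow> 0"
proof (rule Lim_null_comparison)
  define C where "C = 4 * s * (norm w)\<^sup>2 / (f y * (cmod (1 - cis t))\<^sup>2)"
  have "(\<lambda>n. sqrt (C * (1 - r n))) \<longlonglongrightarrow> sqrt (C * (1 - 1))"
    by (intro tendsto_intros r)
  then show "(\<lambda>n. sqrt (C * (1 - r n))) \<longlonglongrightarrow> 0" by simp
  show "\<forall>\<^sub>F n in sequentially. norm ((E - \<i> * s * (1 + r n * cis t) / (1 - r n * cis t)) *
      cinner w (R s y (r n * cis t))) \<le> sqrt (C * (1 - r n))"
  proof (intro always_eventually allI)
    fix n
    let ?q = "r n * cis t"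
    let ?z = "\<i> * s * (1 + ?q) / (1 - ?q)"
    have q: "cmod ?q = r n" using r(1)[of n] by (simp add: norm_mult)
    then have q1: "cmod ?q < 1" "?q \<noteq> 1" using r(2)[of n] by auto
    have s: "s > 0" by (rule s_pos[OF M])
    have Im: "Im ?z = s * (1 - (r n)\<^sup>2) / (cmod (1 - ?q))\<^sup>2"
      using Im_cayley_param[OF q1(2)] by (simp add: q)
    have E_eq: "E = \<i> * s * (1 + cis t) / (1 - cis t)"
      using t by (simp add: nonzero_eq_divide_eq)
    have "E - ?z = 2 * \<i> * s * ((1 - r n) * cis t) / ((1 - cis t) * (1 - ?q))"
    proof -
      have "cis t - ?q = (1 - r n) * cis t" by (simp add: left_diff_distrib)
      then show ?thesis
        using cayley_param_diff[OF t(1) q1(2), of "\<i> * s"] unfolding E_eq by (simp only: mult.assoc)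
    qed
    moreover have "cmod (complex_of_real (1 - r n)) = 1 - r n"
      using r(2)[of n] unfolding norm_of_real by simp
    ultimately have "cmod (E - ?z) = 2 * s * (1 - r n) / (cmod (1 - cis t) * cmod (1 - ?q))"
      using s by (simp add: norm_divide norm_mult)
    then have dist: "(cmod (E - ?z))\<^sup>2 = 4 * s\<^sup>2 * (1 - r n)\<^sup>2 / ((cmod (1 - cis t))\<^sup>2 * (cmod (1 - ?q))\<^sup>2)"
      by (simp add: power_divide power_mult_distrib)
    have R: "(norm (R s y ?q))\<^sup>2 \<le> 1 / (f y * Im ?z)"
      by (rule resolvent_bound(2)[OF R_eq[OF M q1(1)] Im_param_pos[OF q1(1)] y])
    \<comment> \<open>The squares of |1 - q| in |E - z|^2 and in Im z cancel, leaving |1 - cis t| as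
      the only geometric factor.\<close>
    have cancel: "4 * s\<^sup>2 * x / (b * a) * W * (1 / (F * (s * U / a))) = 4 * s * W / (F * b) * (x / U)"
      if "a \<noteq> 0" "s \<noteq> 0" for a b x W F U :: real
      using that by (simp add: divide_simps power2_eq_square)
    have "(norm ((E - ?z) * cinner w (R s y ?q)))\<^sup>2 \<le> (cmod (E - ?z) * (norm w * norm (R s y ?q)))\<^sup>2"
      unfolding norm_mult by (intro power_mono mult_left_mono norm_cinner_le) auto
    also have "\<dots> = (cmod (E - ?z))\<^sup>2 * (norm w)\<^sup>2 * (norm (R s y ?q))\<^sup>2"
      by (simp add: power_mult_distrib)
    also have "\<dots> \<le> (cmod (E - ?z))\<^sup>2 * (norm w)\<^sup>2 * (1 / (f y * Im ?z))"
      by (intro mult_left_mono R) auto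
    also have "\<dots> = 4 * s * (norm w)\<^sup>2 / (f y * (cmod (1 - cis t))\<^sup>2) * ((1 - r n)\<^sup>2 / (1 - (r n)\<^sup>2))"
      unfolding dist Im by (rule cancel) (use q1(2) s in auto)
    also have "\<dots> \<le> C * (1 - r n)"
      unfolding C_def
    proof (intro mult_left_mono)
      have "1 - (r n)\<^sup>2 = (1 - r n) * (1 + r n)" by (simp add: power2_eq_square algebra_simps)
      then show "(1 - r n)\<^sup>2 / (1 - (r n)\<^sup>2) \<le> 1 - r n"
        using r(1,2)[of n] by (simp add: power2_eq_square divide_le_eq mult_left_le)
      show "0 \<le> 4 * s * (norm w)\<^sup>2 / (f y * (cmod (1 - cis t))\<^sup>2)"
        using s f_pos[OF y] by simp
    qed
    finally show "norm ((E - ?z) * cinner w (R s y ?q)) \<le> sqrt (C * (1 - r n))"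
      by (rule real_le_rsqrt)
  qed
qed

text \<open>The vectors q that annihilate all Krylov vectors at the centre form a subspace invariant
  under the cell block, so a nonzero one yields a left eigenvector. The combination u of resolvent
  columns with its coefficients is a multiple of q / f on the cell; hence u solves the eigenvalue
  equation at i s for some complex coupling and is orthogonal to e, which the hypothesis
  forbids.\<close>

lemma krylov_nondegenerate:
  assumes ND: "\<And>u c. A u + c *\<^sub>C P u = (\<i> * s) *\<^sub>C u \<Longrightarrow>
      (\<Sum>x\<in>S. e x * f x * coord u x) = 0 \<Longrightarrow> u = 0"
    and q0: "\<And>j. (\<Sum>x\<in>S. q x * krylov s e j x 0) = 0"
  shows "\<forall>x\<in>S. q x = 0"
proof (rule ccontr)
  assume nz: "\<not> (\<forall>x\<in>S. q x = 0)"
  define X where "X = {q. \<forall>j. (\<Sum>x\<in>S. q x * krylov s e j x 0) = 0}"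
  let ?b = "\<lambda>x y. coord (R s y 0) x * f y"
  have "\<exists>q\<in>X. \<exists>k. (\<exists>x\<in>S. q x \<noteq> 0) \<and> (\<forall>y\<in>S. (\<Sum>x\<in>S. q x * ?b x y) = k * q y)"
  proof (rule ex_eigenvector_invariant[OF finite_S])
    fix q assume "q \<in> X"
    have "(\<Sum>y\<in>S. (\<Sum>x\<in>S. q x * ?b x y) * krylov s e j y 0) = (\<Sum>x\<in>S. q x * krylov s e (Suc j) x 0)" for j
      unfolding krylov.simps sum_distrib_left sum_distrib_right
      by (subst sum.swap) (simp add: mult.assoc)
    then show "(\<lambda>y. \<Sum>x\<in>S. q x * ?b x y) \<in> X"
      using \<open>q \<in> X\<close> by (simp add: X_def del: krylov.simps)
  next
    fix q q' c assume "q \<in> X" "q' \<in> X"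
    then show "(\<lambda>y. q y - c * q' y) \<in> X"
      by (simp add: X_def left_diff_distrib sum_subtractf mult.assoc flip: sum_distrib_left)
  next
    show "q \<in> X" using q0 by (simp add: X_def)
  qed (use nz in auto)
  then obtain q k where q: "q \<in> X" "\<exists>x\<in>S. q x \<noteq> 0"
    and k: "\<And>y. y \<in> S \<Longrightarrow> (\<Sum>x\<in>S. q x * ?b x y) = k * q y" by blast
  define u where "u = (\<Sum>x\<in>S. q x *\<^sub>C R s x 0)"
  have Rx: "T (R s x 0) - (\<i> * s) *\<^sub>C R s x 0 = delta x" for x
    using R_eq[OF M, of 0 x] by simp
  have "T u - (\<i> * s) *\<^sub>C u = (\<Sum>x\<in>S. q x *\<^sub>C (T (R s x 0) - (\<i> * s) *\<^sub>C R s x 0))"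
    unfolding u_def linear_sum[OF bounded_linear.linear[OF T_bounded]]
      linear_sum[OF bounded_linear.linear[OF bounded_linear_scaleC]]
    by (simp add: T_scaleC scaleC_diff_right sum_subtractf mult.commute)
  then have Tu: "T u - (\<i> * s) *\<^sub>C u = (\<Sum>x\<in>S. q x *\<^sub>C delta x)" by (simp add: Rx)
  have g: "coord (\<Sum>x\<in>S. q x *\<^sub>C delta x) i = (if i \<in> S then q i else 0)" for i
    by (simp add: coord_sum coord_delta finite_S if_distrib cong: if_cong)
  have u_S: "f y * coord u y = k * q y" if "y \<in> S" for y
  proof -
    have "coord u y = (\<Sum>x\<in>S. q x * coord (R s y 0) x)"
      unfolding u_def coord_sum using resolvent_symmetric[OF Rx Rx] by simp
    then show ?thesis using k[OF that] by (simp add: sum_distrib_left mult_ac)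
  qed
  have "u = 0"
  proof (cases "k = 0")
    \<comment> \<open>Eigenvalue 0 corresponds to no finite coupling; but then u vanishes on the
      cell, and the imaginary part of the energy identity kills it.\<close>
    case True
    then have u0: "coord u y = 0" if "y \<in> S" for y
      using u_S[OF that] f_pos[OF that] by simp
    have "cinner u (T u - (\<i> * s) *\<^sub>C u) = 0"
      unfolding Tu by (subst cinner_finite_support[OF finite_S]) (auto simp: g u0)
    then have "cinner u (T u) = \<i> * s * cinner u u"
      by (simp add: cinner_diff_right cinner_scaleC_right)
    from arg_cong[OF this, of Im] have "s * (norm u)\<^sup>2 = 0"
      by (simp add: Im_cinner_T u0 cinner_self_norm)
    then show ?thesis using s_pos[OF M] by simp
  next
    case False
    show ?thesis
    proof (rule ND)
      \<comment> \<open>Since f u = k q on S, the source is P u / k; moving it to the left gives the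
        coupling c = -(1 / k + i).\<close>
      have "(\<Sum>x\<in>S. q x *\<^sub>C delta x) = (1 / k) *\<^sub>C P u"
        using False u_S by (intro ell2_eqI) (auto simp: g coord_P f_zero)
      then have "T u - (\<i> * s) *\<^sub>C u = (1 / k) *\<^sub>C P u" using Tu by simp
      then have "coord (A u) i = \<i> * s * coord u i + (1 / k + \<i>) * (f i * coord u i)" for i
        using arg_cong[of _ _ "\<lambda>u. coord u i"] by (force simp: T_def coord_P algebra_simps)
      then show "A u + (- (1 / k + \<i>)) *\<^sub>C P u = (\<i> * s) *\<^sub>C u"
        by (intro ell2_eqI) (simp add: coord_P algebra_simps)
      have "(\<Sum>x\<in>S. q x * krylov s e 0 x 0) = 0" using q(1) unfolding X_def by blast
      then have "k * (\<Sum>x\<in>S. e x * q x) = 0" by (simp add: mult.commute)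
      then show "(\<Sum>x\<in>S. e x * f x * coord u x) = 0"
        by (simp add: sum_distrib_left u_S mult.assoc mult.left_commute[of k] cong: sum.cong)
    qed
  qed
  then have "T u - (\<i> * s) *\<^sub>C u = 0"
    by (simp add: linear_0[OF bounded_linear.linear[OF T_bounded]])
  then have "coord (\<Sum>x\<in>S. q x *\<^sub>C delta x) i = 0" for i unfolding Tu by simp
  then show False using q(2) unfolding g by metis
qed

end

text \<open>Inverts the Cayley parameter on the boundary: cis t corresponds to the real energy E,
  and the excluded point 1 to infinity.\<close>

lemma energy_param:
  fixes s E :: real
  assumes "s > 0"
  defines "t \<equiv> 2 * arctan (E / s) + pi"
  shows "t \<in> {0<..<2*pi}" "E = s * tan (t / 2 - pi / 2)" "cis t \<noteq> 1"
    "complex_of_real E * (1 - cis t) = \<i> * s * (1 + cis t)"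
proof -
  define a where "a = arctan (E / s)"
  have a: "- (pi / 2) < a" "a < pi / 2" "tan a = E / s" "cos a > 0"
    using arctan_lbound arctan_ubound tan_arctan cos_gt_zero_pi by (auto simp: a_def)
  show "t \<in> {0<..<2*pi}" using a by (simp add: t_def flip: a_def)
  show "E = s * tan (t / 2 - pi / 2)"
    using a(3) assms(1) by (simp add: t_def add_divide_distrib flip: a_def)
  have E: "E = s * sin a / cos a" using a assms(1) by (simp add: tan_def field_simps)
  have cis: "cis t = Complex (- (2 * (cos a)\<^sup>2 - 1)) (- (2 * sin a * cos a))"
    by (simp add: t_def complex_eq_iff cos_double_cos sin_double flip: a_def)
  have "2 * (cos a)\<^sup>2 > 0" using a(4) by simp
  then show "cis t \<noteq> 1" unfolding cis by (simp add: complex_eq_iff)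
  show "complex_of_real E * (1 - cis t) = \<i> * s * (1 + cis t)"
  proof -
    have "s * (cos a * (cos a * 2)) + s * (sin a * (sin a * 2)) = s * 2"
      using sin_cos_squared_add3[of a] by algebra
    then show ?thesis
      unfolding cis E using a(4) by (simp add: complex_eq_iff field_simps power2_eq_square)
  qed
qed

text \<open>The angles for which some nonzero p annihilates all Krylov vectors in the radial limit
  form a null set, defined without reference to l. The map from angles to energies is
  differentiable, so it carries null sets to null sets.\<close>

lemma orthogonal_energies_negligible:
  assumes ND: "\<And>s u c. s > s0 \<Longrightarrow> A u + c *\<^sub>C P u = (\<i> * complex_of_real s) *\<^sub>C u \<Longrightarrow>
      (\<Sum>x\<in>S. e x * f x * coord u x) = 0 \<Longrightarrow> u = 0"
  shows "negligible {E. \<exists>l w. eigen l E w \<and>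
    (\<exists>x\<in>S. coord w x \<noteq> 0) \<and> (\<Sum>x\<in>S. e x * f x * coord w x) = 0}" (is "negligible ?E")
proof -
  obtain M where M0: "is_bound M" using ex_bound by blast
  define s where "s = max M s0 + 1"
  have M: "is_bound M" "M < s" and s: "s > s0" using M0 by (auto simp: s_def)
  have s_gt: "s > 0" by (rule s_pos[OF M])
  define r where "r n = 1 - 1 / (real n + 2)" for n
  have r: "0 < r n" "r n < 1" for n by (auto simp: r_def field_simps)
  have r_lim: "r \<longlonglongrightarrow> 1" unfolding r_def by real_asymp
  define N where "N = {t\<in>{0..2*pi}. \<exists>q. (\<exists>x\<in>S. q x \<noteq> 0) \<and>
    (\<forall>j. (\<lambda>n. \<Sum>x\<in>S. q x * krylov s e j x (r n * cis t)) \<longlonglongrightarrow> 0)}"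
  have "negligible N"
    unfolding N_def
    by (rule vector_radial_uniqueness[OF finite_S krylov_holomorphic[OF M] krylov_bounded[OF M]
          krylov_nondegenerate[OF M ND[OF s]] r]) auto
  then have "negligible (N \<inter> {0<..<2*pi})" by (rule negligible_subset) simp
  then have "negligible ((\<lambda>t. s * tan (t / 2 - pi / 2)) ` (N \<inter> {0<..<2*pi}))"
  proof (rule negligible_differentiable_image_negligible[OF order_refl])
    show "(\<lambda>t. s * tan (t / 2 - pi / 2)) differentiable_on N \<inter> {0<..<2*pi}"
      unfolding differentiable_on_def
    proof
      fix t assume "t \<in> N \<inter> {0<..<2*pi}"
      then have "cos (t / 2 - pi / 2) > 0" by (intro cos_gt_zero_pi) (auto simp: field_simps)
      then have "\<exists>D. ((\<lambda>t. s * tan (t / 2 - pi / 2)) has_field_derivative D) (at t)"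
        by (intro exI) (auto intro!: derivative_eq_intros)
      then show "(\<lambda>t. s * tan (t / 2 - pi / 2)) differentiable at t within N \<inter> {0<..<2*pi}"
        using has_field_derivative_imp_has_derivative differentiableI differentiable_at_withinI
        by metis
    qed
  qed
  moreover have "?E \<subseteq> (\<lambda>t. s * tan (t / 2 - pi / 2)) ` (N \<inter> {0<..<2*pi})"
  proof
    fix E assume "E \<in> ?E"
    then obtain l w where w: "eigen l E w"
      and nz: "\<exists>x\<in>S. coord w x \<noteq> 0" and orth: "(\<Sum>x\<in>S. e x * f x * coord w x) = 0" by blast
    define t where "t = 2 * arctan (E / s) + pi"
    note t = energy_param[OF s_gt, of E, folded t_def]
    let ?z = "\<lambda>n. \<i> * s * (1 + r n * cis t) / (1 - r n * cis t)"
    define p where "p x = f x * cnj (coord w x)" for x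
    define err where "err y n = f y / (l + \<i>) *
      ((E - ?z n) * cinner w (R s y (r n * cis t)))" for y n
    have li: "complex_of_real l + \<i> \<noteq> 0" by (simp add: complex_eq_iff)
    have in_ball: "complex_of_real (r n) * cis t \<in> ball 0 1" for n
      using r[of n] by (simp add: norm_mult)
    have err_lim: "err y \<longlonglongrightarrow> 0" if "y \<in> S" for y
      unfolding err_def by (intro tendsto_mult_right_zero radial_null[OF M t(3,4) r r_lim that])
    \<comment> \<open>Up to \<open>err\<close>, p is a left eigenvector of the cell block with
      eigenvalue -1 / (l + i); the denominator is nonzero because l is real.\<close>
    have row: "(\<Sum>x\<in>S. p x * (coord (R s y (r n * cis t)) x * f y)) = err y n - p y / (l + \<i>)"
      if "y \<in> S" for y n
    proof -
      have "cmod (r n * cis t) < 1" using in_ball[of n] by simp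
      from eigen_relation[OF w R_eq[OF M this, of y]]
      have "(l + \<i>) * (\<Sum>x\<in>S. p x * coord (R s y (r n * cis t)) x) =
        (E - ?z n) * cinner w (R s y (r n * cis t)) - cnj (coord w y)"
        by (simp add: p_def algebra_simps)
      then have "(\<Sum>x\<in>S. p x * coord (R s y (r n * cis t)) x) =
        ((E - ?z n) * cinner w (R s y (r n * cis t))
          - cnj (coord w y)) / (l + \<i>)"
        using li by (simp add: nonzero_eq_divide_eq mult.commute)
      then have "f y * (\<Sum>x\<in>S. p x * coord (R s y (r n * cis t)) x) = err y n - p y / (l + \<i>)"
        unfolding err_def p_def by (simp add: diff_divide_distrib right_diff_distrib)
      then show ?thesis by (simp add: sum_distrib_left mult_ac)
    qed
    have "(\<lambda>n. \<Sum>x\<in>S. p x * krylov s e j x (r n * cis t)) \<longlonglongrightarrow> 0" for j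
    proof (induction j)
      case 0
      have "(\<Sum>x\<in>S. p x * e x) = cnj (\<Sum>x\<in>S. e x * f x * coord w x)"
        by (simp add: p_def mult_ac)
      also have "\<dots> = 0" unfolding orth by simp
      finally show ?case by simp
    next
      case (Suc j)
      have null: "(\<lambda>n. err y n * krylov s e j y (r n * cis t)) \<longlonglongrightarrow> 0" if y: "y \<in> S" for y
      proof -
        obtain K where "\<forall>q\<in>ball 0 1. cmod (krylov s e j y q) \<le> K"
          using krylov_bounded[OF M y] by blast
        then show ?thesis
          using in_ball by (intro lim_null_mult_right_bounded[of _ _ _ K] err_lim[OF y]) auto
      qed
      have "(\<Sum>x\<in>S. p x * krylov s e (Suc j) x (r n * cis t)) =
          (\<Sum>y\<in>S. (\<Sum>x\<in>S. p x * (coord (R s y (r n * cis t)) x * f y)) * krylov s e j y (r n * cis t))" for n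
        unfolding krylov.simps sum_distrib_left sum_distrib_right
        by (subst sum.swap) (simp add: mult.assoc)
      also have "\<dots> n = (\<Sum>y\<in>S. err y n * krylov s e j y (r n * cis t))
          - (\<Sum>y\<in>S. p y * krylov s e j y (r n * cis t)) / (l + \<i>)" for n
        by (simp add: row left_diff_distrib sum_subtractf sum_divide_distrib cong: sum.cong)
      finally have eq: "(\<Sum>x\<in>S. p x * krylov s e (Suc j) x (r n * cis t)) =
        (\<Sum>y\<in>S. err y n * krylov s e j y (r n * cis t))
          - (\<Sum>y\<in>S. p y * krylov s e j y (r n * cis t)) / (l + \<i>)" for n .
      have "(\<lambda>n. (\<Sum>y\<in>S. err y n * krylov s e j y (r n * cis t))
          - (\<Sum>y\<in>S. p y * krylov s e j y (r n * cis t)) / (l + \<i>)) \<longlonglongrightarrow> 0 - 0"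
        by (intro tendsto_diff tendsto_null_sum null tendsto_divide_zero Suc.IH)
      then show ?case unfolding eq by simp
    qed
    moreover have "\<exists>x\<in>S. p x \<noteq> 0" using nz f_pos by (force simp: p_def)
    ultimately have "t \<in> N" using t(1) unfolding N_def by auto
    then show "E \<in> (\<lambda>t. s * tan (t / 2 - pi / 2)) ` (N \<inter> {0<..<2*pi})"
      using t(1,2) by blast
  qed
  ultimately show ?thesis by (rule negligible_subset)
qed

end

section \<open>From energies to coupling constants\<close>

text \<open>At equal energies the Lipschitz bound gives equal couplings, so Q is the graph of a
  Lipschitz function of the energy, and such functions map null sets to null sets.\<close>

lemma lipschitz_relation_negligible:
  fixes Q :: "(real \<times> real) set"
  assumes "negligible X" "\<And>E l. (E, l) \<in> Q \<Longrightarrow> E \<in> X"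
    and lip: "\<And>E l E' l'. (E, l) \<in> Q \<Longrightarrow> (E', l') \<in> Q \<Longrightarrow> \<bar>l - l'\<bar> \<le> B * \<bar>E - E'\<bar>"
  shows "negligible (snd ` Q)"
proof -
  define h where "h E = (SOME l. (E, l) \<in> Q)" for E
  have h: "(E, h E) \<in> Q" if "(E, l) \<in> Q" for E l
    unfolding h_def using that by (rule someI)
  have h_eq: "h E = l" if "(E, l) \<in> Q" for E l
    using lip[OF h[OF that] that] by simp
  have "negligible (fst ` Q)"
    using assms(1) by (rule negligible_subset) (use assms(2) in auto)
  then have "negligible (h ` fst ` Q)"
  proof (rule negligible_locally_Lipschitz_image[OF order_refl])
    fix x assume "x \<in> fst ` Q"
    then obtain l where l: "(x, l) \<in> Q" by auto
    have "\<forall>y\<in>fst ` Q. norm (h y - h x) \<le> B * norm (y - x)"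
    proof
      fix y assume "y \<in> fst ` Q"
      then obtain l' where "(y, l') \<in> Q" by auto
      from lip[OF h[OF this] h[OF l]] show "norm (h y - h x) \<le> B * norm (y - x)" by simp
    qed
    then show "\<exists>T B. open T \<and> x \<in> T \<and> (\<forall>y\<in>fst ` Q \<inter> T. norm (h y - h x) \<le> B * norm (y - x))"
      by (intro exI[of _ UNIV] exI[of _ B]) auto
  qed
  moreover have "snd ` Q \<subseteq> h ` fst ` Q"
    using h_eq by force
  ultimately show ?thesis by (rule negligible_subset)
qed

context cell_perturbation
begin

text \<open>Eigenvectors to k + 1 distinct energies are orthogonal, so their sum has squared norm at
  most (k + 1) k, while its coordinate at n equals k + 1; a coordinate never exceeds the
  norm.\<close>

lemma eigenvalues_finite:
  "finite {E. \<exists>w. A w = of_real E *\<^sub>C w \<and> coord w n = 1 \<and> (norm w)\<^sup>2 \<le> real k}"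
    (is "finite ?E")
proof (rule ccontr)
  assume "infinite ?E"
  then obtain X where X: "X \<subseteq> ?E" "finite X" "card X = Suc k"
    using infinite_arbitrarily_large by blast
  then obtain w where w: "\<And>E. E \<in> X \<Longrightarrow> A (w E) = of_real E *\<^sub>C w E"
    "\<And>E. E \<in> X \<Longrightarrow> coord (w E) n = 1" "\<And>E. E \<in> X \<Longrightarrow> (norm (w E))\<^sup>2 \<le> real k"
  proof -
    have "\<forall>E\<in>X. \<exists>w. A w = of_real E *\<^sub>C w \<and> coord w n = 1 \<and> (norm w)\<^sup>2 \<le> real k"
      using X(1) by blast
    from bchoice[OF this] show ?thesis using that by blast
  qed
  have orth: "cinner (w E) (w E') = 0" if "E \<in> X" "E' \<in> X" "E \<noteq> E'" for E E'
  proof -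
    have "complex_of_real E * cinner (w E) (w E') = complex_of_real E' * cinner (w E) (w E')"
      using A_sym[of "w E" "w E'"]
      unfolding w(1)[OF that(1)] w(1)[OF that(2)] cinner_scaleC_left cinner_scaleC_right by simp
    then show ?thesis using that(3) by simp
  qed
  have norm_sum: "finite Y \<Longrightarrow> Y \<subseteq> X \<Longrightarrow> (norm (\<Sum>E\<in>Y. w E))\<^sup>2 = (\<Sum>E\<in>Y. (norm (w E))\<^sup>2)" for Y
    by (rule norm_sum_Pythagorean) (auto simp: pairwise_def orthogonal_def inner_ell2_def orth subset_iff)
  have "(real (Suc k))\<^sup>2 = (cmod (coord (\<Sum>E\<in>X. w E) n))\<^sup>2"
    unfolding coord_sum using X(3) by (simp add: w(2) del: of_nat_Suc)
  also have "\<dots> \<le> (norm (\<Sum>E\<in>X. w E))\<^sup>2"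
    by (intro power_mono coord_le_norm) simp
  also have "\<dots> = (\<Sum>E\<in>X. (norm (w E))\<^sup>2)" using X(2) by (intro norm_sum) auto
  also have "\<dots> \<le> (\<Sum>E\<in>X. real k)" by (intro sum_mono w(3))
  also have "\<dots> = real (Suc k) * real k" using X(3) by simp
  finally show False by (simp add: power2_eq_square)
qed

text \<open>The index type may be uncountable, so countability is asked only for eigenvectors seen
  by the countable set V. Rescaling to coordinate 1 at some n in V sorts the energies into countably
  many finite sets.\<close>

lemma eigenvalues_countable:
  assumes "countable V"
  shows "countable {E. \<exists>w. A w = of_real E *\<^sub>C w \<and> (\<exists>n\<in>V. coord w n \<noteq> 0)}"
proof (rule countable_subset)
  let ?F = "\<lambda>n k. {E. \<exists>w. A w = of_real E *\<^sub>C w \<and> coord w n = 1 \<and> (norm w)\<^sup>2 \<le> real k}"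
  show "countable (\<Union>n\<in>V. \<Union>k. ?F n k)"
    using assms eigenvalues_finite by (intro countable_UN) (auto intro: countable_finite)
  show "{E. \<exists>w. A w = of_real E *\<^sub>C w \<and> (\<exists>n\<in>V. coord w n \<noteq> 0)} \<subseteq> (\<Union>n\<in>V. \<Union>k. ?F n k)"
  proof
    fix E assume "E \<in> {E. \<exists>w. A w = of_real E *\<^sub>C w \<and> (\<exists>n\<in>V. coord w n \<noteq> 0)}"
    then obtain w n where w: "A w = of_real E *\<^sub>C w" "n \<in> V" "coord w n \<noteq> 0" by blast
    define w' where "w' = (1 / coord w n) *\<^sub>C w"
    obtain k where "(norm w')\<^sup>2 \<le> real k" using real_arch_simple by blast
    moreover have "A w' = of_real E *\<^sub>C w'"
      by (simp add: w'_def A_scaleC w(1) mult.commute)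
    moreover have "coord w' n = 1" using w(3) by (simp add: w'_def)
    ultimately show "E \<in> (\<Union>n\<in>V. \<Union>k. ?F n k)" using w(2) by blast
  qed
qed

lemma coupling_identity:
  assumes "eigen l E u"
    and "A v + complex_of_real l' *\<^sub>C P v = complex_of_real E' *\<^sub>C v"
  shows "complex_of_real (E - E') * cinner v u = complex_of_real (l - l') * cinner v (P u)"
proof -
  have "A u = of_real E *\<^sub>C u - of_real l *\<^sub>C P u"
    using assms(1) by (simp add: eq_diff_eq)
  then have "cinner v (A u) = E * cinner v u - l * cinner v (P u)"
    by (simp add: cinner_diff_right cinner_scaleC_right)
  moreover have "A v = complex_of_real E' *\<^sub>C v - complex_of_real l' *\<^sub>C P v"
    using assms(2) by (simp add: eq_diff_eq)
  then have "cinner (A v) u = E' * cinner v u - l' * cinner v (P u)"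
    by (simp add: cinner_diff_left cinner_scaleC_left P_sym)
  ultimately show ?thesis
    using A_sym[of v u] unfolding of_real_diff by algebra
qed

text \<open>Normalise the eigenvectors so that their restrictions to the cell are unit vectors for P. On a piece
  where these restrictions are close to each other and the norms are bounded, the coupling identity
  makes l a Lipschitz function of E.\<close>

lemma coupling_negligible_of_energies:
  assumes "negligible X"
  shows "negligible {l. \<exists>E\<in>X. \<exists>u. eigen l E u \<and>
    (\<exists>x\<in>S. coord u x \<noteq> 0)}" (is "negligible ?L")
proof -
  \<comment> \<open>Chosen such that the total weight times 2 / N, the squared distance allowed
    within one grid cell, is (N - 1) / N and so below 1.\<close>
  define N where "N = 1 + 2 * (\<Sum>x\<in>S. f x)"
  have f_sum: "(\<Sum>x\<in>S. f x) \<ge> 0" by (intro sum_nonneg less_imp_le[OF f_pos])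
  then have N: "N \<ge> 1" by (simp add: N_def)
  define code where "code u = (\<lambda>x\<in>S. (\<lfloor>N * Re (coord u x)\<rfloor>, \<lfloor>N * Im (coord u x)\<rfloor>))" for u :: "'a ell2"
  define Q where "Q g k = {(E, l). E \<in> X \<and> (\<exists>u. eigen l E u \<and>
      cinner u (P u) = 1 \<and> norm u \<le> real k \<and> code u = g)}" for g k
  \<comment> \<open>Polarisation: vectors of P-length 1 whose difference has squared P-length at
    most 1 have real inner product at least 1 / 2, so the coupling identity can be divided by
    it.\<close>
  have close: "1 / 2 \<le> cmod (cinner v (P u))"
    if u: "cinner u (P u) = 1" and v: "cinner v (P v) = 1" and uv: "code u = code v" for u v
  proof -
    have le: "(cmod (coord u x - coord v x))\<^sup>2 \<le> 2 / N" if "x \<in> S" for x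
    proof -
      have floor_close: "(a - b)\<^sup>2 \<le> 1 / N" if "\<lfloor>N * a\<rfloor> = \<lfloor>N * b\<rfloor>" for a b
      proof -
        have "\<bar>N * a - N * b\<bar> \<le> 1" using that by linarith
        then have "(N * (a - b))\<^sup>2 \<le> 1" by (simp add: right_diff_distrib abs_square_le_1)
        then have "N * (a - b)\<^sup>2 \<le> 1"
          using N mult_right_mono[of N "N\<^sup>2" "(a - b)\<^sup>2"]
          by (simp add: power_mult_distrib self_le_power)
        then show ?thesis using N by (simp add: field_simps)
      qed
      have "\<lfloor>N * Re (coord u x)\<rfloor> = \<lfloor>N * Re (coord v x)\<rfloor>" "\<lfloor>N * Im (coord u x)\<rfloor> = \<lfloor>N * Im (coord v x)\<rfloor>"
        using fun_cong[OF uv, of x] that by (simp_all add: code_def)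
      from floor_close[OF this(1)] floor_close[OF this(2)] show ?thesis
        by (simp add: cmod_power2)
    qed
    have "(\<Sum>x\<in>S. f x * (cmod (coord (u - v) x))\<^sup>2) \<le> (\<Sum>x\<in>S. f x * (2 / N))"
      by (intro sum_mono mult_left_mono) (auto simp: le intro: less_imp_le[OF f_pos])
    also have "\<dots> = (\<Sum>x\<in>S. f x) * (2 / N)" by (rule sum_distrib_right[symmetric])
    also have "\<dots> = (N - 1) / N" by (simp add: N_def)
    also have "\<dots> \<le> 1" using N by simp
    finally have "Re (cinner (u - v) (P (u - v))) \<le> 1" by (simp add: P_quadratic)
    moreover have "Re (cinner u (P v)) = Re (cinner v (P u))"
      by (subst cinner_commute) (simp add: P_sym)
    ultimately have "1 / 2 \<le> Re (cinner v (P u))"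
      by (simp add: linear_diff[OF bounded_linear.linear[OF bounded_linear_mult_op[OF f_bounded]]]
          cinner_diff_left cinner_diff_right u v)
    then show ?thesis using complex_Re_le_cmod order_trans by blast
  qed
  have "negligible (snd ` Q g k)" for g k
  proof (rule lipschitz_relation_negligible[OF assms])
    fix E l E' l' assume "(E, l) \<in> Q g k" "(E', l') \<in> Q g k"
    then obtain u v where u: "eigen l E u"
        "cinner u (P u) = 1" "norm u \<le> real k" "code u = g"
      and v: "A v + complex_of_real l' *\<^sub>C P v = complex_of_real E' *\<^sub>C v"
        "cinner v (P v) = 1" "norm v \<le> real k" "code v = g"
      unfolding Q_def by auto
    have "\<bar>l - l'\<bar> * (1 / 2) \<le> \<bar>l - l'\<bar> * cmod (cinner v (P u))"
      using close[of u v] u v by (intro mult_left_mono) auto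
    also have "\<dots> = \<bar>E - E'\<bar> * cmod (cinner v u)"
      using arg_cong[OF coupling_identity[OF u(1) v(1)], of cmod]
      unfolding norm_mult norm_of_real by simp
    also have "\<dots> \<le> \<bar>E - E'\<bar> * (real k * real k)"
      by (intro mult_left_mono order_trans[OF norm_cinner_le] mult_mono u v) auto
    finally show "\<bar>l - l'\<bar> \<le> 2 * (real k * real k) * \<bar>E - E'\<bar>" by (simp add: mult_ac)
  qed (simp add: Q_def)
  moreover have "countable (PiE S (\<lambda>_. UNIV :: (int \<times> int) set))"
    by (rule countable_PiE[OF finite_S]) simp
  ultimately have "negligible (\<Union>g\<in>PiE S (\<lambda>_. UNIV). \<Union>k. snd ` Q g k)"
    by (intro negligible_countable_Union) auto
  moreover have "?L \<subseteq> (\<Union>g\<in>PiE S (\<lambda>_. UNIV). \<Union>k. snd ` Q g k)"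
  proof
    fix l assume "l \<in> ?L"
    then obtain E u x where u: "E \<in> X" "eigen l E u"
      and x: "x \<in> S" "coord u x \<noteq> 0" by blast
    define c where "c = (\<Sum>x\<in>S. f x * (cmod (coord u x))\<^sup>2)"
    have "0 < f x * (cmod (coord u x))\<^sup>2" using x f_pos by simp
    also have "\<dots> \<le> c" unfolding c_def
      by (rule member_le_sum[OF \<open>x \<in> S\<close> _ finite_S, of "\<lambda>x. f x * (cmod (coord u x))\<^sup>2"])
        (auto intro: mult_nonneg_nonneg less_imp_le[OF f_pos])
    finally have c: "c > 0" .
    define w where "w = complex_of_real (1 / sqrt c) *\<^sub>C u"
    have "A w + of_real l *\<^sub>C P w = complex_of_real (1 / sqrt c) *\<^sub>C (A u + of_real l *\<^sub>C P u)"
      by (simp add: w_def A_scaleC P_scaleC scaleC_add_right mult.commute)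
    then have "eigen l E w"
      by (simp add: u(2) w_def mult.commute)
    moreover have "cinner w (P w) = 1"
      using c by (simp add: w_def P_scaleC cinner_scaleC_left cinner_scaleC_right P_quadratic
          flip: c_def of_real_mult)
    moreover obtain k where "norm w \<le> real k" using real_arch_simple by blast
    moreover have "code w \<in> PiE S (\<lambda>_. UNIV)" by (simp add: code_def)
    ultimately have "(E, l) \<in> Q (code w) k" using u(1) by (auto simp: Q_def)
    then show "l \<in> (\<Union>g\<in>PiE S (\<lambda>_. UNIV). \<Union>k. snd ` Q g k)"
      using \<open>code w \<in> _\<close> by force
  qed
  ultimately show ?thesis by (rule negligible_subset)
qed

text \<open>Degeneracy is recorded as a nonzero minor of u and v with one point in the cell. The
  minor makes every nontrivial combination of u and v nonzero, and the one orthogonal to e places E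
  in an exceptional set. That combination may vanish on the cell, so the transfer to couplings is
  applied to u or v instead, one of which is nonzero at x.\<close>

lemma coupling_negligible:
  assumes ND: "\<And>s u c. s > s0 \<Longrightarrow> A u + c *\<^sub>C P u = (\<i> * complex_of_real s) *\<^sub>C u \<Longrightarrow>
      (\<Sum>x\<in>S. e x * f x * coord u x) = 0 \<Longrightarrow> u = 0"
    and V: "countable V"
  shows "negligible {l. \<exists>E u v. eigen l E u \<and>
    eigen l E v \<and>
    (\<forall>n. n \<notin> V \<longrightarrow> coord u n = 0 \<and> coord v n = 0) \<and>
    (\<exists>x\<in>S. \<exists>y. coord u x * coord v y \<noteq> coord u y * coord v x)}" (is "negligible ?L")
proof -
  let ?E1 = "{E. \<exists>w. A w = of_real E *\<^sub>C w \<and> (\<exists>n\<in>V. coord w n \<noteq> 0)}"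
  let ?E2 = "{E. \<exists>l w. eigen l E w \<and>
    (\<exists>x\<in>S. coord w x \<noteq> 0) \<and> (\<Sum>x\<in>S. e x * f x * coord w x) = 0}"
  have "negligible ?E1"
    unfolding negligible_iff_null_sets
    by (intro null_sets_completionI countable_imp_null_set_lborel eigenvalues_countable V)
  moreover have "negligible ?E2" by (rule orthogonal_energies_negligible[OF ND])
  ultimately have "negligible (?E1 \<union> ?E2)" by (rule negligible_Un)
  from coupling_negligible_of_energies[OF this] show ?thesis
  proof (rule negligible_subset, intro subsetI)
    fix l assume "l \<in> ?L"
    then obtain E u v x y where u: "eigen l E u"
      and v: "eigen l E v"
      and supp: "\<And>n. n \<notin> V \<Longrightarrow> coord u n = 0 \<and> coord v n = 0"
      and x: "x \<in> S" and minor: "coord u x * coord v y \<noteq> coord u y * coord v x" by blast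
    define \<phi> where "\<phi> w = (\<Sum>x\<in>S. e x * f x * coord w x)" for w
    obtain a b where ab: "a \<noteq> 0 \<or> b \<noteq> 0" "a * \<phi> u + b * \<phi> v = 0"
    proof (cases "\<phi> u = 0 \<and> \<phi> v = 0")
      case True
      then show ?thesis using that[of 1 0] by simp
    next
      case False
      then show ?thesis using that[of "\<phi> v" "- \<phi> u"] by auto
    qed
    define w where "w = a *\<^sub>C u + b *\<^sub>C v"
    have \<phi>_w: "\<phi> w = 0"
      using ab(2) by (simp add: \<phi>_def w_def algebra_simps sum.distrib sum_distrib_left)
    have "\<exists>n. coord w n \<noteq> 0"
    proof (rule ccontr)
      assume "\<nexists>n. coord w n \<noteq> 0"
      then have *: "a * coord u n + b * coord v n = 0" for n by (simp add: w_def)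
      have "a * (coord u x * coord v y - coord u y * coord v x) = 0"
        "b * (coord u x * coord v y - coord u y * coord v x) = 0"
        using *[of x] *[of y] by algebra+
      then show False using ab(1) minor by simp
    qed
    then obtain n where n: "coord w n \<noteq> 0" by blast
    then have "n \<in> V" using supp by (force simp: w_def)
    have "A w + of_real l *\<^sub>C P w =
        a *\<^sub>C (A u + of_real l *\<^sub>C P u) + b *\<^sub>C (A v + of_real l *\<^sub>C P v)"
      by (simp add: w_def A_scaleC P_scaleC scaleC_add_right mult.commute
          linear_add[OF bounded_linear.linear[OF A_bounded]]
          linear_add[OF bounded_linear.linear[OF bounded_linear_mult_op[OF f_bounded]]])
    then have w: "eigen l E w"
      by (simp add: u v w_def scaleC_add_right mult.commute)
    have "E \<in> ?E1 \<union> ?E2"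
    proof (cases "\<exists>x\<in>S. coord w x \<noteq> 0")
      case True
      then show ?thesis using w \<phi>_w unfolding \<phi>_def by blast
    next
      case False
      then have "P w = 0" by (intro ell2_eqI) (auto simp: coord_P f_zero)
      then have "A w = of_real E *\<^sub>C w" using w by simp
      then show ?thesis using n \<open>n \<in> V\<close> by blast
    qed
    moreover have "coord u x \<noteq> 0 \<or> coord v x \<noteq> 0" using minor by auto
    ultimately show "l \<in> {l. \<exists>E\<in>?E1 \<union> ?E2. \<exists>u. eigen l E u \<and>
      (\<exists>x\<in>S. coord u x \<noteq> 0)}"
      using u v x by blast
  qed
qed

end

section \<open>Lattice operators and modes at large imaginary energy\<close>

definition step :: "nat \<times> int \<Rightarrow> (nat \<Rightarrow> int) \<Rightarrow> (nat \<Rightarrow> int)" where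
  "step p n = n(fst p := n (fst p) + snd p)"

definition dirs :: "nat \<Rightarrow> (nat \<times> int) set" where
  "dirs d = {..<d} \<times> {1, - 1}"

lemma finite_dirs [simp]: "finite (dirs d)"
  by (simp add: dirs_def)

lemma card_dirs: "card (dirs d) = 2 * d"
  by (simp add: dirs_def card_cartesian_product)

definition flip :: "nat \<times> int \<Rightarrow> nat \<times> int" where
  "flip p = (fst p, - snd p)"

lemma step_flip [simp]: "step (flip p) (step p n) = n" "step p (step (flip p) n) = n"
  by (simp_all add: step_def flip_def)

lemma bij_step: "bij (step p)"
  by (rule o_bij[of "step (flip p)"]) (auto simp: fun_eq_iff)

lemma bij_betw_flip: "bij_betw flip (dirs d) (dirs d)"
  by (rule bij_betwI[of _ _ _ flip]) (auto simp: dirs_def flip_def)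

definition shift_op :: "nat \<times> int \<Rightarrow> (nat \<Rightarrow> int) ell2 \<Rightarrow> (nat \<Rightarrow> int) ell2" where
  "shift_op p u = ell2_of (\<lambda>n. coord u (step p n))"

lemma coord_shift_op [simp]: "coord (shift_op p u) n = coord u (step p n)"
proof -
  have "(\<lambda>n. (cmod (coord u (step p n)))\<^sup>2) summable_on UNIV"
    using summable_on_reindex_bij_betw[OF bij_step, of "\<lambda>n. (cmod (coord u n))\<^sup>2"]
    by (simp add: coord_square_summable)
  then show ?thesis by (simp add: shift_op_def coord_ell2_of)
qed

lemma norm_shift_op: "norm (shift_op p u) = norm u"
proof -
  have "(norm (shift_op p u))\<^sup>2 = (norm u)\<^sup>2"
    unfolding norm_ell2_square
    using infsum_reindex_bij_betw[OF bij_step, of "\<lambda>n. (cmod (coord u n))\<^sup>2"] by simp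
  then show ?thesis by simp
qed

lemma bounded_linear_shift_op: "bounded_linear (shift_op p)"
  by (rule bounded_linear_intro[of _ 1]) (auto intro: ell2_eqI simp: norm_shift_op)

lemma cinner_shift_op: "cinner (shift_op p u) v = cinner u (shift_op (flip p) v)"
  unfolding cinner_def
  using infsum_reindex_bij_betw[OF bij_step, of "\<lambda>n. cnj (coord u (step p n)) * coord v n" "flip p"]
  by simp

definition hop :: "nat \<Rightarrow> (nat \<Rightarrow> int) ell2 \<Rightarrow> (nat \<Rightarrow> int) ell2" where
  "hop d u = (\<Sum>p\<in>dirs d. shift_op p u)"

lemma coord_hop: "coord (hop d u) n = (\<Sum>p\<in>dirs d. coord u (step p n))"
  by (simp add: hop_def coord_sum)

lemma cinner_zero [simp]: "cinner 0 v = 0" "cinner u 0 = 0"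
  by (simp_all add: cinner_def)

lemma cinner_sum_left: "cinner (\<Sum>x\<in>X. g x) v = (\<Sum>x\<in>X. cinner (g x) v)"
  by (induction X rule: infinite_finite_induct) (auto simp: cinner_add_left)

lemma cinner_sum_right: "cinner u (\<Sum>x\<in>X. g x) = (\<Sum>x\<in>X. cinner u (g x))"
  by (induction X rule: infinite_finite_induct) (auto simp: cinner_add_right)

lemma cinner_hop: "cinner (hop d u) v = cinner u (hop d v)"
  unfolding hop_def cinner_sum_left cinner_sum_right cinner_shift_op
  by (rule sum.reindex_bij_betw[OF bij_betw_flip])

lemma lattice_cell_perturbation:
  assumes V: "\<And>n. \<bar>V n\<bar> \<le> K"
    and S: "finite S" "\<And>x. x \<in> S \<Longrightarrow> 0 < f x" "\<And>x. x \<notin> S \<Longrightarrow> f x = 0"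
  shows "cell_perturbation (\<lambda>u. hop d u + mult_op V u) S f"
proof (rule cell_perturbation.intro)
  have "bounded_linear (hop d)"
    unfolding hop_def[abs_def] by (intro bounded_linear_sum bounded_linear_shift_op)
  then show "bounded_linear (\<lambda>u. hop d u + mult_op V u)"
    by (intro bounded_linear_add bounded_linear_mult_op[OF V])
  show "hop d (c *\<^sub>C u) + mult_op V (c *\<^sub>C u) = c *\<^sub>C (hop d u + mult_op V u)" for c u
    by (rule ell2_eqI) (simp add: coord_hop coord_mult_op[OF V] sum_distrib_left algebra_simps)
  show "cinner (hop d u + mult_op V u) v = cinner u (hop d v + mult_op V v)" for u v
    by (simp add: cinner_add_left cinner_add_right cinner_hop cinner_mult_op[OF V])
  show "hop d (cnj_ell2 u) + mult_op V (cnj_ell2 u) = cnj_ell2 (hop d u + mult_op V u)" for u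
    by (rule ell2_eqI) (simp add: coord_hop coord_mult_op[OF V])
qed (use S in auto)

text \<open>Normalised eigenfunctions at the energy i s for the complex coupling c. The decay off the cell is
  part of the definition only for convenience: it holds automatically for s > 2 d.\<close>

definition cell_mode ::
  "nat \<Rightarrow> ((nat \<Rightarrow> int) \<Rightarrow> real) \<Rightarrow> (nat \<Rightarrow> int) set \<Rightarrow> ((nat \<Rightarrow> int) \<Rightarrow> real) \<Rightarrow>
    real \<Rightarrow> complex \<Rightarrow> ((nat \<Rightarrow> int) \<Rightarrow> complex) \<Rightarrow> bool" where
  "cell_mode d V S f s c u \<longleftrightarrow>
    (\<forall>n. (\<Sum>p\<in>dirs d. u (step p n)) + V n * u n + c * f n * u n = \<i> * s * u n) \<and>
    (\<forall>n. cmod (u n) \<le> 1) \<and> (\<forall>n. n \<notin> S \<longrightarrow> cmod (u n) \<le> 2 * real d / s) \<and>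
    (\<exists>x\<in>S. cmod (u x) = 1)"

text \<open>A maximum principle: off S the diagonal term i s - V has modulus at least s > 2 d since
  V is real, so |u| there is at most 2 d / s times its supremum, and the supremum cannot exceed the
  bound m on S.\<close>

lemma outside_bound:
  fixes u :: "(nat \<Rightarrow> int) \<Rightarrow> complex" and s :: real
  assumes s: "s > 2 * d" and m: "0 \<le> m" "\<And>x. x \<in> S \<Longrightarrow> cmod (u x) \<le> m"
    and K: "\<And>n. cmod (u n) \<le> K"
    and eq: "\<And>n. n \<notin> S \<Longrightarrow> (\<Sum>p\<in>dirs d. u (step p n)) + complex_of_real (V n) * u n = \<i> * s * u n"
  shows "cmod (u n) \<le> m" "n \<notin> S \<Longrightarrow> cmod (u n) \<le> 2 * real d * m / s"
proof -
  have s0: "s > 0" using s by simp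
  define \<sigma> where "\<sigma> = (SUP n. cmod (u n))"
  have le_\<sigma>: "cmod (u n) \<le> \<sigma>" for n
    unfolding \<sigma>_def by (rule cSUP_upper) (use K in \<open>auto intro: bdd_aboveI[of _ K]\<close>)
  have \<sigma>0: "0 \<le> \<sigma>" using le_\<sigma>[of n] norm_ge_zero order_trans by blast
  have out: "cmod (u n) \<le> 2 * real d * \<sigma> / s" if "n \<notin> S" for n
  proof -
    have "s * cmod (u n) \<le> cmod (\<i> * s - V n) * cmod (u n)"
      using abs_Im_le_cmod[of "\<i> * s - V n"] s0 by (intro mult_right_mono) auto
    also have "\<dots> = cmod ((\<i> * s - V n) * u n)" by (simp only: norm_mult)
    also have "\<dots> = cmod (\<Sum>p\<in>dirs d. u (step p n))"
      unfolding left_diff_distrib eq[OF that, symmetric] by simp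
    also have "\<dots> \<le> (\<Sum>p\<in>dirs d. \<sigma>)" by (intro sum_norm_le le_\<sigma>)
    also have "\<dots> = 2 * real d * \<sigma>" by (simp add: card_dirs)
    finally show ?thesis using s0 by (simp add: field_simps)
  qed
  have "\<sigma> \<le> m"
  proof (rule ccontr)
    assume "\<not> \<sigma> \<le> m"
    then have gt: "\<sigma> > m" "\<sigma> > 0" using m(1) by auto
    have "\<sigma> \<le> max m (2 * real d * \<sigma> / s)"
      unfolding \<sigma>_def[symmetric]
      by (subst \<sigma>_def, rule cSUP_least) (use m(2) out in \<open>auto simp: le_max_iff_disj\<close>)
    then have "\<sigma> * s \<le> 2 * real d * \<sigma>" using gt s0 by (simp add: le_max_iff_disj field_simps)
    then have "s \<le> 2 * d" using gt(2) by simp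
    then show False using s by simp
  qed
  then show "cmod (u n) \<le> m" using le_\<sigma>[of n] by simp
  show "cmod (u n) \<le> 2 * real d * m / s" if "n \<notin> S"
    using out[OF that] \<open>\<sigma> \<le> m\<close> s0
    by (elim order_trans) (simp add: divide_right_mono mult_left_mono)
qed

text \<open>The threshold on s is uniform in c, because the coupling that a failure of spanning
  produces is not known beforehand.\<close>

definition no_orthogonal_mode ::
  "nat \<Rightarrow> ((nat \<Rightarrow> int) \<Rightarrow> real) \<Rightarrow> (nat \<Rightarrow> int) set \<Rightarrow> ((nat \<Rightarrow> int) \<Rightarrow> real) \<Rightarrow>
    ((nat \<Rightarrow> int) \<Rightarrow> real) \<Rightarrow> bool" where
  "no_orthogonal_mode d V S f e \<longleftrightarrow> (\<forall>\<^sub>F s in at_top. \<forall>c u. cell_mode d V S f s c u \<longrightarrow>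
    (\<Sum>x\<in>S. complex_of_real (e x) * f x * u x) \<noteq> 0)"

text \<open>A solution that is nonzero on the cell becomes a mode after division by its maximum over
  the cell; one that vanishes there is an eigenvector of the dissipative operator in the upper
  half-plane, hence 0.\<close>

lemma no_mode_imp_zero:
  fixes s :: real
  assumes V: "\<And>n. \<bar>V n\<bar> \<le> K" "\<And>x. x \<in> S \<Longrightarrow> V x = 0"
    and S: "finite S" "\<And>x. x \<in> S \<Longrightarrow> 0 < f x" "\<And>x. x \<notin> S \<Longrightarrow> f x = 0"
    and s: "s > 2 * d"
    and u: "hop d u + mult_op V u + c *\<^sub>C mult_op f u = (\<i> * complex_of_real s) *\<^sub>C u"
    and orth: "(\<Sum>x\<in>S. complex_of_real (e x) * f x * coord u x) = 0"
    and no_mode: "\<And>v. cell_mode d V S f s c v \<Longrightarrow> (\<Sum>x\<in>S. complex_of_real (e x) * f x * v x) \<noteq> 0"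
  shows "u = 0"
proof -
  interpret cell_perturbation "\<lambda>u. hop d u + mult_op V u" S f
    by (rule lattice_cell_perturbation[OF V(1) S])
  have s0: "s > 0" using s by simp
  have eq: "(\<Sum>p\<in>dirs d. coord u (step p n)) + V n * coord u n + c * f n * coord u n = \<i> * s * coord u n" for n
    using arg_cong[OF u, of "\<lambda>u. coord u n"]
    by (simp add: coord_hop coord_mult_op[OF V(1)] coord_P mult.assoc)
  show ?thesis
  proof (cases "\<exists>x\<in>S. coord u x \<noteq> 0")
    case False
    then have "P u = 0" by (intro ell2_eqI) (auto simp: coord_P f_zero)
    then have "T u = (\<i> * s) *\<^sub>C u" using u by (simp add: T_def)
    then show ?thesis by (rule resolvent_unique) (use s0 in simp)
  next
    case True
    define m where "m = Max ((\<lambda>x. cmod (coord u x)) ` S)"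
    have "S \<noteq> {}" using True by auto
    then have "m \<in> (\<lambda>x. cmod (coord u x)) ` S" unfolding m_def using S(1) by (intro Max_in) auto
    then obtain x where x: "x \<in> S" "cmod (coord u x) = m" by auto
    have le_m: "cmod (coord u y) \<le> m" if "y \<in> S" for y
      unfolding m_def using S(1) that by (intro Max_ge) auto
    have m0: "m > 0" using True le_m by (metis norm_le_zero_iff not_le order_trans)
    have eq_out: "(\<Sum>p\<in>dirs d. coord u (step p n)) + V n * coord u n = \<i> * s * coord u n" if "n \<notin> S" for n
      using eq[of n] S(3)[OF that] by simp
    have le: "cmod (coord u n) \<le> m" for n
      by (rule outside_bound(1)[OF s less_imp_le[OF m0] le_m coord_le_norm eq_out])
    have out: "cmod (coord u n) \<le> 2 * real d * m / s" if "n \<notin> S" for n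
      by (rule outside_bound(2)[OF s less_imp_le[OF m0] _ coord_le_norm _ that], erule le_m, erule eq_out)
    define v where "v n = coord u n / m" for n
    have "cell_mode d V S f s c v"
      unfolding cell_mode_def
    proof (intro conjI allI impI)
      show "(\<Sum>p\<in>dirs d. v (step p n)) + V n * v n + c * f n * v n = \<i> * s * v n" for n
        using arg_cong[OF eq[of n], of "\<lambda>t. t / m"]
        by (simp add: v_def add_divide_distrib sum_divide_distrib)
      show "cmod (v n) \<le> 1" for n
        using le[of n] m0 by (simp add: v_def norm_divide divide_le_eq)
      show "cmod (v n) \<le> 2 * real d / s" if "n \<notin> S" for n
        using divide_right_mono[OF out[OF that], of m] m0 by (simp add: v_def norm_divide)
      show "\<exists>x\<in>S. cmod (v x) = 1"
        using x m0 by (intro bexI[of _ x]) (auto simp: v_def norm_divide)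
    qed
    moreover have "(\<Sum>x\<in>S. complex_of_real (e x) * f x * v x) = 0"
      using arg_cong[OF orth, of "\<lambda>t. t / m"] by (simp add: v_def sum_divide_distrib)
    ultimately show ?thesis using no_mode by blast
  qed
qed

section \<open>Modes of cells with injective weights and of segments\<close>

lemma cell_mode_sum_le:
  assumes "cell_mode d V S f s c u" "X \<subseteq> dirs d"
  shows "cmod (\<Sum>p\<in>X. u (step p n)) \<le> 2 * d"
proof -
  have "cmod (\<Sum>p\<in>X. u (step p n)) \<le> (\<Sum>p\<in>X. 1)"
    using assms(1) by (intro sum_norm_le) (simp add: cell_mode_def)
  also have "\<dots> \<le> 2 * d"
    using card_mono[OF finite_dirs assms(2)] by (simp add: card_dirs)
  finally show ?thesis .
qed

lemma cell_mode_in_cell: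
  assumes "cell_mode d V S f s c u" "V x = 0"
  shows "(\<Sum>p\<in>dirs d. u (step p x)) = (\<i> * s - c * f x) * u x"
proof -
  have "(\<Sum>p\<in>dirs d. u (step p x)) + V x * u x + c * f x * u x = \<i> * s * u x"
    using assms(1) by (simp add: cell_mode_def)
  then show ?thesis using assms(2) by (simp add: algebra_simps)
qed

text \<open>At a site x with |u x| = 1 the coupling satisfies |i s - c f x| \<le> 2 d. As f y
  differs from f x, the coefficient i s - c f y then has modulus of order s, so u y = O(1 / s): the
  mode concentrates at x, and its sum weighted by f cannot vanish.\<close>

lemma no_mode_injective:
  assumes S: "finite S" "\<And>x. x \<in> S \<Longrightarrow> 0 < f x" and inj: "inj_on f S"
    and V: "\<And>x. x \<in> S \<Longrightarrow> V x = 0"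
  shows "no_orthogonal_mode d V S f (\<lambda>_. 1)"
  unfolding no_orthogonal_mode_def
proof -
  \<comment> \<open>Lower bound for |i s - c f y|, from i s - c f y = i s (1 - f y / f x) + (f y / f
    x)(i s - c f x).\<close>
  let ?g = "\<lambda>x y s. s * \<bar>1 - f y / f x\<bar> - 2 * d * (f y / f x)"
  have pos: "\<bar>1 - f y / f x\<bar> > 0" if "x \<in> S" "y \<in> S - {x}" for x y
    using that inj S(2)[of x] by (auto simp: inj_on_def)
  have top: "LIM s at_top. ?g x y s :> at_top" if "x \<in> S" "y \<in> S - {x}" for x y
  proof -
    have "LIM s at_top. s * a - b :> at_top" if "a > 0" for a b :: real
      using that by real_asymp
    from this[OF pos[OF that]] show ?thesis .
  qed
  have ev1: "\<forall>\<^sub>F s in at_top. \<forall>x\<in>S. \<forall>y\<in>S - {x}. ?g x y s > 0"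
    using S(1)
    by (intro eventually_ball_finite ballI filterlim_at_top_dense[THEN iffD1, rule_format, OF top]) auto
  have ev2: "\<forall>\<^sub>F s in at_top. \<forall>x\<in>S. (\<Sum>y\<in>S - {x}. f y * (2 * d / ?g x y s)) < f x"
  proof (intro eventually_ball_finite ballI S)
    fix x assume x: "x \<in> S"
    have "((\<lambda>s. \<Sum>y\<in>S - {x}. f y * (2 * d / ?g x y s)) \<longlongrightarrow> 0) at_top"
      by (intro tendsto_null_sum tendsto_mult_right_zero
          tendsto_divide_0[OF tendsto_const filterlim_at_top_imp_at_infinity[OF top[OF x]]])
    then show "\<forall>\<^sub>F s in at_top. (\<Sum>y\<in>S - {x}. f y * (2 * d / ?g x y s)) < f x"
      using S(2)[OF x] by (rule order_tendstoD)
  qed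
  from ev1 ev2 eventually_gt_at_top[of 0]
  show "\<forall>\<^sub>F s in at_top. \<forall>c u. cell_mode d V S f s c u \<longrightarrow>
    (\<Sum>x\<in>S. complex_of_real 1 * f x * u x) \<noteq> 0"
  proof eventually_elim
    case (elim s)
    show ?case
    proof (intro allI impI notI)
      fix c u assume u: "cell_mode d V S f s c u" and orth: "(\<Sum>x\<in>S. complex_of_real 1 * f x * u x) = 0"
      obtain x where x: "x \<in> S" "cmod (u x) = 1" using u by (auto simp: cell_mode_def)
      have bnd: "cmod ((\<i> * s - c * f y) * u y) \<le> 2 * d" if "y \<in> S" for y
        using cell_mode_sum_le[OF u order_refl, of y] cell_mode_in_cell[OF u V[OF that]] by simp
      have x_bnd: "cmod (\<i> * s - c * f x) \<le> 2 * d"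
        using bnd[OF x(1)] x(2) by (simp add: norm_mult)
      have "cmod (u y) \<le> 2 * d / ?g x y s" if y: "y \<in> S - {x}" for y
      proof -
        define r where "r = f y / f x"
        have r: "r > 0" using S(2) x y by (simp add: r_def)
        have "\<i> * s - c * f y = \<i> * s * (1 - r) + r * (\<i> * s - c * f x)"
          using S(2)[OF x(1)] by (simp add: r_def field_simps)
        then have "cmod (\<i> * s * (1 - r)) - cmod (r * (\<i> * s - c * f x)) \<le> cmod (\<i> * s - c * f y)"
          using norm_diff_ineq[of "\<i> * s * (1 - r)" "r * (\<i> * s - c * f x)"] by simp
        moreover have "cmod (\<i> * s * (1 - r)) = s * \<bar>1 - r\<bar>"
          using elim(3) norm_of_real[of "1 - r", where 'a=complex] by (simp add: norm_mult)
        moreover have "cmod (r * (\<i> * s - c * f x)) \<le> r * (2 * d)"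
          unfolding norm_mult using r x_bnd by (simp add: mult_left_mono)
        ultimately have "?g x y s \<le> cmod (\<i> * s - c * f y)" by (simp add: r_def mult.commute)
        then have "?g x y s * cmod (u y) \<le> 2 * d"
          using bnd[of y] y mult_right_mono[of "?g x y s" _ "cmod (u y)"] unfolding norm_mult by fastforce
        moreover have "?g x y s > 0" using elim(1) x y by blast
        ultimately show ?thesis by (subst pos_le_divide_eq) (auto simp: mult.commute)
      qed
      then have "(\<Sum>y\<in>S - {x}. f y * cmod (u y)) \<le> (\<Sum>y\<in>S - {x}. f y * (2 * d / ?g x y s))"
        using S(2) by (intro sum_mono mult_left_mono) (auto intro: less_imp_le)
      also have "\<dots> < f x" using elim(2) x by blast
      also have "f x = cmod (f x * u x)" using x S(2)[OF x(1)] by (simp add: norm_mult)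
      also have "\<dots> = cmod (\<Sum>y\<in>S - {x}. f y * u y)"
      proof -
        have "f x * u x = - (\<Sum>y\<in>S - {x}. f y * u y)"
          using orth sum.remove[OF S(1) x(1), of "\<lambda>x. f x * u x"] by (simp add: eq_neg_iff_add_eq_0)
        then show ?thesis by (simp only: norm_minus_cancel)
      qed
      also have "\<dots> \<le> (\<Sum>y\<in>S - {x}. f y * cmod (u y))"
        using S(2) by (intro sum_norm_le) (simp add: norm_mult less_imp_le)
      finally show False by simp
    qed
  qed
qed

text \<open>Inside the segment the forward neighbour equals k times the current value minus the
  other neighbours. For a mode that vanishes at the end point b these are all O(1 / s) inductively,
  so the mode is O(1 / s) on the whole segment, against its maximum 1.\<close>

lemma no_mode_path:
  fixes b :: "nat \<Rightarrow> int"
  defines "x \<equiv> \<lambda>j. b(0 := b 0 + int j)"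
  assumes d: "d \<ge> 1" and S: "S = x ` {..<l}" and f: "\<And>y. y \<in> S \<Longrightarrow> f y = 1"
    and V: "\<And>y. y \<in> S \<Longrightarrow> V y = 0"
  shows "no_orthogonal_mode d V S f (\<lambda>y. if y = b then 1 else 0)"
proof -
  \<comment> \<open>One step of the recursion costs 2 d for the factor k and 2 d for the remaining
    neighbours.\<close>
  define B where "B = 4 * real d"
  have B: "B \<ge> 1" "2 * real d \<le> B" using d by (auto simp: B_def)
  from eventually_gt_at_top[of 0] eventually_gt_at_top[of "B ^ l"] show ?thesis
    unfolding no_orthogonal_mode_def
  proof eventually_elim
    case (elim s)
    show ?case
    proof (intro allI impI notI)
      fix c u assume u: "cell_mode d V S f s c u"
        and "(\<Sum>y\<in>S. complex_of_real (if y = b then 1 else 0) * f y * u y) = 0"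
      moreover have "(\<Sum>y\<in>S. complex_of_real (if y = b then 1 else 0) * f y * u y) =
          (\<Sum>y\<in>S. if y = b then u y else 0)"
        by (intro sum.cong) (auto simp: f)
      ultimately have ub: "b \<in> S \<Longrightarrow> u b = 0" by (simp add: S)
      obtain j0 where j0: "j0 < l" "cmod (u (x j0)) = 1" using u by (auto simp: cell_mode_def S)
      define k where "k = \<i> * s - c"
      have eq: "(\<Sum>p\<in>dirs d. u (step p (x j))) = k * u (x j)" if "j < l" for j
      proof -
        have "x j \<in> S" using that by (simp add: S)
        then show ?thesis using cell_mode_in_cell[OF u V[of "x j"]] f[of "x j"] by (simp add: k_def)
      qed
      have k: "cmod k \<le> 2 * real d"
        using cell_mode_sum_le[OF u order_refl, of "x j0"] eq[OF j0(1)] j0(2) by (simp add: norm_mult)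
      have claim: "j < l \<Longrightarrow> cmod (u (x j)) \<le> B ^ Suc j / s" for j
      proof (induction j rule: less_induct)
        case (less j)
        show ?case
        proof (cases j)
          case 0
          have "x 0 = b" by (simp add: x_def)
          moreover have "x 0 \<in> S" using less.prems 0 by (auto simp: S)
          ultimately have "u (x 0) = 0" using ub by simp
          then show ?thesis using 0 B elim by simp
        next
          case (Suc i)
          have i: "i < l" using less.prems Suc by simp
          \<comment> \<open>A neighbour inside the segment other than the forward one is the
            preceding site, covered by the induction; all others lie off the cell.\<close>
          have other: "cmod (u (step p (x i))) \<le> B ^ Suc i / s" if p: "p \<in> dirs d - {(0, 1)}" for p
          proof (cases "step p (x i) \<in> S")
            case True
            then obtain i' where i': "i' < l" "step p (x i) = x i'" by (auto simp: S)
            have "snd p \<noteq> 0" using p by (auto simp: dirs_def)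
            then have "fst p = 0"
              using fun_cong[OF i'(2), of "fst p"] by (auto simp: step_def x_def split: if_splits)
            then have "snd p = - 1" using p by (cases p) (auto simp: dirs_def)
            then have "int i = int i' + 1"
              using fun_cong[OF i'(2), of 0] \<open>fst p = 0\<close> by (simp add: step_def x_def)
            then have "i' < j" "Suc i' \<le> Suc i" using Suc by auto
            have "cmod (u (x i')) \<le> B ^ Suc i' / s"
              using less.IH[OF \<open>i' < j\<close> i'(1)] .
            also have "\<dots> \<le> B ^ Suc i / s"
              using elim B \<open>Suc i' \<le> Suc i\<close> by (intro divide_right_mono power_increasing) auto
            finally show ?thesis using i'(2) by simp
          next
            case False
            then have "cmod (u (step p (x i))) \<le> 2 * real d / s" using u by (simp add: cell_mode_def)
            also have "\<dots> \<le> B / s" using elim B by (intro divide_right_mono) auto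
            also have "\<dots> \<le> B ^ Suc i / s"
              using elim B self_le_power[of B "Suc i"] by (intro divide_right_mono) auto
            finally show ?thesis .
          qed
          have "(0, 1) \<in> dirs d" using d by (simp add: dirs_def)
          from sum.remove[OF finite_dirs this, of "\<lambda>p. u (step p (x i))"]
          have "u (step (0, 1) (x i)) = k * u (x i) - (\<Sum>p\<in>dirs d - {(0, 1)}. u (step p (x i)))"
            using eq[OF i] by simp
          moreover have "step (0, 1) (x i) = x j" by (simp add: step_def x_def Suc fun_eq_iff)
          ultimately have "cmod (u (x j)) \<le> cmod (k * u (x i)) + cmod (\<Sum>p\<in>dirs d - {(0, 1)}. u (step p (x i)))"
            by (simp add: norm_triangle_ineq4)
          also have "cmod (k * u (x i)) \<le> 2 * real d * (B ^ Suc i / s)"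
            unfolding norm_mult using less.IH[OF _ i] Suc k by (intro mult_mono) auto
          also have "cmod (\<Sum>p\<in>dirs d - {(0, 1)}. u (step p (x i))) \<le> (\<Sum>p\<in>dirs d - {(0, 1)}. B ^ Suc i / s)"
            by (rule sum_norm_le[OF other])
          also have "\<dots> \<le> (\<Sum>p\<in>dirs d. B ^ Suc i / s)"
            using B elim by (intro sum_mono2) auto
          also have "\<dots> = 2 * real d * (B ^ Suc i / s)" by (simp add: card_dirs)
          also have "2 * real d * (B ^ Suc i / s) + 2 * real d * (B ^ Suc i / s) = B ^ Suc j / s"
            by (simp add: Suc B_def)
          finally show ?thesis by simp
        qed
      qed
      have "1 \<le> B ^ Suc j0 / s" using claim[OF j0(1)] j0(2) by simp
      also have "\<dots> \<le> B ^ l / s"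
        using elim B j0(1) by (intro divide_right_mono power_increasing) auto
      also have "\<dots> < 1" using elim by simp
      finally show False by simp
    qed
  qed
qed

section \<open>Expansion in the inverse energy for the square cell\<close>

definition small :: "(nat \<Rightarrow> real) \<Rightarrow> nat \<Rightarrow> (nat \<Rightarrow> complex) \<Rightarrow> bool" where
  "small eps j F \<longleftrightarrow> (\<exists>M. \<forall>n. cmod (F n) \<le> M * eps n ^ j)"

lemma small_add:
  assumes "small eps j F" "small eps j G"
  shows "small eps j (\<lambda>n. F n + G n)"
proof -
  obtain M N where "\<And>n. cmod (F n) \<le> M * eps n ^ j" "\<And>n. cmod (G n) \<le> N * eps n ^ j"
    using assms unfolding small_def by blast
  then have "cmod (F n + G n) \<le> (M + N) * eps n ^ j" for n
    unfolding distrib_right by (intro norm_triangle_le add_mono)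
  then show ?thesis unfolding small_def by blast
qed

lemma small_uminus: "small eps j F \<Longrightarrow> small eps j (\<lambda>n. - F n)"
  by (simp add: small_def)

lemma small_diff: "small eps j F \<Longrightarrow> small eps j G \<Longrightarrow> small eps j (\<lambda>n. F n - G n)"
  using small_add[OF _ small_uminus[of eps j G]] by simp

lemma small_mult:
  assumes "small eps i F" "small eps j G"
  shows "small eps (i + j) (\<lambda>n. F n * G n)"
proof -
  obtain M N where MN: "\<And>n. cmod (F n) \<le> M * eps n ^ i" "\<And>n. cmod (G n) \<le> N * eps n ^ j"
    using assms unfolding small_def by blast
  have "cmod (F n * G n) \<le> (M * N) * eps n ^ (i + j)" for n
  proof -
    have "cmod (F n * G n) \<le> (M * eps n ^ i) * (N * eps n ^ j)"
      unfolding norm_mult using MN by (intro mult_mono) (auto intro: order_trans[OF norm_ge_zero])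
    then show ?thesis by (simp add: power_add mult_ac)
  qed
  then show ?thesis unfolding small_def by blast
qed

lemma small_bounded: "(\<And>n. cmod (F n) \<le> M) \<Longrightarrow> small eps 0 F"
  by (auto simp: small_def)

lemma small_cmult: "small eps j F \<Longrightarrow> small eps j (\<lambda>n. c * F n)"
  using small_mult[OF small_bounded[of "\<lambda>_. c" "cmod c"], of eps j F] by simp

lemma small_weaken:
  assumes "small eps j F" "i \<le> j" "\<And>n. 0 \<le> eps n" "\<And>n. eps n \<le> 1"
  shows "small eps i F"
proof -
  obtain M where M: "\<And>n. cmod (F n) \<le> M * eps n ^ j"
    using assms(1) unfolding small_def by blast
  have "cmod (F n) \<le> \<bar>M\<bar> * eps n ^ i" for n
  proof -
    have "M * eps n ^ j \<le> \<bar>M\<bar> * eps n ^ i"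
      using assms by (intro mult_mono power_decreasing) auto
    then show ?thesis using M[of n] by simp
  qed
  then show ?thesis unfolding small_def by blast
qed

text \<open>In the application \<open>eps\<close> is 1 / s and \<open>w\<close> is 1 / (i s): each
  visit to a site off the cell costs one factor \<open>w\<close>.\<close>

locale small_seq =
  fixes eps :: "nat \<Rightarrow> real" and w :: "nat \<Rightarrow> complex"
  assumes eps: "\<And>n. 0 < eps n" "\<And>n. eps n \<le> 1" and w: "\<And>n. cmod (w n) = eps n"
begin

lemma weaken: "small eps j F \<Longrightarrow> i \<le> j \<Longrightarrow> small eps i F"
  using small_weaken[of eps j F i] eps by (simp add: less_imp_le)

lemma small_zero [simp]: "small eps j (\<lambda>_. 0)"
  by (auto simp: small_def intro: exI[of _ 0])

lemma small_w_mult: "small eps j F \<Longrightarrow> small eps (Suc j) (\<lambda>n. w n * F n)"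
  using small_mult[of eps 1 w j F] by (simp add: small_def w exI[of _ 1])

lemma small_eq: "small eps j G \<Longrightarrow> (\<And>n. F n = G n) \<Longrightarrow> small eps j F"
  by (simp add: small_def)

text \<open>Two adjacent sites outside the cell, with values X and Y, whose neighbours in the cell
  have values x and y.\<close>

lemma neighbour_expansion:
  assumes X: "\<And>n. X n = w n * (x n + \<omega> * X n + Y n + X1 n + X2 n)"
    and Y: "\<And>n. Y n = w n * (y n + \<omega> * Y n + X n + Y1 n + Y2 n)"
    and s: "small eps 2 X" "small eps 1 Y" "small eps 2 Y1" "small eps 2 Y2"
  shows "small eps 2 (\<lambda>n. Y n - w n * y n)"
    and "small eps 3 X1 \<Longrightarrow> small eps 3 X2 \<Longrightarrow> small eps 2 x \<Longrightarrow>
      small eps 4 (\<lambda>n. X n - w n * x n - w n ^ 2 * y n - 2 * \<omega> * w n ^ 3 * y n)"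
proof -
  have "small eps (Suc 1) (\<lambda>n. w n * (\<omega> * Y n + X n + Y1 n + Y2 n))"
    by (intro small_w_mult small_add small_cmult s weaken[OF s(1)] weaken[OF s(3)] weaken[OF s(4)]) auto
  then have "small eps 2 (\<lambda>n. w n * (\<omega> * Y n + X n + Y1 n + Y2 n))" by (simp add: numeral_2_eq_2)
  then show e1: "small eps 2 (\<lambda>n. Y n - w n * y n)"
    apply (rule small_eq)
    subgoal for n using Y[of n] by algebra
    done
  assume s': "small eps 3 X1" "small eps 3 X2" "small eps 2 x"
  have "small eps (Suc 2) (\<lambda>n. w n * (\<omega> * (Y n - w n * y n) + X n + Y1 n + Y2 n))"
    by (intro small_w_mult small_add small_cmult s e1)
  then have "small eps 3 (\<lambda>n. w n * (\<omega> * (Y n - w n * y n) + X n + Y1 n + Y2 n))"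
    by (simp add: numeral_3_eq_3 numeral_2_eq_2)
  then have e2: "small eps 3 (\<lambda>n. Y n - w n * y n - w n ^ 2 * \<omega> * y n)"
    apply (rule small_eq)
    subgoal for n using Y[of n] by algebra
    done
  have "small eps (Suc 2) (\<lambda>n. w n * (x n + \<omega> * X n + (Y n - w n * y n) + X1 n + X2 n))"
    by (intro small_w_mult small_add small_cmult s e1 weaken[OF s'(1)] weaken[OF s'(2)] s'(3)) auto
  then have "small eps 3 (\<lambda>n. w n * (x n + \<omega> * X n + (Y n - w n * y n) + X1 n + X2 n))"
    by (simp add: numeral_3_eq_3 numeral_2_eq_2)
  then have e3: "small eps 3 (\<lambda>n. X n - w n ^ 2 * y n)"
    apply (rule small_eq)
    subgoal for n using X[of n] by algebra
    done
  \<comment> \<open>The term 2 \<omega> w^3 y has two equal sources: the potential at X acting on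
    w^2 y, and the second-order part of Y.\<close>
  have "small eps (Suc 3) (\<lambda>n. w n * (\<omega> * (X n - w n ^ 2 * y n)
      + (Y n - w n * y n - w n ^ 2 * \<omega> * y n) + X1 n + X2 n))"
    by (intro small_w_mult small_add small_cmult e2 e3 s')
  then have "small eps 4 (\<lambda>n. w n * (\<omega> * (X n - w n ^ 2 * y n)
      + (Y n - w n * y n - w n ^ 2 * \<omega> * y n) + X1 n + X2 n))" by (simp add: eval_nat_numeral)
  then show "small eps 4 (\<lambda>n. X n - w n * x n - w n ^ 2 * y n - 2 * \<omega> * w n ^ 3 * y n)"
    apply (rule small_eq)
    subgoal for n using X[of n] by algebra
    done
qed

end

text \<open>Let b, c, d be the values at (1,0), (0,1), (1,1), the value at (0,0) being 0. The four
  rows give b + c = O(eps^2), then d = O(eps^2) and m b = O(eps^2) with m = k - 2 w. In the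
  difference of the rows at (1,1) and (0,0) the second-order terms cancel and the third order
  contains the four couplings. Multiplying by b and using c = -b up to O(eps^2) yields (\<omega>l +
  \<omega>r - \<omega>b - \<omega>t) w^3 b^2 = O(eps^4). If the bracket is nonzero, then b, c and d
  tend to 0, against the normalisation.\<close>

lemma square_modes_force_balance:
  fixes U :: "nat \<Rightarrow> int \<Rightarrow> int \<Rightarrow> complex" and W :: "int \<Rightarrow> int \<Rightarrow> real" and s :: "nat \<Rightarrow> real"
    and k :: "nat \<Rightarrow> complex"
  defines "cell \<equiv> \<lambda>a b. (a = 0 \<or> a = 1) \<and> (b = 0 \<or> b = (1::int))"
  assumes s: "\<And>n. s n \<ge> real n + 1" and W: "\<And>a b. \<bar>W a b\<bar> \<le> K"
    and U: "\<And>n a b. cmod (U n a b) \<le> 1" "\<And>n a b. \<not> cell a b \<Longrightarrow> cmod (U n a b) \<le> 4 / s n"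
    and eq_in: "\<And>n a b. cell a b \<Longrightarrow>
      U n (a + 1) b + U n (a - 1) b + U n a (b + 1) + U n a (b - 1) = k n * U n a b"
    and eq_out: "\<And>n a b. \<not> cell a b \<Longrightarrow>
      U n (a + 1) b + U n (a - 1) b + U n a (b + 1) + U n a (b - 1) + W a b * U n a b = \<i> * s n * U n a b"
    and zero: "\<And>n. U n 0 0 = 0"
    and one: "\<And>n. cmod (U n 0 0) = 1 \<or> cmod (U n 1 0) = 1 \<or> cmod (U n 0 1) = 1 \<or> cmod (U n 1 1) = 1"
    and left: "W (- 1) 0 = \<omega>l" "W (- 1) 1 = \<omega>l" and right: "W 2 0 = \<omega>r" "W 2 1 = \<omega>r"
    and bottom: "W 0 (- 1) = \<omega>b" "W 1 (- 1) = \<omega>b" and top: "W 0 2 = \<omega>t" "W 1 2 = \<omega>t"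
  shows "\<omega>l + \<omega>r = \<omega>b + \<omega>t"
proof (rule ccontr)
  assume unbalanced: "\<omega>l + \<omega>r \<noteq> \<omega>b + \<omega>t"
  define eps where "eps n = 1 / s n" for n
  define w where "w n = 1 / (\<i> * s n)" for n
  have s_pos: "s n > 0" "s n \<ge> 1" for n using s[of n] by auto
  interpret small_seq eps w
    by standard (use s_pos in \<open>auto simp: eps_def w_def norm_divide norm_mult less_imp_le\<close>)
  note [simp] = cell_def
  have out: "small eps 1 (\<lambda>n. U n a b)" if "\<not> cell a b" for a b
    unfolding small_def using U(2)[OF that] by (intro exI[of _ 4]) (simp add: eps_def)
  have eq_w: "U n a b = w n * (U n (a + 1) b + U n (a - 1) b + U n a (b + 1) + U n a (b - 1) + W a b * U n a b)"
    if "\<not> cell a b" for n a b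
    unfolding eq_out[OF that] using s_pos(1)[of n] by (simp add: w_def)
  have out_step: "small eps (Suc j) (\<lambda>n. U n a b)"
    if "\<not> cell a b" "small eps j (\<lambda>n. U n a b)" "small eps j (\<lambda>n. U n (a + 1) b)" "small eps j (\<lambda>n. U n (a - 1) b)"
      "small eps j (\<lambda>n. U n a (b + 1))" "small eps j (\<lambda>n. U n a (b - 1))" for a b j
  proof -
    have "small eps (Suc j) (\<lambda>n. w n * (U n (a + 1) b + U n (a - 1) b + U n a (b + 1) + U n a (b - 1) + W a b * U n a b))"
      by (intro small_w_mult small_add small_cmult that)
    then show ?thesis by (rule small_eq) (rule eq_w[OF that(1)])
  qed
  have k: "small eps 0 k"
  proof (rule small_bounded)
    fix n
    obtain a b where ab: "cell a b" "cmod (U n a b) = 1" using one[of n] by auto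
    have "cmod (k n) = cmod (U n (a + 1) b + U n (a - 1) b + U n a (b + 1) + U n a (b - 1))"
      using eq_in[OF ab(1), of n] ab(2) by (simp add: norm_mult)
    also have "\<dots> \<le> 1 + 1 + 1 + 1"
      by (intro norm_triangle_le add_mono U(1))
    finally show "cmod (k n) \<le> 4" by simp
  qed
  have cell0: "small eps 0 (\<lambda>n. U n a b)" for a b by (rule small_bounded) (rule U(1))
  have far: "small eps 2 (\<lambda>n. U n a b)"
    if "\<not> cell a b" "\<not> cell (a + 1) b" "\<not> cell (a - 1) b" "\<not> cell a (b + 1)" "\<not> cell a (b - 1)" for a b
    unfolding numeral_2_eq_2 One_nat_def[symmetric] by (intro out_step out that)
  have zero': "small eps j (\<lambda>n. U n 0 0)" for j by (simp add: zero)
  have two: "small eps 2 F" if "small eps (Suc 1) F" for F using that by (simp add: numeral_2_eq_2)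
  have three: "small eps 3 F" if "small eps (Suc 2) F" for F using that by (simp add: eval_nat_numeral)
  \<comment> \<open>As U vanishes at (0,0), the two outer neighbours of this corner gain an
    order.\<close>
  have la: "small eps 2 (\<lambda>n. U n (- 1) 0)" and ba: "small eps 2 (\<lambda>n. U n 0 (- 1))"
    by (rule two, rule out_step; simp add: out zero' del: One_nat_def)+
  have la3: "small eps 3 (\<lambda>n. U n (- 2) 0)" "small eps 3 (\<lambda>n. U n (- 1) (- 1))"
    and ba3: "small eps 3 (\<lambda>n. U n 0 (- 2))"
    by (rule three, rule out_step; simp add: far la ba del: One_nat_def)+
  have A: "U n 1 0 + U n 0 1 + U n (- 1) 0 + U n 0 (- 1) = 0" for n
    using eq_in[of 0 0 n] by (simp add: zero algebra_simps)
  have Brow: "U n 1 1 + U n 2 0 + U n 1 (- 1) = k n * U n 1 0" for n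
    using eq_in[of 1 0 n] by (simp add: zero algebra_simps)
  have Crow: "U n 1 1 + U n (- 1) 1 + U n 0 2 = k n * U n 0 1" for n
    using eq_in[of 0 1 n] by (simp add: zero algebra_simps)
  have D: "U n 1 0 + U n 0 1 + U n 2 1 + U n 1 2 = k n * U n 1 1" for n
    using eq_in[of 1 1 n] by (simp add: algebra_simps)
  have bc: "small eps 2 (\<lambda>n. U n 1 0 + U n 0 1)"
    apply (rule small_eq[OF small_uminus[OF small_add[OF la ba]]])
    subgoal for n using A[of n] by algebra
    done
  have first_order: "small eps 2 (\<lambda>n. U n a b - w n * p n)"
    if "\<not> cell a b" "\<And>n. U n a b = w n * (p n + q n)" "small eps 1 q" for a b p q
  proof -
    have "small eps 2 (\<lambda>n. w n * q n)" by (rule two, rule small_w_mult, rule that)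
    then show ?thesis by (rule small_eq) (simp add: that(2) distrib_left)
  qed
  have nb: "small eps 2 (\<lambda>n. U n 2 0 - w n * U n 1 0)" "small eps 2 (\<lambda>n. U n 1 (- 1) - w n * U n 1 0)"
    "small eps 2 (\<lambda>n. U n (- 1) 1 - w n * U n 0 1)" "small eps 2 (\<lambda>n. U n 0 2 - w n * U n 0 1)"
    subgoal
      by (rule first_order[where q = "\<lambda>n. U n 3 0 + U n 2 1 + U n 2 (- 1) + \<omega>r * U n 2 0"])
        (use eq_w[of 2 0] in \<open>auto simp: right algebra_simps simp del: One_nat_def intro!: small_add small_cmult out\<close>)
    subgoal
      by (rule first_order[where q = "\<lambda>n. U n 2 (- 1) + U n 0 (- 1) + U n 1 (- 2) + \<omega>b * U n 1 (- 1)"])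
        (use eq_w[of 1 "- 1"] in \<open>auto simp: bottom algebra_simps simp del: One_nat_def intro!: small_add small_cmult out\<close>)
    subgoal
      by (rule first_order[where q = "\<lambda>n. U n (- 2) 1 + U n (- 1) 2 + U n (- 1) 0 + \<omega>l * U n (- 1) 1"])
        (use eq_w[of "- 1" 1] in \<open>auto simp: left algebra_simps simp del: One_nat_def intro!: small_add small_cmult out\<close>)
    subgoal
      by (rule first_order[where q = "\<lambda>n. U n 1 2 + U n (- 1) 2 + U n 0 3 + \<omega>t * U n 0 2"])
        (use eq_w[of 0 2] in \<open>auto simp: top algebra_simps simp del: One_nat_def intro!: small_add small_cmult out\<close>)
    done
  \<comment> \<open>A corner has two neighbours off the cell, each equal to \<open>w\<close> times
    the value at the corner to leading order; 2 w is their joint shift of the diagonal.\<close>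
  define m where "m n = k n - 2 * w n" for n
  have m: "small eps 0 m"
    unfolding m_def
    by (intro small_diff k small_cmult) (rule weaken[of 1], auto simp: small_def w intro: exI[of _ 1])
  have mb: "small eps 2 (\<lambda>n. m n * U n 1 0 - U n 1 1)"
    apply (rule small_eq[OF small_add[OF nb(1,2)]])
    subgoal for n using Brow[of n] m_def[of n] by algebra
    done
  have mc: "small eps 2 (\<lambda>n. m n * U n 0 1 - U n 1 1)"
    apply (rule small_eq[OF small_add[OF nb(3,4)]])
    subgoal for n using Crow[of n] m_def[of n] by algebra
    done
  \<comment> \<open>Adding the rows at (1,0) and (0,1) gives m (b + c) - 2 d, and b + c is already
    small.\<close>
  have "small eps 2 (\<lambda>n. m n * (U n 1 0 + U n 0 1))" using small_mult[OF m bc] by (simp only: add_0)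
  then have "small eps 2 (\<lambda>n. (1 / 2) * (m n * (U n 1 0 + U n 0 1)
      - ((m n * U n 1 0 - U n 1 1) + (m n * U n 0 1 - U n 1 1))))"
    by (intro small_cmult small_diff small_add mb mc)
  then have d: "small eps 2 (\<lambda>n. U n 1 1)"
    by (rule small_eq) (simp add: algebra_simps)
  have mb2: "small eps 2 (\<lambda>n. m n * U n 1 0)"
    by (rule small_eq[OF small_add[OF mb d]]) simp
  have d1: "small eps 1 (\<lambda>n. U n 1 1)" by (rule weaken[OF d]) simp
  have rd: "small eps 2 (\<lambda>n. U n 2 1)" and td: "small eps 2 (\<lambda>n. U n 1 2)"
    by (rule two, rule out_step; simp add: out d1 del: One_nat_def)+
  have rd3: "small eps 3 (\<lambda>n. U n 3 1)" "small eps 3 (\<lambda>n. U n 2 2)"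
    and td3: "small eps 3 (\<lambda>n. U n 1 3)"
    by (rule three, rule out_step; simp add: far rd td del: One_nat_def)+
  have L: "small eps 4 (\<lambda>n. U n (- 1) 0 - w n * U n 0 0 - w n ^ 2 * U n 0 1 - 2 * complex_of_real \<omega>l * w n ^ 3 * U n 0 1)"
    by (rule neighbour_expansion(2)[where Y = "\<lambda>n. U n (- 1) 1" and ?X1.0 = "\<lambda>n. U n (- 2) 0"
          and ?X2.0 = "\<lambda>n. U n (- 1) (- 1)" and ?Y1.0 = "\<lambda>n. U n (- 2) 1" and ?Y2.0 = "\<lambda>n. U n (- 1) 2"])
      (use eq_w[of "- 1" 0] eq_w[of "- 1" 1] in \<open>auto simp: left algebra_simps simp del: One_nat_def intro!: out far la la3 zero'\<close>)
  have Bo: "small eps 4 (\<lambda>n. U n 0 (- 1) - w n * U n 0 0 - w n ^ 2 * U n 1 0 - 2 * complex_of_real \<omega>b * w n ^ 3 * U n 1 0)"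
    by (rule neighbour_expansion(2)[where Y = "\<lambda>n. U n 1 (- 1)" and ?X1.0 = "\<lambda>n. U n 0 (- 2)"
          and ?X2.0 = "\<lambda>n. U n (- 1) (- 1)" and ?Y1.0 = "\<lambda>n. U n 1 (- 2)" and ?Y2.0 = "\<lambda>n. U n 2 (- 1)"])
      (use eq_w[of 0 "- 1"] eq_w[of 1 "- 1"] in \<open>auto simp: bottom algebra_simps simp del: One_nat_def intro!: out far ba ba3 la3 zero'\<close>)
  have Ri: "small eps 4 (\<lambda>n. U n 2 1 - w n * U n 1 1 - w n ^ 2 * U n 1 0 - 2 * complex_of_real \<omega>r * w n ^ 3 * U n 1 0)"
    by (rule neighbour_expansion(2)[where Y = "\<lambda>n. U n 2 0" and ?X1.0 = "\<lambda>n. U n 3 1"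
          and ?X2.0 = "\<lambda>n. U n 2 2" and ?Y1.0 = "\<lambda>n. U n 3 0" and ?Y2.0 = "\<lambda>n. U n 2 (- 1)"])
      (use eq_w[of 2 1] eq_w[of 2 0] in \<open>auto simp: right algebra_simps simp del: One_nat_def intro!: out far rd rd3 d\<close>)
  have To: "small eps 4 (\<lambda>n. U n 1 2 - w n * U n 1 1 - w n ^ 2 * U n 0 1 - 2 * complex_of_real \<omega>t * w n ^ 3 * U n 0 1)"
    by (rule neighbour_expansion(2)[where Y = "\<lambda>n. U n 0 2" and ?X1.0 = "\<lambda>n. U n 1 3"
          and ?X2.0 = "\<lambda>n. U n 2 2" and ?Y1.0 = "\<lambda>n. U n 0 3" and ?Y2.0 = "\<lambda>n. U n (- 1) 2"])
      (use eq_w[of 1 2] eq_w[of 0 2] in \<open>auto simp: top algebra_simps simp del: One_nat_def intro!: out far td td3 rd3 d\<close>)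
  define \<delta> where "\<delta> = complex_of_real (\<omega>r - \<omega>b - \<omega>t + \<omega>l)"
  \<comment> \<open>Row (1,1) minus row (0,0): the terms w^2 (b + c) occur on both sides and cancel,
    2 w d is absorbed in m, and the third order remains.\<close>
  define E where "E n = m n * U n 1 1 - 2 * w n ^ 3 * ((complex_of_real \<omega>r - complex_of_real \<omega>b) * U n 1 0 + (complex_of_real \<omega>t - complex_of_real \<omega>l) * U n 0 1)" for n
  have E: "small eps 4 E"
    apply (rule small_eq[OF small_diff[OF small_add[OF Ri To] small_add[OF L Bo]]])
    subgoal for n using A[of n] D[of n] zero[of n] E_def[of n] m_def[of n] by algebra
    done
  \<comment> \<open>The size of m d alone is only O(eps^2); multiplication by b brings it to
    O(eps^4), as m b and d are both O(eps^2).\<close>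
  have "small eps 4 (\<lambda>n. U n 1 0 * E n)" using small_mult[OF cell0 E, of 1 0] by (simp only: add_0)
  moreover have "small eps 4 (\<lambda>n. (m n * U n 1 0) * U n 1 1)"
    by (rule back_subst[of "\<lambda>j. small eps j _", OF small_mult[OF mb2 d]]) simp
  \<comment> \<open>Replacing c by -b costs a multiple of b + c, which supplies the order missing
    beside w^3.\<close>
  moreover have "small eps 4 (\<lambda>n. w n * (w n * (w n * ((2 * (complex_of_real \<omega>t - complex_of_real \<omega>l)) * (U n 1 0 * (U n 1 0 + U n 0 1))))))"
  proof -
    have "small eps (Suc (Suc (Suc 1))) (\<lambda>n. w n * (w n * (w n * ((2 * (complex_of_real \<omega>t - complex_of_real \<omega>l)) * (U n 1 0 * (U n 1 0 + U n 0 1))))))"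
      using small_mult[OF cell0 weaken[OF bc, of 1], of 1 0]
      by (intro small_w_mult small_cmult) (simp only: add_0 one_le_numeral)
    then show ?thesis by (simp add: eval_nat_numeral)
  qed
  ultimately have "small eps 4 (\<lambda>n. (1 / 2) * ((m n * U n 1 0) * U n 1 1 - U n 1 0 * E n
      - w n * (w n * (w n * ((2 * (complex_of_real \<omega>t - complex_of_real \<omega>l)) * (U n 1 0 * (U n 1 0 + U n 0 1)))))))"
    by (intro small_cmult small_diff)
  then have "small eps 4 (\<lambda>n. \<delta> * w n ^ 3 * (U n 1 0)\<^sup>2)"
    by (rule small_eq) (simp add: E_def \<delta>_def field_simps power2_eq_square power3_eq_cube)
  then obtain M where M: "\<And>n. cmod (\<delta> * w n ^ 3 * (U n 1 0)\<^sup>2) \<le> M * eps n ^ 4"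
    unfolding small_def by blast
  have \<delta>: "cmod \<delta> > 0" using unbalanced by (auto simp: \<delta>_def simp flip: of_real_diff of_real_add)
  have b_sq: "(cmod (U n 1 0))\<^sup>2 \<le> M / cmod \<delta> * eps n" for n
  proof -
    have "eps n ^ 3 * (cmod \<delta> * (cmod (U n 1 0))\<^sup>2) \<le> eps n ^ 3 * (M * eps n)"
      using M[of n] by (simp add: norm_mult norm_power w power_Suc[of _ 3, simplified] mult_ac eval_nat_numeral)
    then have "cmod \<delta> * (cmod (U n 1 0))\<^sup>2 \<le> M * eps n"
      using eps(1)[of n] by (subst (asm) mult_le_cancel_left_pos) auto
    then show ?thesis using \<delta> by (simp add: field_simps)
  qed
  have eps_lim: "eps \<longlonglongrightarrow> 0"
  proof (rule Lim_null_comparison)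
    have "norm (eps n) \<le> 1 / (real n + 1)" for n
      using s[of n] s_pos[of n] by (simp add: eps_def abs_of_pos frac_le)
    then show "\<forall>\<^sub>F n in sequentially. norm (eps n) \<le> 1 / (real n + 1)" by simp
    show "(\<lambda>n. 1 / (real n + 1)) \<longlonglongrightarrow> 0" by real_asymp
  qed
  have "(\<lambda>n. (cmod (U n 1 0))\<^sup>2) \<longlonglongrightarrow> 0"
  proof (rule Lim_null_comparison)
    show "\<forall>\<^sub>F n in sequentially. norm ((cmod (U n 1 0))\<^sup>2) \<le> M / cmod \<delta> * eps n"
      using b_sq by simp
    show "(\<lambda>n. M / cmod \<delta> * eps n) \<longlonglongrightarrow> 0" by (intro tendsto_mult_right_zero eps_lim)
  qed
  from tendsto_real_sqrt[OF this] have b_lim: "(\<lambda>n. U n 1 0) \<longlonglongrightarrow> 0"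
    by (simp add: tendsto_norm_zero_iff)
  have small_lim: "F \<longlonglongrightarrow> 0" if "small eps 2 F" for F
  proof -
    have "small eps 1 F" using that by (rule weaken) simp
    then obtain M where M: "\<And>n. cmod (F n) \<le> M * eps n" by (auto simp: small_def)
    show ?thesis
    proof (rule Lim_null_comparison)
      show "\<forall>\<^sub>F n in sequentially. norm (F n) \<le> M * eps n" using M by simp
      show "(\<lambda>n. M * eps n) \<longlonglongrightarrow> 0" by (intro tendsto_mult_right_zero eps_lim)
    qed
  qed
  have d_lim: "(\<lambda>n. U n 1 1) \<longlonglongrightarrow> 0" by (rule small_lim[OF d])
  have c_lim: "(\<lambda>n. U n 0 1) \<longlonglongrightarrow> 0"
    using tendsto_diff[OF small_lim[OF bc] b_lim] by simp
  have ev: "\<forall>\<^sub>F n in sequentially. cmod (F n) < 1" if "F \<longlonglongrightarrow> 0" for F :: "nat \<Rightarrow> complex"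
    using tendsto_norm[OF that] by (auto intro: order_tendstoD(2))
  have "\<forall>\<^sub>F n in sequentially. False"
    using ev[OF b_lim] ev[OF c_lim] ev[OF d_lim]
  proof eventually_elim
    case (elim n)
    then show ?case using one[of n] zero[of n] by auto
  qed
  then show False by simp
qed

section \<open>Cells of the lattice\<close>

lemma sum_dirs_2:
  "(\<Sum>p\<in>dirs 2. g p) = g (0, 1) + g (0, - 1) + g (1, 1) + (g (1, - 1) :: complex)"
proof -
  have "dirs 2 = {(0, 1), (0, - 1), (1, 1), (1, - 1)}"
    by (auto simp: dirs_def less_2_cases_iff)
  then show ?thesis by (simp add: add.assoc)
qed

text \<open>If the claim failed, modes vanishing at the corner b would exist for arbitrarily large
  s, and a sequence of them would force the balance of opposite couplings. \<open>\<sigma>\<close>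
  gives plane coordinates centred at b.\<close>

lemma no_mode_square:
  fixes b :: "nat \<Rightarrow> int"
  defines "\<sigma> \<equiv> \<lambda>i j. b(0 := b 0 + i, 1 := b 1 + j)"
  assumes S: "S = {\<sigma> i j |i j. i \<in> {0, 1} \<and> j \<in> {0, 1}}"
    and f: "\<And>y. y \<in> S \<Longrightarrow> f y = 1" "\<And>y. y \<notin> S \<Longrightarrow> f y = 0"
    and V: "\<And>y. y \<in> S \<Longrightarrow> V y = 0" "\<And>y. \<bar>V y\<bar> \<le> K"
    and left: "V (\<sigma> (- 1) 0) = \<omega>l" "V (\<sigma> (- 1) 1) = \<omega>l"
    and right: "V (\<sigma> 2 0) = \<omega>r" "V (\<sigma> 2 1) = \<omega>r"
    and bottom: "V (\<sigma> 0 (- 1)) = \<omega>b" "V (\<sigma> 1 (- 1)) = \<omega>b"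
    and top: "V (\<sigma> 0 2) = \<omega>t" "V (\<sigma> 1 2) = \<omega>t"
    and unbalanced: "\<omega>l + \<omega>r \<noteq> \<omega>b + \<omega>t"
  shows "no_orthogonal_mode 2 V S f (\<lambda>y. if y = b then 1 else 0)"
proof (rule ccontr)
  assume "\<not> ?thesis"
  then have "\<forall>N. \<exists>s\<ge>N. \<exists>c u. cell_mode 2 V S f s c u \<and>
      (\<Sum>y\<in>S. complex_of_real (if y = b then 1 else 0) * f y * u y) = 0"
    unfolding no_orthogonal_mode_def eventually_at_top_linorder by blast
  then have "\<forall>n. \<exists>s c u. s \<ge> real n + 1 \<and> cell_mode 2 V S f s c u \<and>
      (\<Sum>y\<in>S. complex_of_real (if y = b then 1 else 0) * f y * u y) = 0"
    by blast
  from choice[OF this] obtain s where "\<forall>n. \<exists>c u. s n \<ge> real n + 1 \<and> cell_mode 2 V S f (s n) c u \<and>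
      (\<Sum>y\<in>S. complex_of_real (if y = b then 1 else 0) * f y * u y) = 0" by blast
  from choice[OF this] obtain c where "\<forall>n. \<exists>u. s n \<ge> real n + 1 \<and> cell_mode 2 V S f (s n) (c n) u \<and>
      (\<Sum>y\<in>S. complex_of_real (if y = b then 1 else 0) * f y * u y) = 0" by blast
  from choice[OF this] obtain u where s: "\<And>n. s n \<ge> real n + 1"
    and u: "\<And>n. cell_mode 2 V S f (s n) (c n) (u n)"
    and orth: "\<And>n. (\<Sum>y\<in>S. complex_of_real (if y = b then 1 else 0) * f y * u n y) = 0" by blast
  have \<sigma>_inj: "\<sigma> i j = \<sigma> i' j' \<longleftrightarrow> i = i' \<and> j = j'" for i j i' j'
    by (auto simp: \<sigma>_def fun_eq_iff)
  have in_S: "\<sigma> i j \<in> S \<longleftrightarrow> (i = 0 \<or> i = 1) \<and> (j = 0 \<or> j = 1)" for i j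
    unfolding S by (auto simp: \<sigma>_inj)
  have S_fin: "finite S"
    by (rule finite_subset[of _ "(\<lambda>(i, j). \<sigma> i j) ` ({0, 1} \<times> {0, 1})"]) (auto simp: S)
  have hops: "(\<Sum>p\<in>dirs 2. u n (step p (\<sigma> i j))) =
      u n (\<sigma> (i + 1) j) + u n (\<sigma> (i - 1) j) + u n (\<sigma> i (j + 1)) + u n (\<sigma> i (j - 1))" for n i j
  proof -
    have "step (0, 1) (\<sigma> i j) = \<sigma> (i + 1) j" "step (0, - 1) (\<sigma> i j) = \<sigma> (i - 1) j"
      "step (1, 1) (\<sigma> i j) = \<sigma> i (j + 1)" "step (1, - 1) (\<sigma> i j) = \<sigma> i (j - 1)"
      by (auto simp: step_def \<sigma>_def fun_eq_iff)
    then show ?thesis by (simp only: sum_dirs_2)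
  qed
  have "\<omega>l + \<omega>r = \<omega>b + \<omega>t"
  proof (rule square_modes_force_balance[where U = "\<lambda>n i j. u n (\<sigma> i j)" and W = "\<lambda>i j. V (\<sigma> i j)"
        and s = s and k = "\<lambda>n. \<i> * s n - c n" and K = K])
    fix n i j
    show "cmod (u n (\<sigma> i j)) \<le> 1" using u[of n] by (simp add: cell_mode_def)
    show "cmod (u n (\<sigma> i j)) \<le> 4 / s n" if "\<not> ((i = 0 \<or> i = 1) \<and> (j = 0 \<or> j = 1))"
      using u[of n] that in_S[of i j] by (simp add: cell_mode_def)
    show "u n (\<sigma> (i + 1) j) + u n (\<sigma> (i - 1) j) + u n (\<sigma> i (j + 1)) + u n (\<sigma> i (j - 1)) =
        (\<i> * s n - c n) * u n (\<sigma> i j)" if "(i = 0 \<or> i = 1) \<and> (j = 0 \<or> j = 1)"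
      using cell_mode_in_cell[OF u[of n] V(1)] that in_S[of i j] f(1)[of "\<sigma> i j"]
      unfolding hops[symmetric] by simp
    show "u n (\<sigma> (i + 1) j) + u n (\<sigma> (i - 1) j) + u n (\<sigma> i (j + 1)) + u n (\<sigma> i (j - 1))
        + V (\<sigma> i j) * u n (\<sigma> i j) = \<i> * s n * u n (\<sigma> i j)"
      if "\<not> ((i = 0 \<or> i = 1) \<and> (j = 0 \<or> j = 1))"
    proof -
      have "(\<Sum>p\<in>dirs 2. u n (step p (\<sigma> i j))) + V (\<sigma> i j) * u n (\<sigma> i j)
          + c n * f (\<sigma> i j) * u n (\<sigma> i j) = \<i> * s n * u n (\<sigma> i j)"
        using u[of n] unfolding cell_mode_def by blast
      moreover have "f (\<sigma> i j) = 0" using f(2) that in_S[of i j] by blast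
      ultimately show ?thesis unfolding hops[symmetric] by simp
    qed
  next
    fix n
    have "\<sigma> 0 0 = b" by (auto simp: \<sigma>_def)
    then have "b \<in> S" using in_S[of 0 0] by simp
    have "(\<Sum>y\<in>S. complex_of_real (if y = b then 1 else 0) * f y * u n y) = (\<Sum>y\<in>S. if y = b then u n y else 0)"
      by (intro sum.cong) (auto simp: f)
    then have "(\<Sum>y\<in>S. complex_of_real (if y = b then 1 else 0) * f y * u n y) = u n b"
      using S_fin \<open>b \<in> S\<close> by simp
    then show "u n (\<sigma> 0 0) = 0" using orth \<open>\<sigma> 0 0 = b\<close> by simp
    obtain x where "x \<in> S" "cmod (u n x) = 1" using u[of n] by (auto simp: cell_mode_def)
    then show "cmod (u n (\<sigma> 0 0)) = 1 \<or> cmod (u n (\<sigma> 1 0)) = 1 \<or>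
        cmod (u n (\<sigma> 0 1)) = 1 \<or> cmod (u n (\<sigma> 1 1)) = 1"
      unfolding S by auto
  qed (use s V left right bottom top in auto)
  then show False using unbalanced by simp
qed

section \<open>The partition into cells and the dependence of the potential on one coupling\<close>

lemma cell_index_unique:
  assumes "k \<in> Zd d" "k' \<in> Zd d" "shiftL L n k \<in> C0 d L" "shiftL L n k' \<in> C0 d L"
  shows "k = k'"
proof
  fix i
  have div: "m i = n i div int (L i)" if "shiftL L n m \<in> C0 d L" "i < d" for m
  proof -
    have "0 \<le> n i - m i * int (L i)" "n i - m i * int (L i) < int (L i)"
      using that by (auto simp: C0_def shiftL_def)
    then have "n i div int (L i) = m i"
      by (intro int_div_pos_eq[of _ _ _ "n i - m i * int (L i)"]) (auto simp: mult.commute)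
    then show ?thesis ..
  qed
  show "k i = k' i"
    using assms div[of k] div[of k'] by (cases "i < d") (auto simp: Zd_def)
qed

lemma potential_eq:
  assumes "k \<in> Zd d" "shiftL L n k \<in> C0 d L"
  shows "potential d L f w n = w k * f (shiftL L n k)"
proof -
  have "{k \<in> Zd d. shiftL L n k \<in> C0 d L} = {k}"
    using assms cell_index_unique[of _ d k] by auto
  then show ?thesis by (simp add: potential_def)
qed

lemma potential_eq_0: "\<not> (\<exists>k\<in>Zd d. shiftL L n k \<in> C0 d L) \<Longrightarrow> potential d L f w n = 0"
  unfolding potential_def by (rule sum.neutral) auto

definition cell_index :: "nat \<Rightarrow> (nat \<Rightarrow> nat) \<Rightarrow> (nat \<Rightarrow> int) \<Rightarrow> (nat \<Rightarrow> int)" where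
  "cell_index d L n = (\<lambda>i. if i < d then n i div int (L i) else 0)"

lemma cell_index_in_Zd: "cell_index d L n \<in> Zd d"
  by (simp add: cell_index_def Zd_def)

lemma shiftL_cell_index:
  assumes "\<forall>i<d. L i \<ge> 1" "n \<in> Zd d"
  shows "shiftL L n (cell_index d L n) \<in> C0 d L"
proof -
  have "n i - n i div int (L i) * int (L i) = n i mod int (L i)" for i
    by (simp add: minus_div_mult_eq_mod)
  moreover have "L i > 0" if "i < d" for i using assms(1) that by (auto simp: Suc_le_eq)
  ultimately show ?thesis
    using assms(2) by (auto simp: C0_def shiftL_def cell_index_def Zd_def)
qed

lemma finite_C0: "finite (C0 d L)"
proof -
  have "inj_on (\<lambda>x. restrict x {..<d}) (C0 d L)"
  proof (rule inj_onI)
    fix x y assume xy: "x \<in> C0 d L" "y \<in> C0 d L" "restrict x {..<d} = restrict y {..<d}"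
    show "x = y"
    proof
      fix i
      show "x i = y i"
      proof (cases "i < d")
        case True
        then show ?thesis using fun_cong[OF xy(3), of i] by simp
      next
        case False
        then show ?thesis using xy(1,2) by (simp add: C0_def)
      qed
    qed
  qed
  moreover have "finite ((\<lambda>x. restrict x {..<d}) ` C0 d L)"
  proof (rule finite_subset)
    show "(\<lambda>x. restrict x {..<d}) ` C0 d L \<subseteq> (\<Pi>\<^sub>E i\<in>{..<d}. {0..<int (L i)})"
      by (auto simp: C0_def split: if_splits)
  qed (auto intro!: finite_PiE)
  ultimately show ?thesis by (rule finite_imageD[rotated])
qed

lemma step_in_Zd:
  assumes "p \<in> dirs d"
  shows "step p n \<in> Zd d \<longleftrightarrow> n \<in> Zd d"
proof -
  have "step p n i = n i" if "i \<ge> d" for i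
    using assms that by (auto simp: step_def dirs_def)
  then show ?thesis by (simp add: Zd_def)
qed

lemma sum_nbrs:
  assumes "n \<in> Zd d"
  shows "(\<Sum>m\<in>nbrs d n. g m) = (\<Sum>p\<in>dirs d. (g (step p n) :: complex))"
proof (rule sum.reindex_bij_betw[symmetric])
  show "bij_betw (\<lambda>p. step p n) (dirs d) (nbrs d n)"
  proof (rule bij_betw_imageI)
    show "inj_on (\<lambda>p. step p n) (dirs d)"
    proof (rule inj_onI)
      fix p q assume pq: "p \<in> dirs d" "q \<in> dirs d" "step p n = step q n"
      have "n (fst p) + snd p = (if fst p = fst q then n (fst p) + snd q else n (fst p))"
        using fun_cong[OF pq(3), of "fst p"] by (simp add: step_def fun_upd_def)
      moreover have "snd p \<noteq> 0" using pq(1) by (auto simp: dirs_def)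
      ultimately show "p = q" by (auto simp: prod_eq_iff split: if_splits)
    qed
    show "(\<lambda>p. step p n) ` dirs d = nbrs d n"
    proof (intro equalityI subsetI)
      fix m assume "m \<in> (\<lambda>p. step p n) ` dirs d"
      then obtain p where p: "p \<in> dirs d" "m = step p n" by blast
      have "(\<Sum>i<d. \<bar>m i - n i\<bar>) = (\<Sum>i<d. if i = fst p then \<bar>snd p\<bar> else 0)"
        by (intro sum.cong) (auto simp: p step_def)
      also have "\<dots> = 1" using p(1) by (auto simp: dirs_def)
      finally show "m \<in> nbrs d n" using p step_in_Zd assms by (auto simp: nbrs_def)
    next
      fix m assume "m \<in> nbrs d n"
      then have m: "m \<in> Zd d" "(\<Sum>i<d. \<bar>m i - n i\<bar>) = 1" by (auto simp: nbrs_def)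
      then have "\<exists>i<d. m i - n i \<noteq> 0"
        by (metis (no_types, lifting) abs_zero lessThan_iff sum.neutral zero_neq_one)
      then obtain i where i: "i < d" "m i - n i \<noteq> 0" by blast
      have split: "\<bar>m i - n i\<bar> + (\<Sum>j\<in>{..<d} - {i}. \<bar>m j - n j\<bar>) = 1"
        using m(2) sum.remove[of "{..<d}" i "\<lambda>i. \<bar>m i - n i\<bar>"] i(1) by simp
      moreover have nn: "(\<Sum>j\<in>{..<d} - {i}. \<bar>m j - n j\<bar>) \<ge> 0" by (rule sum_nonneg) simp
      ultimately have one: "\<bar>m i - n i\<bar> = 1" and "(\<Sum>j\<in>{..<d} - {i}. \<bar>m j - n j\<bar>) = 0"
        using i(2) by linarith+
      then have "\<forall>j\<in>{..<d} - {i}. \<bar>m j - n j\<bar> = 0"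
        by (subst (asm) sum_nonneg_eq_0_iff) auto
      then have "m j = n j" if "j \<noteq> i" for j
        using that m(1) assms by (cases "j < d") (auto simp: Zd_def)
      then have "m = step (i, m i - n i) n" by (auto simp: step_def)
      moreover have "(i, m i - n i) \<in> dirs d" using one i(1) by (auto simp: dirs_def)
      ultimately show "m \<in> (\<lambda>p. step p n) ` dirs d" by blast
    qed
  qed
qed

text \<open>The zero function is allowed: simplicity is tested on 2x2 minors, for which it does no
  harm.\<close>

definition l2_solution ::
  "nat \<Rightarrow> (nat \<Rightarrow> nat) \<Rightarrow> ((nat \<Rightarrow> int) \<Rightarrow> real) \<Rightarrow> ((nat \<Rightarrow> int) \<Rightarrow> real)
     \<Rightarrow> real \<Rightarrow> ((nat \<Rightarrow> int) \<Rightarrow> complex) \<Rightarrow> bool" where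
  "l2_solution d L f w E u \<longleftrightarrow> in_l2 d u \<and> (\<forall>n\<in>Zd d. HB d L f w u n = complex_of_real E * u n)"

definition cell_at :: "nat \<Rightarrow> (nat \<Rightarrow> nat) \<Rightarrow> (nat \<Rightarrow> int) \<Rightarrow> (nat \<Rightarrow> int) set" where
  "cell_at d L k = {n. shiftL L n k \<in> C0 d L}"

text \<open>Resetting the coupling of cell k to 0 gives a background that vanishes on this cell and
  does not depend on \<open>w k\<close>; the condition can thus be read off from any w with the same
  couplings elsewhere.\<close>

abbreviation no_cell_mode where
  "no_cell_mode d L f w k \<equiv> no_orthogonal_mode d (potential d L f (w(k := 0))) (cell_at d L k)
    (\<lambda>n. f (shiftL L n k))"

lemma finite_cell_at: "finite (cell_at d L k)"
proof -
  have "cell_at d L k = (\<lambda>n. shiftL L n k) -` C0 d L" by (auto simp: cell_at_def)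
  moreover have "inj (\<lambda>n. shiftL L n k)"
    by (rule injI) (simp add: shiftL_def fun_eq_iff)
  ultimately show ?thesis using finite_vimageI[OF finite_C0] by metis
qed

lemma countable_Zd: "countable (Zd d)"
proof (rule countable_subset)
  show "Zd d \<subseteq> (\<lambda>xs i. if i < d then xs ! i else 0) ` (UNIV :: int list set)"
  proof
    fix x assume "x \<in> Zd d"
    then have "x = (\<lambda>i. if i < d then map x [0..<d] ! i else 0)" by (auto simp: Zd_def)
    then show "x \<in> (\<lambda>xs i. if i < d then xs ! i else 0) ` (UNIV :: int list set)" by blast
  qed
qed simp

lemma potential_bounded:
  assumes f_pos: "\<forall>x\<in>C0 d L. f x > 0" and f_off: "\<forall>x. x \<notin> C0 d L \<longrightarrow> f x = 0"
    and R: "\<And>j. j \<in> Zd d \<Longrightarrow> \<bar>w j\<bar> \<le> R"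
  shows "\<bar>potential d L f w n\<bar> \<le> R * (\<Sum>x\<in>C0 d L. f x)"
proof -
  have nonneg: "0 \<le> f n" for n using f_pos f_off by (cases "n \<in> C0 d L") (auto intro: less_imp_le)
  have R0: "0 \<le> R" using R[of "\<lambda>_. 0"] by (auto simp: Zd_def)
  show ?thesis
  proof (cases "\<exists>j\<in>Zd d. shiftL L n j \<in> C0 d L")
    case True
    then obtain j where j: "j \<in> Zd d" "shiftL L n j \<in> C0 d L" by blast
    have "\<bar>f (shiftL L n j)\<bar> \<le> (\<Sum>x\<in>C0 d L. f x)"
      using member_le_sum[OF j(2) _ finite_C0, of f] nonneg by simp
    then show ?thesis
      unfolding potential_eq[OF j] abs_mult using R[OF j(1)] R0 by (intro mult_mono) auto
  next
    case False
    then show ?thesis using R0 nonneg by (simp add: potential_eq_0 sum_nonneg)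
  qed
qed

lemma potential_update:
  assumes "k \<in> Zd d" and f_zero: "\<forall>x. x \<notin> C0 d L \<longrightarrow> f x = 0"
  shows "potential d L f (w(k := l)) n = potential d L f (w(k := 0)) n + l * f (shiftL L n k)"
proof (cases "\<exists>k'\<in>Zd d. shiftL L n k' \<in> C0 d L")
  case True
  then obtain k' where k': "k' \<in> Zd d" "shiftL L n k' \<in> C0 d L" by blast
  show ?thesis
  proof (cases "k' = k")
    case True
    then show ?thesis using k' by (simp add: potential_eq)
  next
    case False
    then have "shiftL L n k \<notin> C0 d L" using k' cell_index_unique assms(1) by blast
    then show ?thesis using k' False f_zero by (simp add: potential_eq)
  qed
next
  case False
  then have "shiftL L n k \<notin> C0 d L" using assms(1) by blast
  then show ?thesis using False f_zero by (simp add: potential_eq_0)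
qed

text \<open>As a function of the coupling l of cell k the operator is affine, a fixed background
  plus l times a weight on the cell: an instance of the abstract cell perturbation.\<close>

lemma resonance_negligible:
  assumes f_pos: "\<forall>x\<in>C0 d L. f x > 0" and f_off: "\<forall>x. x \<notin> C0 d L \<longrightarrow> f x = 0"
    and k: "k \<in> Zd d" and R: "\<And>j. j \<in> Zd d \<Longrightarrow> j \<noteq> k \<Longrightarrow> \<bar>w j\<bar> \<le> R"
    and no_mode: "no_cell_mode d L f w k e"
    and x: "x \<in> cell_at d L k" "x \<in> Zd d" "y \<in> Zd d"
  shows "negligible {l. \<exists>E u v. l2_solution d L f (w(k := l)) E u \<and> l2_solution d L f (w(k := l)) E v \<and>
    u x * v y \<noteq> u y * v x}"
proof -
  define V where "V = potential d L f (w(k := 0))"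
  define S where "S = cell_at d L k"
  define fk where "fk n = f (shiftL L n k)" for n
  have S: "finite S" "\<And>x. x \<in> S \<Longrightarrow> 0 < fk x" "\<And>x. x \<notin> S \<Longrightarrow> fk x = 0"
    using finite_cell_at f_pos f_off by (auto simp: S_def fk_def cell_at_def)
  have V_bound: "\<bar>V n\<bar> \<le> \<bar>R\<bar> * (\<Sum>x\<in>C0 d L. f x)" for n
    unfolding V_def
  proof (rule potential_bounded[OF f_pos f_off])
    show "\<bar>(w(k := 0)) j\<bar> \<le> \<bar>R\<bar>" if "j \<in> Zd d" for j
      using R[OF that] by auto
  qed
  have V_S: "V x = 0" if "x \<in> S" for x
    using that k by (simp add: V_def S_def cell_at_def potential_eq)
  interpret cell_perturbation "\<lambda>u. hop d u + mult_op V u" S fk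
    by (rule lattice_cell_perturbation[OF V_bound S])
  obtain s0 where s0: "\<And>s c u. s > s0 \<Longrightarrow> cell_mode d V S fk s c u \<Longrightarrow>
      (\<Sum>x\<in>S. complex_of_real (e x) * fk x * u x) \<noteq> 0"
    using no_mode unfolding no_orthogonal_mode_def eventually_at_top_dense V_def S_def fk_def by blast
  have ND: "u = 0" if "s > max s0 (2 * d)"
    "(hop d u + mult_op V u) + c *\<^sub>C P u = (\<i> * complex_of_real s) *\<^sub>C u"
    "(\<Sum>x\<in>S. complex_of_real (e x * fk x) * coord u x) = 0" for s u c
  proof (rule no_mode_imp_zero[OF V_bound V_S S _ that(2)])
    show "2 * real d < s" using that(1) by simp
    show "(\<Sum>x\<in>S. complex_of_real (e x) * fk x * coord u x) = 0"
      using that(3) by simp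
    show "(\<Sum>x\<in>S. complex_of_real (e x) * fk x * v x) \<noteq> 0" if "cell_mode d V S fk s c v" for v
      using s0[OF _ that] \<open>s > max s0 (2 * d)\<close> by simp
  qed
  have pot: "potential d L f (w(k := l)) n = V n + l * fk n" for l n
    unfolding V_def fk_def by (rule potential_update[OF k f_off])
  \<comment> \<open>Hops in \<open>dirs d\<close> neither leave nor enter \<open>Zd d\<close>, so
    extension by zero carries solutions on \<open>Zd d\<close> to solutions on the whole index
    type.\<close>
  define ext where "ext u = ell2_of (\<lambda>n. if n \<in> Zd d then u n else 0)" for u :: "(nat \<Rightarrow> int) \<Rightarrow> complex"
  have coord_ext: "coord (ext u) n = (if n \<in> Zd d then u n else 0)" if "in_l2 d u" for u n
  proof -
    have "(\<lambda>n. (cmod (if n \<in> Zd d then u n else 0))\<^sup>2) summable_on UNIV"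
      using that unfolding in_l2_def
      by (rule summable_on_cong_neutral[THEN iffD1, rotated -1]) auto
    then show ?thesis by (simp add: ext_def coord_ell2_of)
  qed
  have ext_eq: "(hop d (ext u) + mult_op V (ext u)) + of_real l *\<^sub>C P (ext u) = of_real E *\<^sub>C ext u"
    if u: "l2_solution d L f (w(k := l)) E u" for u l E
  proof (rule ell2_eqI)
    fix n
    have u2: "in_l2 d u" using u by (simp add: l2_solution_def)
    have "(\<Sum>p\<in>dirs d. coord (ext u) (step p n)) = (if n \<in> Zd d then \<Sum>p\<in>dirs d. u (step p n) else 0)"
      by (simp add: coord_ext[OF u2] step_in_Zd cong: sum.cong)
    then show "coord ((hop d (ext u) + mult_op V (ext u)) + of_real l *\<^sub>C P (ext u)) n =
        coord (of_real E *\<^sub>C ext u) n"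
      using u by (auto simp: coord_hop coord_mult_op[OF V_bound] coord_P coord_ext[OF u2] l2_solution_def
          HB_def sum_nbrs pot algebra_simps)
  qed
  from coupling_negligible[OF ND countable_Zd] have neg: "negligible {l. \<exists>E u v.
      (hop d u + mult_op V u) + of_real l *\<^sub>C P u = of_real E *\<^sub>C u \<and>
      (hop d v + mult_op V v) + of_real l *\<^sub>C P v = of_real E *\<^sub>C v \<and>
      (\<forall>n. n \<notin> Zd d \<longrightarrow> coord u n = 0 \<and> coord v n = 0) \<and>
      (\<exists>x\<in>S. \<exists>y. coord u x * coord v y \<noteq> coord u y * coord v x)}" (is "negligible ?L") .
  show ?thesis
  proof (rule negligible_subset[OF neg], intro subsetI)
    fix l assume "l \<in> {l. \<exists>E u v. l2_solution d L f (w(k := l)) E u \<and> l2_solution d L f (w(k := l)) E v \<and>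
      u x * v y \<noteq> u y * v x}"
    then obtain E u v where uv: "l2_solution d L f (w(k := l)) E u" "l2_solution d L f (w(k := l)) E v"
      "u x * v y \<noteq> u y * v x" by blast
    have l2: "in_l2 d u" "in_l2 d v" using uv by (auto simp: l2_solution_def)
    show "l \<in> ?L"
    proof (intro CollectI exI conjI)
      show "(hop d (ext u) + mult_op V (ext u)) + of_real l *\<^sub>C P (ext u) = of_real E *\<^sub>C ext u"
        by (rule ext_eq[OF uv(1)])
      show "(hop d (ext v) + mult_op V (ext v)) + of_real l *\<^sub>C P (ext v) = of_real E *\<^sub>C ext v"
        by (rule ext_eq[OF uv(2)])
      show "\<forall>n. n \<notin> Zd d \<longrightarrow> coord (ext u) n = 0 \<and> coord (ext v) n = 0"
        by (simp add: coord_ext[OF l2(1)] coord_ext[OF l2(2)])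
      have "coord (ext u) x * coord (ext v) y \<noteq> coord (ext u) y * coord (ext v) x"
        using uv(3) x(2,3) by (simp add: coord_ext[OF l2(1)] coord_ext[OF l2(2)])
      then show "\<exists>x\<in>S. \<exists>y. coord (ext u) x * coord (ext v) y \<noteq> coord (ext u) y * coord (ext v) x"
        using x(1) unfolding S_def by blast
    qed
  qed
qed

section \<open>Measurability and Fubini\<close>

text \<open>Resampling coordinate k independently leaves the product measure unchanged, so Tonelli's
  theorem for the pair of new coordinate and old point reduces the measure of B to those of its
  sections.\<close>

lemma null_sets_PiM_sectionwise:
  assumes M: "\<And>i. i \<in> I \<Longrightarrow> prob_space (M i)" and k: "k \<in> I" and B: "B \<in> sets (PiM I M)"
    and sections: "\<And>x. x \<in> space (PiM I M) \<Longrightarrow> {l \<in> space (M k). x(k := l) \<in> B} \<in> null_sets (M k)"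
  shows "B \<in> null_sets (PiM I M)"
proof -
  interpret Mk: prob_space "M k" by (rule M[OF k])
  interpret N: prob_space "PiM I M" by (rule prob_space_PiM[OF M])
  interpret pair_sigma_finite "M k" "PiM I M" ..
  let ?upd = "\<lambda>(l, x). x(k := l)"
  have upd: "?upd \<in> measurable (M k \<Otimes>\<^sub>M PiM I M) (PiM I M)"
  proof -
    have "(\<lambda>p. (\<lambda>(x, l). x(k := l)) (snd p, fst p)) \<in> measurable (M k \<Otimes>\<^sub>M PiM I M) (PiM (insert k I) M)"
      by measurable
    then show ?thesis using k by (simp add: insert_absorb case_prod_unfold)
  qed
  let ?Q = "?upd -` B \<inter> space (M k \<Otimes>\<^sub>M PiM I M)"
  have Q: "?Q \<in> sets (M k \<Otimes>\<^sub>M PiM I M)" by (rule measurable_sets[OF upd B])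
  have "emeasure (PiM I M) B = emeasure (distr (M k \<Otimes>\<^sub>M PiM I M) (PiM I M) ?upd) B"
    using distr_pair_PiM_eq_PiM[of I M k] M k by (simp add: insert_absorb)
  also have "\<dots> = emeasure (M k \<Otimes>\<^sub>M PiM I M) ?Q" by (rule emeasure_distr[OF upd B])
  also have "\<dots> = (\<integral>\<^sup>+x. emeasure (M k) ((\<lambda>l. (l, x)) -` ?Q) \<partial>PiM I M)"
    by (rule emeasure_pair_measure_alt2[OF Q])
  also have "\<dots> = (\<integral>\<^sup>+x. 0 \<partial>PiM I M)"
  proof (rule nn_integral_cong)
    fix x assume x: "x \<in> space (PiM I M)"
    then have "(\<lambda>l. (l, x)) -` ?Q = {l \<in> space (M k). x(k := l) \<in> B}"
      by (auto simp: space_pair_measure)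
    then show "emeasure (M k) ((\<lambda>l. (l, x)) -` ?Q) = 0"
      using sections[OF x] by (simp add: null_sets_def)
  qed
  finally show ?thesis using B by (simp add: null_sets_def)
qed

text \<open>Tychonoff's theorem, in the topology of pointwise convergence.\<close>

lemma compact_function_box:
  fixes K :: "'b::topological_space set"
  assumes "compact K"
  shows "compact {w :: 'i \<Rightarrow> 'b. \<forall>i. w i \<in> K}"
proof -
  have "compactin (product_topology (\<lambda>_::'i. euclidean) UNIV) (PiE UNIV (\<lambda>_. K))"
    using assms by (simp add: compactin_PiE)
  then show ?thesis
    by (simp add: euclidean_product_topology PiE_def Pi_def extensional_def)
qed

type_synonym 's resonance_data = "(nat \<Rightarrow> real) \<times> real \<times> ('s \<Rightarrow> complex) \<times> ('s \<Rightarrow> complex)"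

text \<open>The coupling constants are enumerated by natural numbers, since the product sigma-algebra agrees
  with the Borel sets of the product topology only for a countable index type.\<close>

definition resonance_set ::
  "'s set \<Rightarrow> 'p set \<Rightarrow> ('p \<Rightarrow> 's \<Rightarrow> 's) \<Rightarrow> ('s \<Rightarrow> nat) \<Rightarrow> ('s \<Rightarrow> real) \<Rightarrow> real \<Rightarrow> nat \<Rightarrow> 's \<Rightarrow> 's \<Rightarrow>
    's resonance_data set" where
  "resonance_set X D st idx g R j x y = {(w, E, u, v).
     (\<forall>n\<in>X. (\<Sum>p\<in>D. u (st p n)) + complex_of_real (w (idx n) * g n) * u n = complex_of_real E * u n) \<and>
     (\<forall>n\<in>X. (\<Sum>p\<in>D. v (st p n)) + complex_of_real (w (idx n) * g n) * v n = complex_of_real E * v n) \<and>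
     (\<forall>F\<in>{F. finite F \<and> F \<subseteq> X}. (\<Sum>n\<in>F. (cmod (u n))\<^sup>2) \<le> j) \<and>
     (\<forall>F\<in>{F. finite F \<and> F \<subseteq> X}. (\<Sum>n\<in>F. (cmod (v n))\<^sup>2) \<le> j) \<and>
     1 / Suc j \<le> cmod (u x * v y - u y * v x) \<and>
     (w, E, u, v) \<in> {w. \<forall>i. w i \<in> cball 0 R} \<times> cball 0 j \<times> {u. \<forall>n. u n \<in> cball 0 j} \<times> {v. \<forall>n. v n \<in> cball 0 j}}"

text \<open>All conditions are non-strict, and each concerns finitely many coordinates: square
  summability is replaced by bounds over finite sets, nonvanishing of the minor by the lower bound 1
  / Suc j. They are thus closed in the compact box, and the projection of a compact set is
  compact.\<close>

lemma closed_resonance_projection: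
  "closed (fst ` resonance_set X D st idx g R j x y)"
proof (rule compact_imp_closed, rule compact_continuous_image)
  let ?box = "{w :: nat \<Rightarrow> real. \<forall>i. w i \<in> cball 0 R} \<times> cball (0::real) j \<times>
    {u :: 'a \<Rightarrow> complex. \<forall>n. u n \<in> cball 0 j} \<times> {v :: 'a \<Rightarrow> complex. \<forall>n. v n \<in> cball 0 j}"
  have box: "compact ?box"
    by (intro compact_Times compact_function_box compact_cball)
  have [continuous_intros]:
    "continuous_on UNIV (\<lambda>p :: 'a resonance_data. fst p i)"
    "continuous_on UNIV (\<lambda>p :: 'a resonance_data. fst (snd (snd p)) n)"
    "continuous_on UNIV (\<lambda>p :: 'a resonance_data. snd (snd (snd p)) n)"
    for i n
    by (rule continuous_on_product_then_coordinatewise, intro continuous_intros)+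
  have "closed {p :: 'a resonance_data.
     (\<forall>n\<in>X. (\<Sum>q\<in>D. fst (snd (snd p)) (st q n)) + complex_of_real (fst p (idx n) * g n) * fst (snd (snd p)) n
       = complex_of_real (fst (snd p)) * fst (snd (snd p)) n) \<and>
     (\<forall>n\<in>X. (\<Sum>q\<in>D. snd (snd (snd p)) (st q n)) + complex_of_real (fst p (idx n) * g n) * snd (snd (snd p)) n
       = complex_of_real (fst (snd p)) * snd (snd (snd p)) n) \<and>
     (\<forall>F\<in>{F. finite F \<and> F \<subseteq> X}. (\<Sum>n\<in>F. (cmod (fst (snd (snd p)) n))\<^sup>2) \<le> j) \<and>
     (\<forall>F\<in>{F. finite F \<and> F \<subseteq> X}. (\<Sum>n\<in>F. (cmod (snd (snd (snd p)) n))\<^sup>2) \<le> j) \<and>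
     1 / Suc j \<le> cmod (fst (snd (snd p)) x * snd (snd (snd p)) y - fst (snd (snd p)) y * snd (snd (snd p)) x)}"
    (is "closed ?C")
    unfolding Collect_conj_eq Collect_ball_eq
    by (intro closed_Int closed_INT ballI closed_Collect_eq closed_Collect_le continuous_intros)
  moreover have "resonance_set X D st idx g R j x y = ?box \<inter> ?C"
    by (auto simp: resonance_set_def)
  ultimately show "compact (resonance_set X D st idx g R j x y)"
    using compact_Int_closed[OF box] by simp
qed (intro continuous_intros)

section \<open>Almost sure simplicity\<close>

text \<open>The union over j exhausts the square-summable solutions with a nonzero minor, since
  energy, norms and reciprocal of the minor are all dominated by some j.\<close>

lemma resonance_set_iff_solution:
  assumes L_pos: "\<forall>i<d. L i \<ge> 1" and x: "x \<in> Zd d" and y: "y \<in> Zd d"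
  shows "(\<exists>j. (\<lambda>i. w (from_nat_into (Zd d) i)) \<in> fst ` resonance_set (Zd d) (dirs d) step
      (\<lambda>n. to_nat_on (Zd d) (cell_index d L n)) (\<lambda>n. f (shiftL L n (cell_index d L n))) R j x y) \<longleftrightarrow>
    (\<forall>k\<in>Zd d. \<bar>w k\<bar> \<le> R) \<and>
    (\<exists>E u v. l2_solution d L f w E u \<and> l2_solution d L f w E v \<and> u x * v y \<noteq> u y * v x)"
    (is "(\<exists>j. ?c \<in> fst ` ?Q j) \<longleftrightarrow> ?bounded \<and> ?solution")
proof -
  let ?pot = "\<lambda>n. complex_of_real (?c (to_nat_on (Zd d) (cell_index d L n)) * f (shiftL L n (cell_index d L n)))"
  have ne: "Zd d \<noteq> {}" using x by auto
  have c_eq: "?c (to_nat_on (Zd d) (cell_index d L n)) = w (cell_index d L n)" for n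
    using countable_Zd cell_index_in_Zd by (simp add: from_nat_into_to_nat_on)
  have c_bound: "(\<forall>i. ?c i \<in> cball 0 R) \<longleftrightarrow> ?bounded"
    using from_nat_into[OF ne] from_nat_into_surj[OF countable_Zd] by (auto simp: dist_norm)
  have HB_eq: "HB d L f w u n = complex_of_real E * u n \<longleftrightarrow>
      (\<Sum>p\<in>dirs d. u (step p n)) +
      ?pot n * u n
        = complex_of_real E * u n" if "n \<in> Zd d" for u E n
    unfolding HB_def sum_nbrs[OF that] c_eq
    using potential_eq[OF cell_index_in_Zd shiftL_cell_index[OF L_pos that], of f w] by simp
  have l2: "in_l2 d u" if "\<forall>F\<in>{F. finite F \<and> F \<subseteq> Zd d}. (\<Sum>n\<in>F. (cmod (u n))\<^sup>2) \<le> real j" for u j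
    unfolding in_l2_def
    by (rule nonneg_bdd_above_summable_on) (use that in \<open>auto intro!: bdd_aboveI[of _ "real j"]\<close>)
  show ?thesis
  proof (intro iffI conjI)
    assume "\<exists>j. ?c \<in> fst ` ?Q j"
    then obtain j E u v where Q: "(?c, E, u, v) \<in> ?Q j" by force
    then have "\<forall>i. ?c i \<in> cball 0 R" unfolding resonance_set_def by blast
    then show ?bounded using c_bound by blast
    have "\<forall>n\<in>Zd d. HB d L f w u n = complex_of_real E * u n"
      "\<forall>n\<in>Zd d. HB d L f w v n = complex_of_real E * v n"
      using Q HB_eq unfolding resonance_set_def by blast+
    moreover have "in_l2 d u" "in_l2 d v" using Q l2[of u j] l2[of v j] unfolding resonance_set_def by blast+
    moreover have "1 / real (Suc j) \<le> cmod (u x * v y - u y * v x)" using Q unfolding resonance_set_def by blast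
    then have "u x * v y \<noteq> u y * v x" by auto
    ultimately show ?solution unfolding l2_solution_def by blast
  next
    assume *: "?bounded \<and> ?solution"
    then obtain E u0 v0 where u0: "l2_solution d L f w E u0" and v0: "l2_solution d L f w E v0"
      and minor: "u0 x * v0 y \<noteq> u0 y * v0 x" by blast
    \<comment> \<open>The box bounds all coordinates, including those off \<open>Zd d\<close>, where
      nothing is known about the given solutions.\<close>
    define cut where "cut u n = (if n \<in> Zd d then u n else 0)" for u :: "(nat \<Rightarrow> int) \<Rightarrow> complex" and n
    have cut_eq: "\<forall>n\<in>Zd d. (\<Sum>p\<in>dirs d. cut u (step p n)) +
      ?pot n * cut u n
        = complex_of_real E * cut u n" if "l2_solution d L f w E u" for u
    proof
      fix n assume n: "n \<in> Zd d"
      have "(\<Sum>p\<in>dirs d. cut u (step p n)) = (\<Sum>p\<in>dirs d. u (step p n))"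
        using n by (intro sum.cong) (auto simp: cut_def step_in_Zd)
      moreover have "HB d L f w u n = complex_of_real E * u n"
        using that n by (simp add: l2_solution_def)
      ultimately show "(\<Sum>p\<in>dirs d. cut u (step p n)) +
        ?pot n * cut u n
          = complex_of_real E * cut u n"
        using HB_eq[OF n, of u E] n by (simp add: cut_def)
    qed
    define N where "N u = (\<Sum>\<^sub>\<infinity>n\<in>Zd d. (cmod (u n))\<^sup>2)" for u :: "(nat \<Rightarrow> int) \<Rightarrow> complex"
    have N: "(\<Sum>n\<in>F. (cmod (cut u n))\<^sup>2) \<le> N u" if "in_l2 d u" "finite F" "F \<subseteq> Zd d" for u F
    proof -
      have "(\<Sum>n\<in>F. (cmod (cut u n))\<^sup>2) = (\<Sum>n\<in>F. (cmod (u n))\<^sup>2)"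
        using that by (intro sum.cong) (auto simp: cut_def)
      also have "\<dots> \<le> N u"
        unfolding N_def using that by (intro finite_sum_le_infsum) (auto simp: in_l2_def)
      finally show ?thesis .
    qed
    define m where "m = cmod (u0 x * v0 y - u0 y * v0 x)"
    have m: "m > 0" using minor by (simp add: m_def)
    \<comment> \<open>The summand 1 makes j \<ge> 1, so that |u n|^2 \<le> j gives |u n| \<le>
      j.\<close>
    obtain j where j: "real j \<ge> 1 + \<bar>E\<bar> + \<bar>N u0\<bar> + \<bar>N v0\<bar> + 1 / m" using real_arch_simple by blast
    have inv: "1 / m > 0" using m by simp
    have j': "real j \<ge> 1" "\<bar>E\<bar> \<le> j" "N u0 \<le> j" "N v0 \<le> j" "1 / m \<le> real j"
      using j inv by linarith+
    have box: "cmod (cut u n) \<le> j" if "in_l2 d u" "N u \<le> j" for u n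
    proof (cases "n \<in> Zd d")
      case True
      have "(cmod (cut u n))\<^sup>2 \<le> real j" using N[OF that(1), of "{n}"] True that(2) by simp
      also have "\<dots> \<le> (real j)\<^sup>2" using j'(1) by (simp add: power2_eq_square)
      finally show ?thesis by (rule power2_le_imp_le) simp
    qed (simp add: cut_def)
    have l2': "in_l2 d u0" "in_l2 d v0" using u0 v0 by (auto simp: l2_solution_def)
    have "(?c, E, cut u0, cut v0) \<in> ?Q j"
      unfolding resonance_set_def mem_Collect_eq case_prod_conv
    proof (intro conjI cut_eq[OF u0] cut_eq[OF v0] SigmaI)
      show "\<forall>F\<in>{F. finite F \<and> F \<subseteq> Zd d}. (\<Sum>n\<in>F. (cmod (cut u0 n))\<^sup>2) \<le> real j"
        using N[OF l2'(1)] j'(3) order_trans by blast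
      show "\<forall>F\<in>{F. finite F \<and> F \<subseteq> Zd d}. (\<Sum>n\<in>F. (cmod (cut v0 n))\<^sup>2) \<le> real j"
        using N[OF l2'(2)] j'(4) order_trans by blast
      have "1 / real (Suc j) \<le> m"
        using j'(1,5) m by (simp add: field_simps)
      then show "1 / real (Suc j) \<le> cmod (cut u0 x * cut v0 y - cut u0 y * cut v0 x)"
        using x y by (simp add: cut_def m_def)
      show "?c \<in> {w. \<forall>i. w i \<in> cball 0 R}" using * c_bound by blast
      show "E \<in> cball 0 (real j)" using j'(2) by simp
      show "cut u0 \<in> {u. \<forall>n. u n \<in> cball 0 (real j)}" "cut v0 \<in> {v. \<forall>n. v n \<in> cball 0 (real j)}"
        using box[OF l2'(1) j'(3)] box[OF l2'(2) j'(4)] by simp_all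
    qed
    then show "\<exists>j. ?c \<in> fst ` ?Q j" by force
  qed
qed

text \<open>For fixed x and y, the coupling that is varied belongs to the cell of x. The predicate
  \<open>good\<close> marks couplings that admit a suitable e; it has to be measurable and almost
  sure, so that the bad set can be restricted to it.\<close>

lemma AE_simple_of_no_mode:
  fixes d :: nat and \<mu> :: "real measure" and M :: "((nat \<Rightarrow> int) \<Rightarrow> real) measure"
  defines "M \<equiv> PiM (Zd d) (\<lambda>_. \<mu>)"
  assumes L_pos: "\<forall>i<d. L i \<ge> 1"
    and f_pos: "\<forall>x\<in>C0 d L. f x > 0"
    and f_off: "\<forall>x. x \<notin> C0 d L \<longrightarrow> f x = 0"
    and \<mu>: "prob_space \<mu>" "sets \<mu> = sets borel"
    and null: "\<And>N. N \<in> sets borel \<Longrightarrow> negligible N \<Longrightarrow> N \<in> null_sets \<mu>"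
    and R: "AE t in \<mu>. \<bar>t\<bar> \<le> R"
    and good_meas: "\<And>k. k \<in> Zd d \<Longrightarrow> {w \<in> space M. good k w} \<in> sets M"
    and good_AE: "\<And>k. k \<in> Zd d \<Longrightarrow> AE w in M. good k w"
    and good: "\<And>k w. k \<in> Zd d \<Longrightarrow> good k w \<Longrightarrow> (\<forall>j\<in>Zd d. \<bar>w j\<bar> \<le> R) \<Longrightarrow>
      \<exists>e. no_cell_mode d L f w k e"
  shows "AE w in M. all_eigenvalues_simple d L f w"
proof -
  have space_\<mu>: "space \<mu> = UNIV" using \<mu>(2) sets_eq_imp_space_eq by force
  have bounded_AE: "AE w in M. \<forall>k\<in>Zd d. \<bar>w k\<bar> \<le> R"
    unfolding M_def AE_ball_countable[OF countable_Zd]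
    by (intro ballI AE_PiM_component R \<mu>(1))
  let ?res = "\<lambda>x y w. \<exists>E u v. l2_solution d L f w E u \<and> l2_solution d L f w E v \<and> u x * v y \<noteq> u y * v x"
  have minor_AE: "AE w in M. \<not> ((\<forall>k\<in>Zd d. \<bar>w k\<bar> \<le> R) \<and> ?res x y w)" if x: "x \<in> Zd d" and y: "y \<in> Zd d" for x y
  proof -
    let ?code = "\<lambda>w i. w (from_nat_into (Zd d) i)"
    let ?Q = "\<lambda>j. fst ` resonance_set (Zd d) (dirs d) step
      (\<lambda>n. to_nat_on (Zd d) (cell_index d L n)) (\<lambda>n. f (shiftL L n (cell_index d L n))) R j x y"
    define k where "k = cell_index d L x"
    have k: "k \<in> Zd d" by (simp add: k_def cell_index_in_Zd)
    have x_cell: "x \<in> cell_at d L k"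
      using shiftL_cell_index[OF L_pos x] by (simp add: k_def cell_at_def)
    have "Zd d \<noteq> {}" using x by auto
    have code: "?code \<in> measurable M (PiM UNIV (\<lambda>_. borel))"
    proof (rule measurable_PiM_single')
      fix i
      have "(\<lambda>w. w (from_nat_into (Zd d) i)) \<in> measurable M \<mu>"
        unfolding M_def by (rule measurable_component_singleton) (rule from_nat_into[OF \<open>Zd d \<noteq> {}\<close>])
      then show "(\<lambda>w. w (from_nat_into (Zd d) i)) \<in> measurable M borel"
        using \<mu>(2) measurable_cong_sets by blast
    qed simp
    have Q_sets: "?code -` ?Q j \<inter> space M \<in> sets M" for j
      by (rule measurable_sets[OF code]) (simp add: sets_PiM_equal_borel borel_closed closed_resonance_projection)
    \<comment> \<open>Restriction to \<open>good\<close> is what makes every section null; the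
      remainder is null by \<open>good_AE\<close>.\<close>
    define B where "B = (\<Union>j. ?code -` ?Q j \<inter> space M) \<inter> {w \<in> space M. good k w}"
    have B_sets: "B \<in> sets M"
      unfolding B_def by (intro sets.Int sets.countable_UN good_meas k) (use Q_sets in auto)
    have B_iff: "w \<in> B \<longleftrightarrow> w \<in> space M \<and> (\<forall>k\<in>Zd d. \<bar>w k\<bar> \<le> R) \<and> ?res x y w \<and> good k w" for w
      using resonance_set_iff_solution[OF L_pos x y, of w f R] by (auto simp: B_def)
    have "B \<in> null_sets M"
      unfolding M_def
    proof (rule null_sets_PiM_sectionwise[OF \<mu>(1) k])
      show "B \<in> sets (PiM (Zd d) (\<lambda>_. \<mu>))" using B_sets by (simp add: M_def)
      fix w assume w: "w \<in> space (PiM (Zd d) (\<lambda>_. \<mu>))"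
      let ?N = "{l \<in> space \<mu>. w(k := l) \<in> B}"
      have "(\<lambda>l. w(k := l)) \<in> measurable \<mu> M"
      proof -
        have "(\<lambda>l. w(k := l)) \<in> measurable \<mu> (PiM (insert k (Zd d)) (\<lambda>_. \<mu>))"
          using w by measurable
        then show ?thesis using k by (simp add: insert_absorb M_def)
      qed
      from measurable_sets[OF this B_sets] have N_sets: "?N \<in> sets borel"
        by (simp add: vimage_def Int_def conj_commute \<mu>(2))
      have "negligible ?N"
      proof (cases "?N = {}")
        case True
        then show ?thesis by (simp only: negligible_empty)
      next
        case False
        then obtain l0 where l0: "w(k := l0) \<in> B" by auto
        \<comment> \<open>One point of the section suffices: \<open>no_cell_mode\<close> ignores the
          coupling of cell k, so it holds along the whole section, and the same point supplies the
          bound on the other couplings.\<close>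
        obtain e where "no_cell_mode d L f (w(k := l0)) k e"
          using good[OF k, of "w(k := l0)"] l0 B_iff by blast
        then have mode: "no_cell_mode d L f w k e"
          by simp
        have bnd: "\<bar>w j\<bar> \<le> R" if "j \<in> Zd d" "j \<noteq> k" for j
          using l0 that unfolding B_iff by (metis fun_upd_other)
        show ?thesis
          by (rule negligible_subset[OF resonance_negligible[OF f_pos f_off k bnd mode x_cell x y]])
            (auto simp: B_iff)
      qed
      then show "?N \<in> null_sets \<mu>" using N_sets by (intro null)
    qed
    then have "AE w in M. w \<notin> B" by (rule AE_not_in)
    with good_AE[OF k] AE_space show ?thesis
      by eventually_elim (auto simp: B_iff)
  qed
  have "AE w in M. \<forall>x\<in>Zd d. \<forall>y\<in>Zd d. \<not> ((\<forall>k\<in>Zd d. \<bar>w k\<bar> \<le> R) \<and> ?res x y w)"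
    unfolding AE_ball_countable[OF countable_Zd] using minor_AE by blast
  with bounded_AE show ?thesis
  proof eventually_elim
    case (elim w)
    show ?case
      unfolding all_eigenvalues_simple_def
    proof (intro allI impI)
      fix E u v
      assume uv: "is_eigenvector d L f w E u \<and> is_eigenvector d L f w E v"
      then obtain x where x: "x \<in> Zd d" "u x \<noteq> 0" by (auto simp: is_eigenvector_def)
      have "l2_solution d L f w E u" "l2_solution d L f w E v"
        using uv by (auto simp: is_eigenvector_def l2_solution_def)
      then have "u x * v y = u y * v x" if "y \<in> Zd d" for y
        using elim x(1) that by blast
      then have "v y = v x / u x * u y" if "y \<in> Zd d" for y
        using x(2) that by (simp add: field_simps)
      then show "\<exists>c. \<forall>n\<in>Zd d. v n = c * u n" by blast
    qed
  qed
qed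

lemma no_mode_segment_cell:
  assumes d: "d \<ge> 1" and L: "\<forall>i. 0 < i \<and> i < d \<longrightarrow> L i = 1" and k: "k \<in> Zd d"
    and f: "f = (\<lambda>x. if x \<in> C0 d L then 1 else 0)"
  shows "\<exists>e. no_cell_mode d L f w k e"
proof (intro exI, rule no_mode_path[OF d])
  let ?b = "\<lambda>i. k i * int (L i)"
  show "cell_at d L k = (\<lambda>j. ?b(0 := ?b 0 + int j)) ` {..<L 0}"
  proof (intro equalityI subsetI)
    fix n assume "n \<in> cell_at d L k"
    then have n: "\<forall>i<d. 0 \<le> n i - ?b i \<and> n i - ?b i < int (L i)" "\<forall>i\<ge>d. n i = ?b i"
      by (auto simp: cell_at_def C0_def shiftL_def)
    have n0: "0 \<le> n 0 - ?b 0" "n 0 - ?b 0 < int (L 0)" using n(1) d by auto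
    have "n i = (?b(0 := ?b 0 + int (nat (n 0 - ?b 0)))) i" for i
    proof (cases "i = 0 \<or> i \<ge> d")
      case True
      then show ?thesis using n(2) n0 d by auto
    next
      case False
      then have i: "i < d" "L i = 1" using L by auto
      have "0 \<le> n i - ?b i \<and> n i - ?b i < int (L i)" using n(1) i(1) by blast
      then show ?thesis using False i(2) by simp
    qed
    moreover have "nat (n 0 - ?b 0) < L 0" using n0 by linarith
    ultimately show "n \<in> (\<lambda>j. ?b(0 := ?b 0 + int j)) ` {..<L 0}" by blast
  next
    fix n assume "n \<in> (\<lambda>j. ?b(0 := ?b 0 + int j)) ` {..<L 0}"
    then obtain j where "j < L 0" "n = ?b(0 := ?b 0 + int j)" by blast
    then show "n \<in> cell_at d L k"
      using L d k by (auto simp: cell_at_def C0_def shiftL_def Zd_def)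
  qed
  show "f (shiftL L y k) = 1" if "y \<in> cell_at d L k" for y
    using that by (simp add: f cell_at_def)
  show "potential d L f (w(k := 0)) y = 0" if "y \<in> cell_at d L k" for y
    using that k by (simp add: cell_at_def potential_eq)
qed

text \<open>Moves indices of cells, not sites; in the square case neighbouring cells lie two sites
  apart.\<close>

definition shifted :: "(nat \<Rightarrow> int) \<Rightarrow> int \<Rightarrow> int \<Rightarrow> (nat \<Rightarrow> int)" where
  "shifted k a b = k(0 := k 0 + a, 1 := k 1 + b)"

lemma shifted_eq_iff: "shifted k a b = shifted k a' b' \<longleftrightarrow> a = a' \<and> b = b'"
  by (auto simp: shifted_def fun_eq_iff)

lemma shifted_0: "shifted k 0 0 = k"
  by (simp add: shifted_def)

lemma shifted_in_Zd: "k \<in> Zd 2 \<Longrightarrow> shifted k a b \<in> Zd 2"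
  by (auto simp: Zd_def shifted_def)

lemma no_mode_square_cell:
  assumes L: "L 0 = 2" "L 1 = 2" and k: "k \<in> Zd 2"
    and f: "f = (\<lambda>x. if x \<in> C0 2 L then 1 else 0)"
    and R: "\<forall>j\<in>Zd 2. \<bar>w j\<bar> \<le> R"
    and unbalanced: "w (shifted k (- 1) 0) + w (shifted k 1 0) \<noteq> w (shifted k 0 (- 1)) + w (shifted k 0 1)"
  shows "\<exists>e. no_cell_mode 2 L f w k e"
proof (intro exI)
  let ?b = "\<lambda>i. k i * int (L i)"
  let ?\<sigma> = "\<lambda>i j. ?b(0 := ?b 0 + i, 1 := ?b 1 + j)"
  \<comment> \<open>The site offset i belongs to the cell offset floor (i / 2): the outer neighbours
    of the square, at offsets -1 and 2, lie in the cells -1 and 1.\<close>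
  have in_cell: "shiftL L (?\<sigma> i j) (shifted k a c) \<in> C0 2 L \<longleftrightarrow>
      0 \<le> i - 2 * a \<and> i - 2 * a < 2 \<and> 0 \<le> j - 2 * c \<and> j - 2 * c < 2" for i j a c
    using k by (auto simp: C0_def shiftL_def shifted_def less_2_cases_iff L(1) L(2)[unfolded One_nat_def] algebra_simps Zd_def)
  have V: "potential 2 L f (w(k := 0)) (?\<sigma> i j) = w (shifted k a c)"
    if "0 \<le> i - 2 * a \<and> i - 2 * a < 2 \<and> 0 \<le> j - 2 * c \<and> j - 2 * c < 2" "a \<noteq> 0 \<or> c \<noteq> 0" for i j a c
  proof -
    have "shifted k a c \<noteq> k" using that(2) shifted_eq_iff[of k a c 0 0] by (simp add: shifted_0)
    then show ?thesis
      using potential_eq[OF shifted_in_Zd[OF k] in_cell[THEN iffD2, OF that(1)], of f "w(k := 0)"]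
        in_cell[THEN iffD2, OF that(1)] by (simp add: f)
  qed
  show "no_cell_mode 2 L f w k (\<lambda>x. if x = ?b then 1 else 0)"
  proof (rule no_mode_square)
    show "cell_at 2 L k = {?\<sigma> i j |i j. i \<in> {0, 1} \<and> j \<in> {0, 1}}"
    proof (intro equalityI subsetI)
      fix n assume "n \<in> cell_at 2 L k"
      then have n: "\<forall>i<2. 0 \<le> n i - ?b i \<and> n i - ?b i < int (L i)" "\<forall>i\<ge>2. n i = ?b i"
        by (auto simp: cell_at_def C0_def shiftL_def)
      have "n i = ?\<sigma> (n 0 - ?b 0) (n 1 - ?b 1) i" for i
        using n(2) by (cases "i = 0"; cases "i = 1") auto
      then have "n = ?\<sigma> (n 0 - ?b 0) (n 1 - ?b 1)" by (rule ext)
      moreover have "0 \<le> n 0 - ?b 0 \<and> n 0 - ?b 0 < 2" "0 \<le> n 1 - ?b 1 \<and> n 1 - ?b 1 < 2"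
        using n(1)[rule_format, of 0] n(1)[rule_format, of 1] L by auto
      then have "n 0 - ?b 0 \<in> {0, 1}" "n 1 - ?b 1 \<in> {0, 1}" by auto
      ultimately show "n \<in> {?\<sigma> i j |i j. i \<in> {0, 1} \<and> j \<in> {0, 1}}" by blast
    next
      fix n assume "n \<in> {?\<sigma> i j |i j. i \<in> {0, 1} \<and> j \<in> {0, 1}}"
      then obtain i j where "n = ?\<sigma> i j" "i \<in> {0, 1}" "j \<in> {0, 1}" by blast
      then show "n \<in> cell_at 2 L k"
        using in_cell[of i j 0 0] by (auto simp: cell_at_def shifted_0)
    qed
    show "f (shiftL L y k) = 1" "potential 2 L f (w(k := 0)) y = 0" if "y \<in> cell_at 2 L k" for y
      using that k by (simp_all add: f cell_at_def potential_eq)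
    show "f (shiftL L y k) = 0" if "y \<notin> cell_at 2 L k" for y
      using that by (simp add: f cell_at_def)
    have "0 \<le> R" using R k by (meson abs_ge_zero order_trans)
    then show "\<bar>potential 2 L f (w(k := 0)) y\<bar> \<le> R * (\<Sum>x\<in>C0 2 L. f x)" for y
      using R by (intro potential_bounded) (auto simp: f)
    show "w (shifted k (- 1) 0) + w (shifted k 1 0) \<noteq> w (shifted k 0 (- 1)) + w (shifted k 0 1)"
      by (rule unbalanced)
  qed (rule V; simp)+
qed

lemma measurable_unbalanced:
  fixes \<mu> :: "real measure"
  assumes k: "k \<in> Zd 2" and \<mu>: "sets \<mu> = sets borel"
  shows "{w \<in> space (PiM (Zd 2) (\<lambda>_. \<mu>)). w (shifted k (- 1) 0) + w (shifted k 1 0) =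
    w (shifted k 0 (- 1)) + w (shifted k 0 1)} \<in> sets (PiM (Zd 2) (\<lambda>_. \<mu>))"
proof -
  have [measurable]: "(\<lambda>w. w (shifted k a b)) \<in> borel_measurable (PiM (Zd 2) (\<lambda>_. \<mu>))" for a b
    using measurable_component_singleton[OF shifted_in_Zd[OF k], where M = "\<lambda>_. \<mu>"] \<mu> measurable_cong_sets
    by blast
  show ?thesis by measurable
qed

theorem theorem1p3:
  fixes d :: nat and L :: "nat \<Rightarrow> nat" and f :: "(nat \<Rightarrow> int) \<Rightarrow> real"
    and \<mu> :: "real measure" and \<rho> :: "real \<Rightarrow> real"
  assumes L_pos: "\<forall>i<d. L i \<ge> 1"
    and f_pos: "\<forall>x\<in>C0 d L. f x > 0"
    and f_zero: "\<forall>x. x \<notin> C0 d L \<longrightarrow> f x = 0"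
    and mu_prob: "prob_space \<mu>"
    and mu_dens: "\<mu> = density lborel (\<lambda>x. ennreal (\<rho> x))"
    and rho_meas: "\<rho> \<in> borel_measurable borel"
    and rho_nonneg: "\<forall>x. \<rho> x \<ge> 0"
    and rho_bdd: "\<exists>B. \<forall>x. \<rho> x \<le> B"
    and rho_supp: "compact (closure {x. \<rho> x \<noteq> 0})"
    and cases:
      "inj_on f (C0 d L)
       \<or> (d \<ge> 1 \<and> (\<forall>i. 0 < i \<and> i < d \<longrightarrow> L i = 1)
            \<and> f = (\<lambda>x. if x \<in> C0 d L then 1 else 0))
       \<or> (d = 2 \<and> L 0 = 2 \<and> L 1 = 2 \<and> f = (\<lambda>x. if x \<in> C0 d L then 1 else 0))"
  shows "AE \<omega> in PiM (Zd d) (\<lambda>_. \<mu>). all_eigenvalues_simple d L f \<omega>"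
proof -
  have sets_\<mu>: "sets \<mu> = sets borel" by (simp add: mu_dens)
  have null: "N \<in> null_sets \<mu>" if N: "N \<in> sets borel" "negligible N" for N
  proof -
    have "N \<in> null_sets lborel"
      using N by (simp add: negligible_iff_null_sets null_sets_completion_iff)
    then have "AE x in lborel. x \<notin> N" by (rule AE_not_in)
    then show ?thesis
      unfolding mu_dens using N(1) rho_meas by (subst null_sets_density_iff) auto
  qed
  obtain R where R: "\<And>x. x \<in> closure {x. \<rho> x \<noteq> 0} \<Longrightarrow> \<bar>x\<bar> \<le> R"
  proof -
    have "\<exists>R. \<forall>x\<in>closure {x. \<rho> x \<noteq> 0}. norm x \<le> R"
      using compact_imp_bounded[OF rho_supp] by (simp only: bounded_iff)
    then show ?thesis using that by (metis real_norm_def)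
  qed
  have "\<bar>t\<bar> \<le> R" if "\<rho> t \<noteq> 0" for t
    by (rule R, rule subsetD[OF closure_subset]) (use that in simp)
  then have R_AE: "AE t in \<mu>. \<bar>t\<bar> \<le> R"
    unfolding mu_dens using rho_meas by (subst AE_density) (auto intro!: AE_I2)
  show ?thesis
    using cases
  proof (elim disjE conjE)
    assume inj: "inj_on f (C0 d L)"
    show ?thesis
    proof (rule AE_simple_of_no_mode[OF L_pos f_pos f_zero mu_prob sets_\<mu> null R_AE, of "\<lambda>_ _. True"])
      fix k w assume k: "k \<in> Zd d"
      have "inj (\<lambda>n. shiftL L n k)" by (rule injI) (simp add: shiftL_def fun_eq_iff)
      then have "inj_on (\<lambda>n. f (shiftL L n k)) (cell_at d L k)"
        using inj by (auto simp: inj_on_def cell_at_def)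
      from no_mode_injective[OF finite_cell_at _ this]
      show "\<exists>e. no_cell_mode d L f w k e"
        using f_pos k by (intro exI[of _ "\<lambda>_. 1"]) (simp add: cell_at_def potential_eq)
    qed auto
  next
    assume "1 \<le> d" "\<forall>i. 0 < i \<and> i < d \<longrightarrow> L i = 1" "f = (\<lambda>x. if x \<in> C0 d L then 1 else 0)"
    then show ?thesis
      by (intro AE_simple_of_no_mode[OF L_pos f_pos f_zero mu_prob sets_\<mu> null R_AE, of "\<lambda>_ _. True"]
          no_mode_segment_cell) auto
  next
    assume sq: "d = 2" "L 0 = 2" "L 1 = 2" "f = (\<lambda>x. if x \<in> C0 d L then 1 else 0)"
    \<comment> \<open>This fails only on a hyperplane in the four adjacent couplings, which is null
      because the distribution has a density.\<close>
    let ?good = "\<lambda>k w. w (shifted k (- 1) 0) + w (shifted k 1 0) \<noteq> w (shifted k 0 (- 1)) + (w (shifted k 0 1) :: real)"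
    show ?thesis
    proof (rule AE_simple_of_no_mode[OF L_pos f_pos f_zero mu_prob sets_\<mu> null R_AE, of ?good])
      fix k assume k: "k \<in> Zd d"
      let ?M = "PiM (Zd d) (\<lambda>_. \<mu>)"
      let ?B = "{w \<in> space ?M. w (shifted k (- 1) 0) + w (shifted k 1 0) = w (shifted k 0 (- 1)) + w (shifted k 0 1)}"
      have B: "?B \<in> sets ?M" using measurable_unbalanced[OF _ sets_\<mu>, of k] k by (simp add: sq(1))
      have "{w \<in> space ?M. ?good k w} = space ?M - ?B" by auto
      then show "{w \<in> space ?M. ?good k w} \<in> sets ?M" using B by simp
      have "?B \<in> null_sets ?M"
      \<comment> \<open>With all other couplings fixed, the equation determines the coupling of the
        right neighbour.\<close>
      proof (rule null_sets_PiM_sectionwise[OF mu_prob _ B])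
        show "shifted k 1 0 \<in> Zd d" using k shifted_in_Zd by (simp add: sq(1))
        fix w
        have "{l \<in> space \<mu>. w(shifted k 1 0 := l) \<in> ?B} \<subseteq>
            {w (shifted k 0 (- 1)) + w (shifted k 0 1) - w (shifted k (- 1) 0)}"
          by (auto simp: shifted_eq_iff)
        moreover have "{w (shifted k 0 (- 1)) + w (shifted k 0 1) - w (shifted k (- 1) 0)} \<in> null_sets \<mu>"
          by (rule null) auto
        moreover have "finite {l \<in> space \<mu>. w(shifted k 1 0 := l) \<in> ?B}"
          by (rule finite_subset[OF calculation(1)]) simp
        ultimately show "{l \<in> space \<mu>. w(shifted k 1 0 := l) \<in> ?B} \<in> null_sets \<mu>"
          by (intro null negligible_finite borel_closed finite_imp_closed)
      qed
      from AE_not_in[OF this] AE_space show "AE w in ?M. ?good k w"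
        by eventually_elim auto
    next
      fix k w assume "k \<in> Zd d" "?good k w" "\<forall>j\<in>Zd d. \<bar>w j\<bar> \<le> R"
      then show "\<exists>e. no_cell_mode d L f w k e"
        using no_mode_square_cell[of L k f w R] sq by blast
    qed
  qed
qed

end
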